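(* Let $a>0$, $b>0$, $\theta\in\mathbb{R}$, and let $p^\theta(t,x)$ be the probability density function of the drifted Variance Gamma process $X^\theta$ with parameters $a,b$ and drift $\theta$. Then $$\frac{\partial}{\partial t}p^\theta(t,x)=-\left(\mathcal{D}^{+}_{a,\sqrt{\frac{\theta^2}{4}+b}-\frac{\theta}{2}}\,p^\theta(t,x)+\mathcal{D}^{-}_{a,\sqrt{\frac{\theta^2}{4}+b}+\frac{\theta}{2}}\,p^\theta(t,x)\right),\qquad t>0,\ x\in\mathbb{R},$$ with $p^\theta(0,x)=\delta(x)$, where the operators $\mathcal{D}^{\pm}$ act on the variable $x$.
   Context: **Drifted Variance Gamma process.** Fix $a,b>0$ and $\theta\in\mathbb{R}$. Let $H=\{H_t,t\ge 0\}$ be the Gamma subordinator started at $0$ with $\mathbf{E}[e^{-\lambda H_t}]=e^{-t\,a\ln(1+\lambda/b)}$ for $\lambda>0$; for $t>0$ its density is $h(t,s)=\frac{b^{at}}{\Gamma(at)}s^{at-1}e^{-bs}$ for $s>0$ and $h(t,s)=0$ for $s\le 0$. Let $B^\theta=\{B^\theta_t,t\ge0\}$ be a one-dimensional drifted Brownian motion started at $0$, independent of $H$, with density $g^\theta(t,x)=e^{-(x-\theta t)^2/(4t)}/\sqrt{4\pi t}$. The drifted Variance Gamma process is $X^\theta_t=B^\theta_{H_t}$; its density is $p^\theta(t,x)=\int_0^\infty g^\theta(s,x)h(t,s)\,ds$ for $t>0$. $\delta$ is the Dirac delta at $0$. **Generalized Weyl derivatives.** For $\alpha,\beta>0$ let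 $\overline{\Pi}_{\alpha,\beta}(z)=\alpha\int_z^\infty \frac{e^{-\beta y}}{y}\,dy$, $z>0$ (the tail of the Lévy measure $\Pi_{\alpha,\beta}(dy)=\alpha\frac{e^{-\beta y}}{y}dy$ on $(0,\infty)$). For $x\in\mathbb{R}$ define $$\mathcal{D}_{\alpha,\beta}^{+}u(x)=\frac{\partial}{\partial x}\int_{-\infty}^{x}u(s)\,\overline{\Pi}_{\alpha,\beta}(x-s)\,ds,\qquad \mathcal{D}_{\alpha,\beta}^{-}u(x)=-\frac{\partial}{\partial x}\int_{x}^{\infty}u(s)\,\overline{\Pi}_{\alpha,\beta}(s-x)\,ds,$$ respectively for functions $u$ such that $s\mapsto u(s)\overline{\Pi}_{\alpha,\beta}(x-s)\in L^1(-\infty,x)$ and $s\mapsto u(s)\overline{\Pi}_{\alpha,\beta}(s-x)\in L^1(x,\infty)$, for all $x\in\mathbb{R}$.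
   Formalization: The equation is asserted for t>0 and x where the density p(t,x) is finite; this excludes only x=0 with at ≤ 1/2, where the defining integral diverges, p(t,0)=+∞ and the time derivative is undefined. *)

theory Defs
  imports "HOL-Probability.Probability"
begin

definition starts_at_zero :: "'w measure \<Rightarrow> (real \<Rightarrow> 'w \<Rightarrow> real) \<Rightarrow> bool" where
  "starts_at_zero M X \<longleftrightarrow> (\<forall>\<omega>\<in>space M. X 0 \<omega> = 0)"

definition independent_increments :: "'w measure \<Rightarrow> (real \<Rightarrow> 'w \<Rightarrow> real) \<Rightarrow> bool" where
  "independent_increments M X \<longleftrightarrow>
     (\<forall>n (\<tau> :: nat \<Rightarrow> real). 0 \<le> \<tau> 0 \<longrightarrow> mono \<tau> \<longrightarrow>
        prob_space.indep_vars M (\<lambda>_. borel) (\<lambda>i \<omega>. X (\<tau> (Suc i)) \<omega> - X (\<tau> i) \<omega>) {..<n})"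

definition stationary_increments :: "'w measure \<Rightarrow> (real \<Rightarrow> 'w \<Rightarrow> real) \<Rightarrow> bool" where
  "stationary_increments M X \<longleftrightarrow>
     (\<forall>s t. 0 \<le> s \<longrightarrow> s \<le> t \<longrightarrow>
        distr M borel (\<lambda>\<omega>. X t \<omega> - X s \<omega>) = distr M borel (\<lambda>\<omega>. X (t - s) \<omega>))"

text \<open>Processes are indexed by \<open>real\<close>, but only the times \<open>t \<ge> 0\<close> are constrained or used.
  Path properties are required of every \<open>\<omega> \<in> space M\<close>, so that the subordinated process
  below is a random variable even if \<open>M\<close> is not complete.\<close>

definition gamma_subordinator ::
  "'w measure \<Rightarrow> real \<Rightarrow> real \<Rightarrow> (real \<Rightarrow> 'w \<Rightarrow> real) \<Rightarrow> bool" where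
  "gamma_subordinator M a b H \<longleftrightarrow>
     (\<forall>t\<ge>0. H t \<in> borel_measurable M) \<and>
     starts_at_zero M H \<and> independent_increments M H \<and> stationary_increments M H \<and>
     (\<forall>\<omega>\<in>space M. mono_on {0..} (\<lambda>t. H t \<omega>) \<and>
        (\<forall>t\<ge>0. continuous (at_right t) (\<lambda>t. H t \<omega>))) \<and>
     (\<forall>t\<ge>0. \<forall>l>0. integral\<^sup>L M (\<lambda>\<omega>. exp (- l * H t \<omega>)) = exp (- t * (a * ln (1 + l / b))))"

definition drifted_bm_density :: "real \<Rightarrow> real \<Rightarrow> real \<Rightarrow> real" where
  "drifted_bm_density \<theta> t x = exp (- (x - \<theta> * t)\<^sup>2 / (4 * t)) / sqrt (4 * pi * t)"

text \<open>The driving Brownian motion has variance \<open>2 * t\<close> at time \<open>t\<close>.\<close>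

definition drifted_brownian_motion ::
  "'w measure \<Rightarrow> real \<Rightarrow> (real \<Rightarrow> 'w \<Rightarrow> real) \<Rightarrow> bool" where
  "drifted_brownian_motion M \<theta> B \<longleftrightarrow>
     (\<forall>t\<ge>0. B t \<in> borel_measurable M) \<and>
     starts_at_zero M B \<and> independent_increments M B \<and>
     (\<forall>s t. 0 \<le> s \<longrightarrow> s < t \<longrightarrow>
        distributed M lborel (\<lambda>\<omega>. B t \<omega> - B s \<omega>) (\<lambda>x. ennreal (drifted_bm_density \<theta> (t - s) x))) \<and>
     (\<forall>\<omega>\<in>space M. continuous_on {0..} (\<lambda>t. B t \<omega>))"

definition independent_processes ::
  "'w measure \<Rightarrow> (real \<Rightarrow> 'w \<Rightarrow> real) \<Rightarrow> (real \<Rightarrow> 'w \<Rightarrow> real) \<Rightarrow> bool" where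
  "independent_processes M X Y \<longleftrightarrow>
     prob_space.indep_var M
       (PiM {0..} (\<lambda>_. borel)) (\<lambda>\<omega>. \<lambda>t\<in>{0..}. X t \<omega>)
       (PiM {0..} (\<lambda>_. borel)) (\<lambda>\<omega>. \<lambda>t\<in>{0..}. Y t \<omega>)"

definition subordinated ::
  "(real \<Rightarrow> 'w \<Rightarrow> real) \<Rightarrow> (real \<Rightarrow> 'w \<Rightarrow> real) \<Rightarrow> real \<Rightarrow> 'w \<Rightarrow> real" where
  "subordinated B H t \<omega> = B (H t \<omega>) \<omega>"

definition gamma_density :: "real \<Rightarrow> real \<Rightarrow> real \<Rightarrow> real \<Rightarrow> real" where
  "gamma_density a b t s =
     (if s > 0 then b powr (a * t) / Gamma (a * t) * s powr (a * t - 1) * exp (- b * s) else 0)"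

definition vg_integrand :: "real \<Rightarrow> real \<Rightarrow> real \<Rightarrow> real \<Rightarrow> real \<Rightarrow> real \<Rightarrow> real" where
  "vg_integrand a b \<theta> t x s = drifted_bm_density \<theta> s x * gamma_density a b t s"

definition vg_density :: "real \<Rightarrow> real \<Rightarrow> real \<Rightarrow> real \<Rightarrow> real \<Rightarrow> real" where
  "vg_density a b \<theta> t x = (LBINT s:{0<..}. vg_integrand a b \<theta> t x s)"

text \<open>The density is finite at \<open>(t, x)\<close>. As the integrand is nonnegative, this fails only where
  the density is \<open>+\<infinity>\<close>, which for \<open>t > 0\<close> happens exactly if \<open>x = 0\<close> and \<open>a * t \<le> 1/2\<close>: there
  the integrand behaves like a multiple of \<open>s powr (a * t - 3/2)\<close> near \<open>s = 0\<close>
  (and \<open>vg_density\<close> takes the junk value \<open>0\<close>).\<close>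

definition vg_density_finite :: "real \<Rightarrow> real \<Rightarrow> real \<Rightarrow> real \<Rightarrow> real \<Rightarrow> bool" where
  "vg_density_finite a b \<theta> t x \<longleftrightarrow> set_integrable lborel {0<..} (vg_integrand a b \<theta> t x)"

definition levy_tail :: "real \<Rightarrow> real \<Rightarrow> real \<Rightarrow> real" where
  "levy_tail \<alpha> \<beta> z = \<alpha> * (LBINT y:{z<..}. exp (- \<beta> * y) / y)"

definition weyl_plus_integral :: "real \<Rightarrow> real \<Rightarrow> (real \<Rightarrow> real) \<Rightarrow> real \<Rightarrow> real" where
  "weyl_plus_integral \<alpha> \<beta> u x = (LBINT s:{..<x}. u s * levy_tail \<alpha> \<beta> (x - s))"

definition weyl_minus_integral :: "real \<Rightarrow> real \<Rightarrow> (real \<Rightarrow> real) \<Rightarrow> real \<Rightarrow> real" where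
  "weyl_minus_integral \<alpha> \<beta> u x = (LBINT s:{x<..}. u s * levy_tail \<alpha> \<beta> (s - x))"

definition weyl_plus_domain :: "real \<Rightarrow> real \<Rightarrow> (real \<Rightarrow> real) \<Rightarrow> bool" where
  "weyl_plus_domain \<alpha> \<beta> u \<longleftrightarrow>
     (\<forall>x. set_integrable lborel {..<x} (\<lambda>s. u s * levy_tail \<alpha> \<beta> (x - s)))"

definition weyl_minus_domain :: "real \<Rightarrow> real \<Rightarrow> (real \<Rightarrow> real) \<Rightarrow> bool" where
  "weyl_minus_domain \<alpha> \<beta> u \<longleftrightarrow>
     (\<forall>x. set_integrable lborel {x<..} (\<lambda>s. u s * levy_tail \<alpha> \<beta> (s - x)))"

text \<open>\<open>deriv\<close> is total: a claim about the following operators is meaningful only together with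
  the domain condition and differentiability of the integral at \<open>x\<close>.\<close>

definition weyl_plus :: "real \<Rightarrow> real \<Rightarrow> (real \<Rightarrow> real) \<Rightarrow> real \<Rightarrow> real" where
  "weyl_plus \<alpha> \<beta> u x = deriv (weyl_plus_integral \<alpha> \<beta> u) x"

definition weyl_minus :: "real \<Rightarrow> real \<Rightarrow> (real \<Rightarrow> real) \<Rightarrow> real \<Rightarrow> real" where
  "weyl_minus \<alpha> \<beta> u x = - deriv (weyl_minus_integral \<alpha> \<beta> u) x"

end

theory Submission
  imports Defs
begin

text \<open>The factorization \<open>b - \<theta> * z - z\<^sup>2 = (\<beta>p - z) * (\<beta>m + z)\<close> of the symbol shows that a variance gamma
  variable is a difference of independent gamma variables of rates \<open>\<beta>p\<close>, \<open>\<beta>m\<close> and common shape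
  \<open>a * t\<close>, so \<open>p t\<close> is a correlation integral of two gamma densities. For a gamma density
  \<open>gam \<beta> c\<close> the semigroup property in the shape \<open>c\<close> gives that its convolution with the Levy tail is
  the derivative in \<open>c\<close> of its survival function. Integrating this against the other gamma factor
  turns the Weyl integrals of \<open>p t\<close> into tail integrals, and its Weyl derivatives are minus the two
  terms which the product rule yields for the derivative of \<open>p t x\<close> in \<open>t\<close>. Near \<open>x = 0\<close> the
  correlation integrals are continuous once \<open>a * t > 1 / 2\<close>, which is exactly finiteness of the
  density there.\<close>

section \<open>Gamma densities\<close>

text \<open>The quadratic is the one in the exponential moment
  \<open>(b / (b - \<theta> * z - z\<^sup>2)) powr (a * t)\<close> of the process, and
  \<open>\<beta>p\<close>, \<open>- \<beta>m\<close> are its roots. Comparing transforms would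
  identify two densities only almost everywhere, while the equation and its finiteness condition
  refer to a single point \<open>x\<close>; so the correlation formula is proved at each
  \<open>x\<close>, between nonnegative integrals that may be infinite. The Levy tail enters through
  \<open>Gamma (1 + d) = d * Gamma d\<close>: the gamma density of small shape \<open>d\<close>,
  divided by \<open>d\<close>, tends to \<open>exp (- \<beta> * y) / y\<close>. Differentiation in
  the shape brings a logarithm, hence a change of sign, on top of the singularity at 0, so the
  passages to the limit need explicit majorants. The tail form of the Weyl integrals rests on
  integrability alone and holds for all \<open>x\<close> and \<open>t > 0\<close>; a condition at
  \<open>x\<close> enters only when the tail integral is differentiated there, and in the time
  derivative.\<close>

definition gam :: "real \<Rightarrow> real \<Rightarrow> real \<Rightarrow> real" where
  "gam \<beta> c z = (if z > 0 then \<beta> powr c / Gamma c * z powr (c - 1) * exp (- \<beta> * z) else 0)"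

lemma gamma_density_eq: "gamma_density a b t = gam b (a * t)"
  by (simp add: fun_eq_iff gamma_density_def gam_def)

lemma measurable_gam [measurable]: "gam \<beta> c \<in> borel_measurable borel"
  unfolding gam_def by measurable

lemma gam_nonneg [simp]: "c > 0 \<Longrightarrow> gam \<beta> c z \<ge> 0"
  by (auto simp: gam_def intro!: mult_nonneg_nonneg divide_nonneg_pos)

lemma nn_integral_powr_exp:
  fixes \<beta> c :: real
  assumes "\<beta> > 0" "c > 0"
  shows "(\<integral>\<^sup>+z. ennreal (z powr (c - 1) * exp (- \<beta> * z)) * indicator {0<..} z \<partial>lborel)
           = ennreal (Gamma c / \<beta> powr c)"
proof -
  let ?f = "\<lambda>z. ennreal (z powr (c - 1) * exp (- \<beta> * z)) * indicator {0<..} z"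
  have "(\<integral>\<^sup>+z. ?f z \<partial>lborel) = ennreal (1 / \<beta>) * (\<integral>\<^sup>+u. ?f (u / \<beta>) \<partial>lborel)"
    using nn_integral_real_affine[of ?f "1 / \<beta>" 0] assms by simp
  also have "(\<integral>\<^sup>+u. ?f (u / \<beta>) \<partial>lborel) =
     (\<integral>\<^sup>+u. ennreal (1 / \<beta> powr (c - 1)) * ennreal (indicator {0..} u * u powr (c - 1) / exp u) \<partial>lborel)"
    using assms
    by (intro nn_integral_cong_AE AE_I[of _ _ "{0}"])
       (auto simp: indicator_def exp_minus powr_divide divide_simps ennreal_mult'[symmetric] split: if_splits)
  also have "\<dots> = ennreal (1 / \<beta> powr (c - 1)) * ennreal (Gamma c)"
    using assms by (subst nn_integral_cmult) (auto simp: Gamma_conv_nn_integral_real)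
  also have "ennreal (1 / \<beta>) * \<dots> = ennreal (Gamma c / \<beta> powr c)"
    using assms by (simp add: ennreal_mult'[symmetric] powr_diff)
  finally show ?thesis .
qed

lemma set_integrable_powr_exp:
  fixes \<beta> c :: real
  assumes "\<beta> > 0" "c > 0"
  shows "set_integrable lborel {0<..} (\<lambda>z. z powr (c - 1) * exp (- \<beta> * z))"
  unfolding set_integrable_def
proof (rule integrableI_nonneg)
  have "(\<integral>\<^sup>+z. ennreal (indicator {0<..} z *\<^sub>R (z powr (c - 1) * exp (- \<beta> * z))) \<partial>lborel)
       = (\<integral>\<^sup>+z. ennreal (z powr (c - 1) * exp (- \<beta> * z)) * indicator {0<..} z \<partial>lborel)"
    by (intro nn_integral_cong) (auto simp: indicator_def)
  then show "(\<integral>\<^sup>+z. ennreal (indicator {0<..} z *\<^sub>R (z powr (c - 1) * exp (- \<beta> * z))) \<partial>lborel) < \<infinity>"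
    using assms by (simp only: nn_integral_powr_exp) simp
qed (auto simp: indicator_def)

lemma nn_integral_gam_exp:
  assumes "\<beta> > 0" "c > 0" "l \<ge> 0"
  shows "(\<integral>\<^sup>+z. ennreal (gam \<beta> c z * exp (- l * z)) \<partial>lborel) = ennreal ((\<beta> / (\<beta> + l)) powr c)"
proof -
  have "(\<integral>\<^sup>+z. ennreal (gam \<beta> c z * exp (- l * z)) \<partial>lborel) =
        (\<integral>\<^sup>+z. ennreal (\<beta> powr c / Gamma c) *
           (ennreal (z powr (c - 1) * exp (- (\<beta> + l) * z)) * indicator {0<..} z) \<partial>lborel)"
    using assms
    by (intro nn_integral_cong)
       (auto simp: gam_def indicator_def ennreal_mult'[symmetric] exp_add[symmetric] algebra_simps)
  also have "\<dots> = ennreal (\<beta> powr c / Gamma c) * ennreal (Gamma c / (\<beta> + l) powr c)"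
    using nn_integral_powr_exp[of "\<beta> + l" c] assms by (subst nn_integral_cmult) auto
  also have "\<dots> = ennreal ((\<beta> / (\<beta> + l)) powr c)"
    using assms Gamma_real_pos[of c, THEN less_imp_neq] by (simp add: ennreal_mult'[symmetric] powr_divide)
  finally show ?thesis .
qed

lemma nn_integral_gam:
  assumes "\<beta> > 0" "c > 0"
  shows "(\<integral>\<^sup>+z. ennreal (gam \<beta> c z) \<partial>lborel) = 1"
  using nn_integral_gam_exp[OF assms, of 0] assms by simp

lemma integrable_gam:
  assumes "\<beta> > 0" "c > 0"
  shows "integrable lborel (gam \<beta> c)"
  using assms by (intro integrableI_nonneg) (auto simp: nn_integral_gam)

lemma integral_gam:
  assumes "\<beta> > 0" "c > 0"
  shows "(\<integral>z. gam \<beta> c z \<partial>lborel) = 1"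
  using assms by (subst integral_eq_nn_integral) (auto simp: nn_integral_gam)

text \<open>The maximum is at \<open>z = p / \<kappa>\<close>; the bound is the value there without
  the factor \<open>exp (- p)\<close>, and follows from \<open>ln u \<le> u - 1\<close> at
  \<open>u = z * \<kappa> / p\<close>.\<close>

lemma powr_exp_le:
  fixes p \<kappa> z :: real
  assumes "p > 0" "\<kappa> > 0" "z > 0"
  shows "z powr p * exp (- \<kappa> * z) \<le> (p / \<kappa>) powr p"
proof -
  have "ln (z * \<kappa> / p) \<le> z * \<kappa> / p - 1"
    using assms by (intro ln_le_minus_one) auto
  then have "p * ln z - p * ln (p / \<kappa>) \<le> \<kappa> * z - p"
    using assms by (simp add: ln_mult ln_div field_simps)
  then have "p * ln z - \<kappa> * z \<le> p * ln (p / \<kappa>)"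
    using assms by linarith
  then have "exp (p * ln z - \<kappa> * z) \<le> exp (p * ln (p / \<kappa>))"
    by simp
  then show ?thesis
    using assms by (simp add: powr_def exp_diff exp_minus field_simps)
qed

text \<open>Half of the exponential rate is given up to absorb logarithm and powers at infinity, and
  the exponent is worsened from \<open>1 - c\<close> to any larger \<open>\<eta>\<close> to absorb
  the logarithm at 0. The factor \<open>1 + \<bar>ln z\<bar>\<close> serves the density and its
  shape derivative at once.\<close>

lemma gam_log_bound:
  fixes \<beta> c \<eta> :: real
  assumes "\<beta> > 0" "c > 0" "1 - c < \<eta>"
  obtains C where "C > 0"
    "\<And>z. z > 0 \<Longrightarrow> gam \<beta> c z * (1 + \<bar>ln z\<bar>) \<le> C * (z powr (- \<eta>) * exp (- (\<beta> / 2) * z))"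
proof -
  define m where "m = c - 1 + \<eta>"
  have m: "m > 0" using assms by (simp add: m_def)
  \<comment> \<open>The entries belong to \<open>z \<le> 1\<close>, where
    \<open>- m * ln z \<le> z powr (- m)\<close>, and to \<open>z > 1\<close>, where replacing the
    logarithm by \<open>2 * z\<close> raises the exponent to \<open>m + 1\<close> in
    \<open>powr_exp_le\<close>.\<close>
  define D where "D = max (1 + 1 / m) (2 * ((m + 1) / (\<beta> / 2)) powr (m + 1))"
  have D: "z powr m * (1 + \<bar>ln z\<bar>) * exp (- (\<beta> / 2) * z) \<le> D" if z: "z > 0" for z
  proof (cases "z \<le> 1")
    case True
    have "- m * ln z \<le> z powr (- m)"
      using ln_le_minus_one[of "z powr (- m)"] z by (simp add: ln_powr)
    then have "z powr m * (- m * ln z) \<le> z powr m * z powr (- m)"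
      by (intro mult_left_mono) auto
    then have "z powr m * \<bar>ln z\<bar> \<le> 1 / m"
      using z True m by (simp add: powr_add[symmetric] field_simps)
    moreover have "z powr m \<le> 1"
      using z True m by (simp add: powr_le1)
    ultimately have "z powr m * (1 + \<bar>ln z\<bar>) \<le> 1 + 1 / m"
      by (simp add: distrib_left)
    moreover have "exp (- (\<beta> / 2) * z) \<le> 1"
      using z assms by simp
    ultimately have "z powr m * (1 + \<bar>ln z\<bar>) * exp (- (\<beta> / 2) * z) \<le> (1 + 1 / m) * 1"
      using m by (intro mult_mono) auto
    then show ?thesis by (simp add: D_def)
  next
    case False
    have "1 + \<bar>ln z\<bar> \<le> 2 * z"
      using False ln_le_minus_one[of z] by auto
    then have "z powr m * (1 + \<bar>ln z\<bar>) * exp (- (\<beta> / 2) * z) \<le> z powr m * (2 * z) * exp (- (\<beta> / 2) * z)"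
      by (intro mult_right_mono mult_left_mono) auto
    also have "\<dots> = 2 * (z powr (m + 1) * exp (- (\<beta> / 2) * z))"
      using z by (simp add: powr_add)
    also have "\<dots> \<le> 2 * ((m + 1) / (\<beta> / 2)) powr (m + 1)"
      using powr_exp_le[of "m + 1" "\<beta> / 2" z] m assms z by simp
    finally show ?thesis by (simp add: D_def)
  qed
  have "1 + 1 / m > 0" using m by (simp add: add_pos_pos)
  then have "D > 0" unfolding D_def by linarith
  have "gam \<beta> c z * (1 + \<bar>ln z\<bar>) \<le> (\<beta> powr c / Gamma c * D) * (z powr (- \<eta>) * exp (- (\<beta> / 2) * z))"
    if z: "z > 0" for z
  proof -
    have "gam \<beta> c z * (1 + \<bar>ln z\<bar>) = (\<beta> powr c / Gamma c) *
        (z powr m * (1 + \<bar>ln z\<bar>) * exp (- (\<beta> / 2) * z)) * (z powr (- \<eta>) * exp (- (\<beta> / 2) * z))"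
    proof -
      have "z powr (c - 1) = z powr m * z powr (- \<eta>)"
        by (simp add: m_def powr_add[symmetric])
      moreover have "exp (- \<beta> * z) = exp (- (\<beta> / 2) * z) * exp (- (\<beta> / 2) * z)"
        by (simp add: exp_add[symmetric])
      ultimately show ?thesis using z by (simp add: gam_def)
    qed
    also have "\<dots> \<le> (\<beta> powr c / Gamma c) * D * (z powr (- \<eta>) * exp (- (\<beta> / 2) * z))"
      using D[OF z] assms by (intro mult_right_mono mult_left_mono) auto
    finally show ?thesis .
  qed
  then show thesis
    using that[of "\<beta> powr c / Gamma c * D"] \<open>D > 0\<close> assms by simp
qed

text \<open>Integrability at the outer parameters \<open>c - \<delta>\<close> and
  \<open>c + \<delta>\<close> controls everything between:
  \<open>exp (\<delta> * \<bar>l\<bar>)\<close> is at most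
  \<open>exp (- \<delta> * l) + exp (\<delta> * l)\<close>, so the factor \<open>L y\<close> and all
  small difference quotients fit below one majorant.\<close>

lemma
  fixes w L :: "'a \<Rightarrow> real" and c \<delta> :: real
  assumes \<delta>: "\<delta> > 0"
    and [measurable]: "w \<in> borel_measurable M" "L \<in> borel_measurable M"
    and m: "integrable M (\<lambda>y. w y * exp ((c - \<delta>) * L y))"
    and p: "integrable M (\<lambda>y. w y * exp ((c + \<delta>) * L y))"
  shows integrable_exp_family_log: "integrable M (\<lambda>y. w y * L y * exp (c * L y))"
    and has_real_derivative_exp_family: "((\<lambda>c. \<integral>y. w y * exp (c * L y) \<partial>M) has_real_derivative
           (\<integral>y. w y * L y * exp (c * L y) \<partial>M)) (at c)"
proof -
  \<comment> \<open>Half of the margin \<open>\<delta>\<close> pays for increments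
    \<open>\<bar>h\<bar> \<le> \<delta> / 2\<close>, the other half for the factor
    \<open>\<bar>L y\<bar>\<close>; the constant comes from \<open>u \<le> exp u\<close> at
    \<open>u = \<delta> / 2 * \<bar>l\<bar>\<close>.\<close>
  define B where "B y = 2 / \<delta> * \<bar>w y\<bar> * (exp ((c - \<delta>) * L y) + exp ((c + \<delta>) * L y))" for y
  have [measurable]: "B \<in> borel_measurable M" unfolding B_def by measurable
  have "integrable M (\<lambda>y. 2 / \<delta> * (\<bar>w y * exp ((c - \<delta>) * L y)\<bar> + \<bar>w y * exp ((c + \<delta>) * L y)\<bar>))"
    using m p by (intro integrable_mult_right Bochner_Integration.integrable_add integrable_abs)
  moreover have "(\<lambda>y. 2 / \<delta> * (\<bar>w y * exp ((c - \<delta>) * L y)\<bar> + \<bar>w y * exp ((c + \<delta>) * L y)\<bar>)) = B"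
    by (simp add: fun_eq_iff B_def abs_mult algebra_simps)
  ultimately have B: "integrable M B" by simp
  have exp_sum: "exp (\<delta> * \<bar>l\<bar>) \<le> exp (- \<delta> * l) + exp (\<delta> * l)" for l
    by (cases "l \<ge> 0") (auto simp: add_increasing add_increasing2)
  have key: "\<bar>l\<bar> * exp (\<delta> / 2 * \<bar>l\<bar>) \<le> 2 / \<delta> * (exp (- \<delta> * l) + exp (\<delta> * l))" for l
  proof -
    have "\<delta> / 2 * \<bar>l\<bar> \<le> exp (\<delta> / 2 * \<bar>l\<bar>)"
      using exp_ge_add_one_self[of "\<delta> / 2 * \<bar>l\<bar>"] by linarith
    then have "\<bar>l\<bar> \<le> 2 / \<delta> * exp (\<delta> / 2 * \<bar>l\<bar>)"
      using \<delta> by (simp add: field_simps)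
    then have "\<bar>l\<bar> * exp (\<delta> / 2 * \<bar>l\<bar>) \<le> 2 / \<delta> * exp (\<delta> / 2 * \<bar>l\<bar>) * exp (\<delta> / 2 * \<bar>l\<bar>)"
      by (intro mult_right_mono) auto
    also have "\<dots> = 2 / \<delta> * exp (\<delta> * \<bar>l\<bar>)"
      by (simp add: exp_add[symmetric])
    also have "\<dots> \<le> 2 / \<delta> * (exp (- \<delta> * l) + exp (\<delta> * l))"
      using \<delta> exp_sum by (intro mult_left_mono) auto
    finally show ?thesis .
  qed
  have dq: "\<bar>w y * exp (c * L y)\<bar> * (\<bar>L y\<bar> * exp (\<delta> / 2 * \<bar>L y\<bar>)) \<le> B y" for y
  proof -
    have "\<bar>w y * exp (c * L y)\<bar> * (\<bar>L y\<bar> * exp (\<delta> / 2 * \<bar>L y\<bar>))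
        \<le> \<bar>w y * exp (c * L y)\<bar> * (2 / \<delta> * (exp (- \<delta> * L y) + exp (\<delta> * L y)))"
      using key by (intro mult_left_mono) auto
    also have "\<dots> = B y"
      by (simp add: B_def abs_mult exp_add algebra_simps exp_diff exp_minus divide_simps)
    finally show ?thesis .
  qed
  have ge1: "\<bar>L y\<bar> \<le> \<bar>L y\<bar> * exp (\<delta> / 2 * \<bar>L y\<bar>)" for y
    using \<delta> mult_left_mono[of 1 "exp (\<delta> / 2 * \<bar>L y\<bar>)" "\<bar>L y\<bar>"] by simp
  show "integrable M (\<lambda>y. w y * L y * exp (c * L y))"
  proof (rule Bochner_Integration.integrable_bound[OF B], measurable, rule AE_I2)
    fix y
    have "norm (w y * L y * exp (c * L y)) = \<bar>w y * exp (c * L y)\<bar> * \<bar>L y\<bar>"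
      by (simp add: abs_mult)
    also have "\<dots> \<le> \<bar>w y * exp (c * L y)\<bar> * (\<bar>L y\<bar> * exp (\<delta> / 2 * \<bar>L y\<bar>))"
      using ge1 by (intro mult_left_mono) auto
    also have "\<dots> \<le> norm (B y)" using dq[of y] by simp
    finally show "norm (w y * L y * exp (c * L y)) \<le> norm (B y)" .
  qed
  have int_h: "integrable M (\<lambda>y. w y * exp ((c + h) * L y))" if h: "\<bar>h\<bar> \<le> \<delta>" for h
  proof (rule Bochner_Integration.integrable_bound[of M "\<lambda>y. \<delta> / 2 * B y"], goal_cases)
    case 1 show ?case using B by simp
  next
    case 3
    show ?case
    proof (rule AE_I2)
      fix y
      have "h * L y \<le> \<delta> * \<bar>L y\<bar>"
        using h \<delta> abs_le_D1[of "h * L y"] by (simp add: abs_mult mult_right_mono order_trans)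
      then have "exp ((c + h) * L y) \<le> exp (c * L y) * exp (\<delta> * \<bar>L y\<bar>)"
        by (simp add: exp_add[symmetric] distrib_right)
      also have "\<dots> \<le> exp (c * L y) * (exp (- \<delta> * L y) + exp (\<delta> * L y))"
        using exp_sum by (intro mult_left_mono) auto
      also have "\<dots> = exp ((c - \<delta>) * L y) + exp ((c + \<delta>) * L y)"
        by (simp add: exp_add algebra_simps exp_diff exp_minus divide_simps)
      finally have "\<bar>w y\<bar> * exp ((c + h) * L y) \<le> \<bar>w y\<bar> * (exp ((c - \<delta>) * L y) + exp ((c + \<delta>) * L y))"
        by (intro mult_left_mono) auto
      then show "norm (w y * exp ((c + h) * L y)) \<le> norm (\<delta> / 2 * B y)"
        using \<delta> by (simp add: B_def abs_mult)
    qed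
  qed measurable
  show "((\<lambda>c. \<integral>y. w y * exp (c * L y) \<partial>M) has_real_derivative
           (\<integral>y. w y * L y * exp (c * L y) \<partial>M)) (at c)"
    unfolding DERIV_def tendsto_at_iff_sequentially
  proof (intro allI impI, unfold o_def)
    fix X :: "nat \<Rightarrow> real"
    assume X0: "\<forall>i. X i \<in> UNIV - {0}" and X: "X \<longlonglongrightarrow> 0"
    obtain N where N: "\<And>n. n \<ge> N \<Longrightarrow> \<bar>X n\<bar> < \<delta> / 2"
      using X[THEN LIMSEQ_D, of "\<delta> / 2"] \<delta> by auto
    define Q where "Q n y = w y * exp (c * L y) * ((exp (X n * L y) - 1) / X n)" for n y
    have [measurable]: "Q n \<in> borel_measurable M" for n unfolding Q_def by measurable
    have quot: "(\<integral>y. w y * exp ((c + X n) * L y) \<partial>M) - (\<integral>y. w y * exp (c * L y) \<partial>M) = X n * (\<integral>y. Q n y \<partial>M)"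
      if "n \<ge> N" for n
    proof -
      have "(\<integral>y. w y * exp ((c + X n) * L y) \<partial>M) - (\<integral>y. w y * exp (c * L y) \<partial>M)
          = (\<integral>y. w y * exp ((c + X n) * L y) - w y * exp (c * L y) \<partial>M)"
        using int_h[of "X n"] int_h[of 0] N[OF that] \<delta>
        by (intro Bochner_Integration.integral_diff[symmetric]) auto
      also have "\<dots> = (\<integral>y. X n * Q n y \<partial>M)"
      proof (intro Bochner_Integration.integral_cong refl)
        fix y
        have "X n \<noteq> 0" using X0 by auto
        then have "X n * Q n y = w y * exp (c * L y) * (exp (X n * L y) - 1)"
          by (simp add: Q_def)
        then show "w y * exp ((c + X n) * L y) - w y * exp (c * L y) = X n * Q n y"
          by (simp add: exp_add algebra_simps)
      qed
      finally show ?thesis by simp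
    qed
    have "(\<lambda>n. \<integral>y. Q (n + N) y \<partial>M) \<longlonglongrightarrow> (\<integral>y. w y * L y * exp (c * L y) \<partial>M)"
    proof (rule integral_dominated_convergence[where w = B])
      show "AE y in M. (\<lambda>n. Q (n + N) y) \<longlonglongrightarrow> w y * L y * exp (c * L y)"
      proof (rule AE_I2)
        fix y
        have "((\<lambda>h. exp (h * L y)) has_real_derivative L y) (at 0)"
          by (auto intro!: derivative_eq_intros)
        then have "(\<lambda>h. (exp (h * L y) - 1) / h) \<midarrow>0\<rightarrow> L y"
          by (simp add: DERIV_def)
        then have "(\<lambda>n. (exp (X n * L y) - 1) / X n) \<longlonglongrightarrow> L y"
          using X0 X unfolding tendsto_at_iff_sequentially o_def by blast
        then have "(\<lambda>n. Q n y) \<longlonglongrightarrow> w y * exp (c * L y) * L y"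
          unfolding Q_def by (intro tendsto_mult tendsto_const)
        then show "(\<lambda>n. Q (n + N) y) \<longlonglongrightarrow> w y * L y * exp (c * L y)"
          by (intro LIMSEQ_ignore_initial_segment) (simp add: mult_ac)
      qed
      show "AE y in M. norm (Q (n + N) y) \<le> B y" for n
      proof (rule AE_I2)
        fix y
        define h where "h = X (n + N)"
        have h: "h \<noteq> 0" "\<bar>h\<bar> \<le> \<delta> / 2"
          using X0 N[of "n + N"] by (auto simp: h_def)
        have "\<bar>exp u - 1\<bar> \<le> \<bar>u\<bar> * exp \<bar>u\<bar>" for u :: real
        proof (cases "u \<ge> 0")
          case True
          have "1 - u \<le> exp (- u)" using exp_ge_add_one_self[of "- u"] by simp
          then have "(1 - u) * exp u \<le> exp (- u) * exp u" by (intro mult_right_mono) auto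
          then show ?thesis using True by (simp add: exp_minus algebra_simps)
        next
          case False
          have "1 + u \<le> exp u" by (rule exp_ge_add_one_self)
          moreover have "- u * 1 \<le> - u * exp (- u)"
            using False by (intro mult_left_mono) auto
          ultimately have "1 - exp u \<le> - u * exp (- u)" by linarith
          moreover have "exp u \<le> 1" using False by simp
          ultimately show ?thesis using False by (simp add: abs_if)
        qed
        from this[of "h * L y"]
        have "\<bar>(exp (h * L y) - 1) / h\<bar> \<le> \<bar>L y\<bar> * exp (\<bar>h\<bar> * \<bar>L y\<bar>)"
          using h by (simp add: abs_mult field_simps)
        also have "\<dots> \<le> \<bar>L y\<bar> * exp (\<delta> / 2 * \<bar>L y\<bar>)"
          using h by (intro mult_left_mono iffD2[OF exp_le_cancel_iff] mult_right_mono) auto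
        finally have "\<bar>w y * exp (c * L y)\<bar> * \<bar>(exp (h * L y) - 1) / h\<bar>
            \<le> \<bar>w y * exp (c * L y)\<bar> * (\<bar>L y\<bar> * exp (\<delta> / 2 * \<bar>L y\<bar>))"
          by (intro mult_left_mono) auto
        also have "\<dots> \<le> B y" by (rule dq)
        finally show "norm (Q (n + N) y) \<le> B y"
          by (simp add: Q_def abs_mult h_def)
      qed
    qed (use B in measurable)
    then have "(\<lambda>n. \<integral>y. Q n y \<partial>M) \<longlonglongrightarrow> (\<integral>y. w y * L y * exp (c * L y) \<partial>M)"
      by (rule LIMSEQ_offset)
    moreover have "eventually (\<lambda>n. (\<integral>y. Q n y \<partial>M)
        = ((\<integral>y. w y * exp ((c + X n) * L y) \<partial>M) - (\<integral>y. w y * exp (c * L y) \<partial>M)) / X n) sequentially"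
      using eventually_ge_at_top[of N] by eventually_elim (use quot X0 in auto)
    ultimately show "(\<lambda>n. ((\<integral>y. w y * exp ((c + X n) * L y) \<partial>M) - (\<integral>y. w y * exp (c * L y) \<partial>M)) / X n)
        \<longlonglongrightarrow> (\<integral>y. w y * L y * exp (c * L y) \<partial>M)"
      by (rule Lim_transform_eventually)
  qed
qed

section \<open>Gamma densities and the Levy tail\<close>

text \<open>The derivative of \<open>gam \<beta> c z\<close> in the shape parameter \<open>c\<close>.\<close>

definition dgam :: "real \<Rightarrow> real \<Rightarrow> real \<Rightarrow> real" where
  "dgam \<beta> c z = gam \<beta> c z * (ln \<beta> - Digamma c + ln z)"

lemma measurable_dgam [measurable]: "dgam \<beta> c \<in> borel_measurable borel"
  unfolding dgam_def by measurable

lemma has_real_derivative_gam_norming: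
  assumes "\<beta> > 0" "c > 0"
  shows "((\<lambda>c. \<beta> powr c / Gamma c) has_real_derivative \<beta> powr c / Gamma c * (ln \<beta> - Digamma c)) (at c)"
proof -
  have "c \<notin> \<int>\<^sub>\<le>\<^sub>0" using assms by (auto elim: nonpos_Ints_cases)
  then show ?thesis
    using assms Gamma_real_pos[of c, THEN less_imp_neq]
    by (auto intro!: derivative_eq_intros simp: field_simps power2_eq_square)
qed

text \<open>Up to the norming factor the density is an exponential family in \<open>c\<close> with
  statistic \<open>ln y\<close>, the form in which \<open>has_real_derivative_exp_family\<close>
  applies.\<close>

lemma gam_eq_exp:
  "gam \<beta> c y = \<beta> powr c / Gamma c * (indicator {0<..} y * exp (- \<beta> * y) / y * exp (c * ln y))"
proof (cases "y > 0")
  case True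
  then have "y powr (c - 1) = exp (c * ln y) / y"
    by (simp add: powr_diff) (simp add: powr_def)
  with True show ?thesis by (simp add: gam_def)
qed (simp add: gam_def)

text \<open>Product rule: the norming factor contributes \<open>ln \<beta> - Digamma c\<close>, the
  exponential family contributes \<open>ln y\<close>. With \<open>A = {x<..}\<close> this
  differentiates the survival function.\<close>

lemma has_real_derivative_gam_integral:
  fixes \<beta> c :: real
  assumes \<beta>: "\<beta> > 0" and c: "c > 0" and [measurable]: "A \<in> sets borel"
  shows "integrable lborel (dgam \<beta> c)"
    and "((\<lambda>c. \<integral>y. indicator A y * gam \<beta> c y \<partial>lborel) has_real_derivative
           (\<integral>y. indicator A y * dgam \<beta> c y \<partial>lborel)) (at c)"
proof -
  have *: "integrable lborel (\<lambda>y. (indicator A y * (indicator {0<..} y * exp (- \<beta> * y) / y)) * ln y * exp (c * ln y))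
     \<and> ((\<lambda>c. \<integral>y. (indicator A y * (indicator {0<..} y * exp (- \<beta> * y) / y)) * exp (c * ln y) \<partial>lborel) has_real_derivative
           (\<integral>y. (indicator A y * (indicator {0<..} y * exp (- \<beta> * y) / y)) * ln y * exp (c * ln y) \<partial>lborel)) (at c)"
    if [measurable]: "A \<in> sets borel" for A
  proof -
    have int: "integrable lborel (\<lambda>y. (indicator A y * (indicator {0<..} y * exp (- \<beta> * y) / y)) * exp (c' * ln y))"
      if c': "c' > 0" for c'
    proof (rule Bochner_Integration.integrable_bound)
      show "integrable lborel (\<lambda>y. Gamma c' / \<beta> powr c' * gam \<beta> c' y)"
        using \<beta> c' by (intro integrable_mult_right integrable_gam)
      show "AE y in lborel. norm ((indicator A y * (indicator {0<..} y * exp (- \<beta> * y) / y)) * exp (c' * ln y))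
              \<le> norm (Gamma c' / \<beta> powr c' * gam \<beta> c' y)"
        using \<beta> c' Gamma_real_pos[OF c', THEN less_imp_neq] by (intro AE_I2) (auto simp: gam_eq_exp indicator_def)
    qed measurable
    \<comment> \<open>The margin \<open>c / 2\<close> keeps both outer shapes positive.\<close>
    show ?thesis
      using c int[of "c - c / 2"] int[of "c + c / 2"]
      by (intro conjI integrable_exp_family_log[of "c / 2"] has_real_derivative_exp_family[of "c / 2"]) auto
  qed
  note N = has_real_derivative_gam_norming[OF \<beta> c]
  let ?h = "\<lambda>A y. indicator A y * (indicator {0<..} y * exp (- \<beta> * y) / y)"
  have dg: "indicator A y * dgam \<beta> c y = (ln \<beta> - Digamma c) * (indicator A y * gam \<beta> c y)
       + \<beta> powr c / Gamma c * (?h A y * ln y * exp (c * ln y))" for A y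
    by (simp add: dgam_def gam_eq_exp algebra_simps add_divide_distrib diff_divide_distrib)
  have i1: "integrable lborel (\<lambda>y. indicator A y * gam \<beta> c y)" if [measurable]: "A \<in> sets borel" for A
    using integrable_gam[OF \<beta> c] by (rule Bochner_Integration.integrable_bound) (auto simp: indicator_def)
  have "integrable lborel (\<lambda>y. indicator UNIV y * dgam \<beta> c y)"
    unfolding dg using *[of UNIV] i1[of UNIV] by (intro Bochner_Integration.integrable_add integrable_mult_right) auto
  then show "integrable lborel (dgam \<beta> c)" by simp
  have gA: "(\<integral>y. indicator A y * gam \<beta> c y \<partial>lborel) = \<beta> powr c / Gamma c * (\<integral>y. ?h A y * exp (c * ln y) \<partial>lborel)" for c
    by (subst integral_mult_right_zero[symmetric]) (simp add: gam_eq_exp mult_ac)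
  have "(\<integral>y. indicator A y * dgam \<beta> c y \<partial>lborel)
     = \<beta> powr c / Gamma c * (ln \<beta> - Digamma c) * (\<integral>y. ?h A y * exp (c * ln y) \<partial>lborel)
       + \<beta> powr c / Gamma c * (\<integral>y. ?h A y * ln y * exp (c * ln y) \<partial>lborel)"
  proof -
    have "integrable lborel (\<lambda>y. ?h A y * ln y * exp (c * ln y))" using *[of A] by simp
    moreover have "integrable lborel (\<lambda>y. indicator A y * gam \<beta> c y)" by (rule i1) simp
    ultimately have "(\<integral>y. indicator A y * dgam \<beta> c y \<partial>lborel)
       = (ln \<beta> - Digamma c) * (\<integral>y. indicator A y * gam \<beta> c y \<partial>lborel)
         + \<beta> powr c / Gamma c * (\<integral>y. ?h A y * ln y * exp (c * ln y) \<partial>lborel)"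
      unfolding dg by (simp only: Bochner_Integration.integral_add integrable_mult_right integral_mult_right_zero)
    then show ?thesis by (simp only: gA mult_ac)
  qed
  with gA show "((\<lambda>c. \<integral>y. indicator A y * gam \<beta> c y \<partial>lborel) has_real_derivative
           (\<integral>y. indicator A y * dgam \<beta> c y \<partial>lborel)) (at c)"
    using DERIV_mult[OF N conjunct2[OF *[of A]]] by (simp add: algebra_simps)
qed

text \<open>The substitution \<open>z = w * u\<close> leaves a Beta integral over the unit interval
  and collects the powers of \<open>w\<close>: one from the substitution and
  \<open>c + d - 2\<close> from the densities.\<close>

lemma gam_convolution:
  fixes \<beta> c d w :: real
  assumes \<beta>: "\<beta> > 0" and c: "c > 0" and d: "d > 0"
  shows "(\<integral>\<^sup>+z. ennreal (gam \<beta> c z) * ennreal (gam \<beta> d (w - z)) \<partial>lborel) = ennreal (gam \<beta> (c + d) w)"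
proof (cases "w > 0")
  case False
  then have "gam \<beta> c z = 0 \<or> gam \<beta> d (w - z) = 0" for z by (auto simp: gam_def)
  then have z0: "ennreal (gam \<beta> c z) * ennreal (gam \<beta> d (w - z))
      = 0" for z by (metis ennreal_0 mult_zero_left mult_zero_right)
  have "(\<integral>\<^sup>+z. ennreal (gam \<beta> c z) * ennreal (gam \<beta> d (w - z)) \<partial>lborel) = (\<integral>\<^sup>+z. 0 \<partial>(lborel :: real measure))"
    by (rule nn_integral_cong) (rule z0)
  then show ?thesis using False by (simp add: gam_def)
next
  case w: True
  let ?K = "\<beta> powr c / Gamma c * (\<beta> powr d / Gamma d) * w powr (c + d - 2) * exp (- \<beta> * w)"
  have K: "?K \<ge> 0" using c d by simp
  have "(\<integral>\<^sup>+z. ennreal (gam \<beta> c z) * ennreal (gam \<beta> d (w - z)) \<partial>lborel)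
      = ennreal w * (\<integral>\<^sup>+u. ennreal (gam \<beta> c (w * u)) * ennreal (gam \<beta> d (w - w * u)) \<partial>lborel)"
    using nn_integral_real_affine[of "\<lambda>z. ennreal (gam \<beta> c z) * ennreal (gam \<beta> d (w - z))" w 0] w by simp
  also have "(\<integral>\<^sup>+u. ennreal (gam \<beta> c (w * u)) * ennreal (gam \<beta> d (w - w * u)) \<partial>lborel)
     = (\<integral>\<^sup>+u. ennreal ?K * ennreal (indicator {0..1} u * (u powr (c - 1) * (1 - u) powr (d - 1))) \<partial>lborel)"
  proof (intro nn_integral_cong)
    fix u :: real
    consider "u \<le> 0" | "u \<ge> 1" | "0 < u" "u < 1" by linarith
    then show "ennreal (gam \<beta> c (w * u)) * ennreal (gam \<beta> d (w - w * u)) =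
        ennreal ?K * ennreal (indicator {0..1} u * (u powr (c - 1) * (1 - u) powr (d - 1)))"
    proof cases
      case 1
      then have "gam \<beta> c (w * u) = 0" using w mult_nonneg_nonpos[of w u] by (simp add: gam_def)
      with 1 show ?thesis by (auto simp: indicator_def)
    next
      case 2
      then have "gam \<beta> d (w - w * u) = 0" using w by (simp add: gam_def)
      with 2 show ?thesis by (auto simp: indicator_def)
    next
      case 3
      have e: "w - w * u = w * (1 - u)" by (simp add: algebra_simps)
      have pos: "w * (1 - u) > 0" "w * u > 0" using 3 w by auto
      have "gam \<beta> c (w * u) * gam \<beta> d (w - w * u) = ?K * (u powr (c - 1) * (1 - u) powr (d - 1))"
      proof -
        have p: "w powr (c + d - 2) = w powr (c - 1) * w powr (d - 1)"
          by (simp add: powr_add[symmetric])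
        have q: "exp (- \<beta> * w) = exp (- \<beta> * (w * u)) * exp (- \<beta> * (w * (1 - u)))"
          by (simp add: exp_add[symmetric] algebra_simps)
        show ?thesis
          unfolding e p q using pos 3 w by (simp add: gam_def powr_mult)
      qed
      with 3 K c d show ?thesis by (simp add: ennreal_mult'[symmetric])
    qed
  qed
  also have "\<dots> = ennreal ?K * ennreal (Beta c d)"
  proof -
    have "(\<integral>\<^sup>+u. ennreal (indicator {0..1} u * (u powr (c - 1) * (1 - u) powr (d - 1))) \<partial>lborel) = ennreal (Beta c d)"
      by (rule nn_integral_has_integral_lebesgue[OF _ has_integral_Beta_real[OF c d]]) auto
    then show ?thesis by (subst nn_integral_cmult) auto
  qed
  also have "ennreal w * \<dots> = ennreal (gam \<beta> (c + d) w)"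
  proof -
    have "w powr (c + d - 1) = w * w powr (c + d - 2)"
      using w powr_add[of w 1 "c + d - 2"] by simp
    moreover have "\<beta> powr (c + d) = \<beta> powr c * \<beta> powr d" by (simp add: powr_add)
    moreover have "Beta c d = Gamma c * Gamma d / Gamma (c + d)" by (simp add: Beta_def)
    moreover have "Gamma c > 0" "Gamma d > 0" "Gamma (c + d) > 0" using c d by (auto intro: Gamma_real_pos)
    ultimately have "w * (?K * Beta c d) = gam \<beta> (c + d) w"
      using w by (simp add: gam_def field_simps)
    then show ?thesis
      using w K c d by (simp add: ennreal_mult'[symmetric] ennreal_mult''[symmetric] Beta_def)
  qed
  finally show ?thesis .
qed

section \<open>Survival functions and the limit of vanishing shape\<close>

definition surv :: "real \<Rightarrow> real \<Rightarrow> real \<Rightarrow> real" where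
  "surv \<beta> c x = (\<integral>y. indicator {x<..} y * gam \<beta> c y \<partial>lborel)"

lemma measurable_surv [measurable]: "surv \<beta> c \<in> borel_measurable borel"
proof -
  have "surv \<beta> c = (\<lambda>x. \<integral>y. (if x < y then gam \<beta> c y else 0) \<partial>lborel)"
    unfolding surv_def by (intro ext Bochner_Integration.integral_cong) (auto simp: indicator_def)
  then show ?thesis by simp
qed

lemma ennreal_surv:
  assumes "\<beta> > 0" "c > 0"
  shows "ennreal (surv \<beta> c x) = (\<integral>\<^sup>+y. indicator {x<..} y * ennreal (gam \<beta> c y) \<partial>lborel)"
proof -
  have "integrable lborel (\<lambda>y. indicator {x<..} y * gam \<beta> c y)"
    using integrable_gam[OF assms] by (rule Bochner_Integration.integrable_bound) (auto simp: indicator_def)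
  then have "ennreal (surv \<beta> c x) = (\<integral>\<^sup>+y. ennreal (indicator {x<..} y * gam \<beta> c y) \<partial>lborel)"
    unfolding surv_def using assms by (intro nn_integral_eq_integral[symmetric]) auto
  also have "\<dots> = (\<integral>\<^sup>+y. indicator {x<..} y * ennreal (gam \<beta> c y) \<partial>lborel)"
    by (intro nn_integral_cong) (auto simp: indicator_def)
  finally show ?thesis .
qed

lemma surv_nonneg: "c > 0 \<Longrightarrow> surv \<beta> c x \<ge> 0"
  unfolding surv_def by (intro integral_nonneg_AE AE_I2) auto

lemma surv_nonpos:
  assumes "\<beta> > 0" "c > 0" "x \<le> 0"
  shows "surv \<beta> c x = 1"
proof -
  have "surv \<beta> c x = (\<integral>y. gam \<beta> c y \<partial>lborel)"
    unfolding surv_def using assms(3) by (intro Bochner_Integration.integral_cong) (auto simp: indicator_def gam_def)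
  with assms show ?thesis by (simp add: integral_gam)
qed

lemma surv_le_1:
  assumes "\<beta> > 0" "c > 0"
  shows "surv \<beta> c x \<le> 1"
proof -
  have "surv \<beta> c x \<le> (\<integral>y. gam \<beta> c y \<partial>lborel)"
    unfolding surv_def using assms
    by (intro integral_mono integrable_gam Bochner_Integration.integrable_bound[OF integrable_gam[OF assms]])
       (auto simp: indicator_def)
  with assms show ?thesis by (simp add: integral_gam)
qed

text \<open>Differencing in the shape: divided by \<open>d\<close>, the factor \<open>surv \<beta> d\<close> tends to \<open>levy_tail 1 \<beta>\<close>
  as \<open>d\<close> tends to 0.\<close>

lemma surv_add:
  assumes \<beta>: "\<beta> > 0" and c: "c > 0" and d: "d > 0"
  shows "surv \<beta> (c + d) x = surv \<beta> c x + (\<integral>z. indicator {..<x} z * (gam \<beta> c z * surv \<beta> d (x - z)) \<partial>lborel)"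
proof -
  have cd: "c + d > 0" using c d by simp
  have "ennreal (surv \<beta> (c + d) x) = (\<integral>\<^sup>+w. indicator {x<..} w *
      (\<integral>\<^sup>+z. ennreal (gam \<beta> c z) * ennreal (gam \<beta> d (w - z)) \<partial>lborel) \<partial>lborel)"
    using \<beta> c d cd by (simp add: ennreal_surv gam_convolution)
  also have "\<dots> = (\<integral>\<^sup>+w. (\<integral>\<^sup>+z. indicator {x<..} w * (ennreal (gam \<beta> c z) * ennreal (gam \<beta> d (w - z))) \<partial>lborel) \<partial>lborel)"
    by (intro nn_integral_cong nn_integral_cmult[symmetric]) auto
  also have "\<dots> = (\<integral>\<^sup>+z. (\<integral>\<^sup>+w. indicator {x<..} w * (ennreal (gam \<beta> c z) * ennreal (gam \<beta> d (w - z))) \<partial>lborel) \<partial>lborel)"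
    by (rule lborel_pair.Fubini') measurable
  also have "\<dots> = (\<integral>\<^sup>+z. ennreal (gam \<beta> c z * surv \<beta> d (x - z)) \<partial>lborel)"
  proof (intro nn_integral_cong)
    fix z
    have "(\<integral>\<^sup>+w. indicator {x<..} w * (ennreal (gam \<beta> c z) * ennreal (gam \<beta> d (w - z))) \<partial>lborel)
       = (\<integral>\<^sup>+y. ennreal (gam \<beta> c z) * (indicator {x - z<..} y * ennreal (gam \<beta> d y)) \<partial>lborel)"
      by (subst nn_integral_real_affine[where t = z and c = 1])
         (auto intro!: nn_integral_cong simp: indicator_def)
    also have "\<dots> = ennreal (gam \<beta> c z) * ennreal (surv \<beta> d (x - z))"
      using \<beta> d by (subst nn_integral_cmult) (auto simp: ennreal_surv)
    finally show "(\<integral>\<^sup>+w. indicator {x<..} w * (ennreal (gam \<beta> c z) * ennreal (gam \<beta> d (w - z))) \<partial>lborel)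
       = ennreal (gam \<beta> c z * surv \<beta> d (x - z))"
      using c by (simp add: ennreal_mult')
  qed
  also have "\<dots> = ennreal (\<integral>z. gam \<beta> c z * surv \<beta> d (x - z) \<partial>lborel)"
  proof (rule nn_integral_eq_integral)
    show "integrable lborel (\<lambda>z. gam \<beta> c z * surv \<beta> d (x - z))"
      by (rule Bochner_Integration.integrable_bound[OF integrable_gam[OF \<beta> c]])
         (use surv_nonneg[OF d] surv_le_1[OF \<beta> d] c in \<open>auto simp: mult_left_le\<close>)
  qed (use surv_nonneg[OF d] c in auto)
  finally have "surv \<beta> (c + d) x = (\<integral>z. gam \<beta> c z * surv \<beta> d (x - z) \<partial>lborel)"
    using surv_nonneg[OF cd] surv_nonneg[OF d] c by (subst (asm) ennreal_inj) (auto intro!: integral_nonneg_AE)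
  \<comment> \<open>For \<open>z > x\<close> the argument \<open>x - z\<close> is negative and
    \<open>surv \<beta> d\<close> equals 1 there, which leaves the survival function of
    \<open>gam \<beta> c\<close>; the point \<open>z = x\<close> is null.\<close>
  also have "\<dots> = (\<integral>z. indicator {x<..} z * gam \<beta> c z + indicator {..<x} z * (gam \<beta> c z * surv \<beta> d (x - z)) \<partial>lborel)"
    using \<beta> d by (intro integral_cong_AE AE_I[of _ _ "{x}"]) (auto simp: surv_nonpos indicator_def split: if_splits)
  also have "\<dots> = surv \<beta> c x + (\<integral>z. indicator {..<x} z * (gam \<beta> c z * surv \<beta> d (x - z)) \<partial>lborel)"
    unfolding surv_def[of \<beta> c]
    by (intro Bochner_Integration.integral_add Bochner_Integration.integrable_bound[OF integrable_gam[OF \<beta> c]])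
       (use surv_nonneg[OF d] surv_le_1[OF \<beta> d] c in \<open>auto simp: mult_left_le indicator_def\<close>)
  finally show ?thesis .
qed

lemma levy_tail_altdef:
  "levy_tail \<alpha> \<beta> z = \<alpha> * (\<integral>y. (if z < y then exp (- \<beta> * y) / y else 0) \<partial>lborel)"
  unfolding levy_tail_def set_lebesgue_integral_def
  by (intro arg_cong[where f = "(*) \<alpha>"] Bochner_Integration.integral_cong) (auto simp: indicator_def)

lemma measurable_levy_tail [measurable]: "levy_tail \<alpha> \<beta> \<in> borel_measurable borel"
  unfolding levy_tail_altdef[abs_def] by measurable

lemma levy_tail_scale: "levy_tail \<alpha> \<beta> z = \<alpha> * levy_tail 1 \<beta> z"
  by (simp add: levy_tail_def)

lemma levy_tail_nonneg: "\<alpha> \<ge> 0 \<Longrightarrow> z > 0 \<Longrightarrow> levy_tail \<alpha> \<beta> z \<ge> 0"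
  unfolding levy_tail_altdef by (auto intro!: mult_nonneg_nonneg integral_nonneg_AE)

text \<open>After division by \<open>d\<close> the norming factor is
  \<open>\<beta> powr d / Gamma (1 + d)\<close>, which tends to 1. The second part is a majorant
  uniform in \<open>n\<close>: the singularity of the tail at 0 is only logarithmic, but
  \<open>z powr (- 1 / 2)\<close> is, up to an exponential, a gamma density of shape
  \<open>1 / 2\<close>, whose convolution with another gamma density is known.\<close>

lemma surv_tendsto_levy_tail:
  fixes \<beta> z :: real
  assumes \<beta>: "\<beta> > 0" 
  defines "d \<equiv> \<lambda>n. inverse (real (Suc n))"
  shows "z > 0 \<Longrightarrow> (\<lambda>n. surv \<beta> (d n) z / d n) \<longlonglongrightarrow> levy_tail 1 \<beta> z"
    and "\<exists>C. \<forall>n. \<forall>z>0. surv \<beta> (d n) z / d n \<le> C * (z powr (- 1 / 2) + 1)"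
proof -
  have d0: "d \<longlonglongrightarrow> 0" unfolding d_def by (rule LIMSEQ_inverse_real_of_nat)
  have d: "d n > 0" "d n \<le> 1" for n by (auto simp: d_def field_simps)
  define N where "N n = \<beta> powr d n / Gamma (1 + d n)" for n
  define I where "I n z = (\<integral>y. (if z < y then y powr (d n - 1) * exp (- \<beta> * y) else 0) \<partial>lborel)" for n z
  have S: "surv \<beta> (d n) z / d n = N n * I n z" if z: "z > 0" for n z
  proof -
    have nz: "d n \<notin> \<int>\<^sub>\<le>\<^sub>0" using d[of n] by (auto elim: nonpos_Ints_cases)
    have G: "Gamma (1 + d n) = d n * Gamma (d n)"
      using Gamma_plus1[of "d n"] nz by (simp add: add.commute)
    have "surv \<beta> (d n) z = (\<integral>y. \<beta> powr d n / Gamma (d n) * (if z < y then y powr (d n - 1) * exp (- \<beta> * y) else 0) \<partial>lborel)"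
      unfolding surv_def using z by (intro Bochner_Integration.integral_cong) (auto simp: gam_def indicator_def)
    also have "\<dots> = \<beta> powr d n / Gamma (d n) * I n z" by (simp add: I_def)
    finally show ?thesis by (simp add: N_def G)
  qed
  have "N \<longlonglongrightarrow> \<beta> powr 0 / Gamma (1 + 0)"
    unfolding N_def using \<beta> by (intro tendsto_intros d0) (auto simp: nonpos_Ints_def)
  then have N: "N \<longlonglongrightarrow> 1" using \<beta> by simp
  have N0: "N n \<ge> 0" for n using d[of n] by (simp add: N_def)
  have pw: "y powr (d n - 1) \<le> 1 / y + 1" if y: "y > 0" for y n
  proof (cases "y \<le> 1")
    case True
    then have "y powr (d n - 1) \<le> y powr (- 1)" using y d[of n] by (intro powr_mono') auto
    then show ?thesis using y by (simp add: powr_minus_divide)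
  next
    case False
    then have "y powr (d n - 1) \<le> y powr 0" using d[of n] by (intro powr_mono) auto
    then show ?thesis using y by (simp add: add_increasing)
  qed
  have E: "integrable lborel (\<lambda>y. indicator {0<..} y * exp (- \<beta> * y))"
  proof -
    have "(\<lambda>z. indicator {0<..} z *\<^sub>R (z powr (1 - 1) * exp (- \<beta> * z))) = (\<lambda>z. indicator {0<..} z * exp (- \<beta> * z))"
      by (auto simp: indicator_def)
    then show ?thesis
      using set_integrable_powr_exp[of \<beta> 1] \<beta> by (simp add: set_integrable_def)
  qed
  have E2: "integrable lborel (\<lambda>y. indicator {0<..} y * (y powr (- 1 / 2) * exp (- \<beta> * y)))"
    using set_integrable_powr_exp[of \<beta> "1 / 2"] \<beta> by (simp add: set_integrable_def)
  define C1 where "C1 = (\<integral>y. indicator {0<..} y * exp (- \<beta> * y) \<partial>lborel)"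
  define C2 where "C2 = (\<integral>y. indicator {0<..} y * (y powr (- 1 / 2) * exp (- \<beta> * y)) \<partial>lborel)"
  have C: "C1 \<ge> 0" "C2 \<ge> 0" unfolding C1_def C2_def by (auto intro!: integral_nonneg_AE)
  have Ib: "I n z \<le> (C1 + C2) * (z powr (- 1 / 2) + 1)" if z: "z > 0" for n z
  proof -
    have "I n z \<le> (\<integral>y. z powr (- 1 / 2) * (indicator {0<..} y * (y powr (- 1 / 2) * exp (- \<beta> * y)))
        + indicator {0<..} y * exp (- \<beta> * y) \<partial>lborel)"
      unfolding I_def
    proof (rule integral_mono_AE')
      show "integrable lborel (\<lambda>y. z powr (- 1 / 2) * (indicator {0<..} y * (y powr (- 1 / 2) * exp (- \<beta> * y)))
          + indicator {0<..} y * exp (- \<beta> * y))"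
        using E E2 by auto
      show "AE y in lborel. (if z < y then y powr (d n - 1) * exp (- \<beta> * y) else 0)
         \<le> z powr (- 1 / 2) * (indicator {0<..} y * (y powr (- 1 / 2) * exp (- \<beta> * y))) + indicator {0<..} y * exp (- \<beta> * y)"
      proof (rule AE_I2)
        fix y
        show "(if z < y then y powr (d n - 1) * exp (- \<beta> * y) else 0)
         \<le> z powr (- 1 / 2) * (indicator {0<..} y * (y powr (- 1 / 2) * exp (- \<beta> * y))) + indicator {0<..} y * exp (- \<beta> * y)"
        proof (cases "z < y")
          case True
          \<comment> \<open>One factor \<open>y powr (- 1 / 2)\<close> is traded for
            \<open>z powr (- 1 / 2)\<close>; the other stays and is integrable at 0.\<close>
          have "1 / y = y powr (- 1 / 2) * y powr (- 1 / 2)"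
            using True z by (simp add: powr_add[symmetric] powr_minus_divide)
          also have "\<dots> \<le> z powr (- 1 / 2) * y powr (- 1 / 2)"
            using True z by (intro mult_right_mono powr_mono2') auto
          finally have "y powr (d n - 1) \<le> z powr (- 1 / 2) * y powr (- 1 / 2) + 1"
            using pw[of y n] True z by simp
          then have "y powr (d n - 1) * exp (- \<beta> * y) \<le> (z powr (- 1 / 2) * y powr (- 1 / 2) + 1) * exp (- \<beta> * y)"
            by (intro mult_right_mono) auto
          with True z show ?thesis by (simp add: algebra_simps)
        qed auto
      qed
    qed auto
    also have "\<dots> = z powr (- 1 / 2) * C2 + C1"
      using E E2 by (simp add: C1_def C2_def)
    also have "\<dots> \<le> (C1 + C2) * (z powr (- 1 / 2) + 1)"
      using C by (simp add: algebra_simps)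
    finally show ?thesis .
  qed
  obtain B where B: "\<And>n. N n \<le> B"
    using convergent_imp_Bseq[OF convergentI[OF N]] by (auto simp: Bseq_def abs_le_iff)
  have "surv \<beta> (d n) z / d n \<le> (B * (C1 + C2)) * (z powr (- 1 / 2) + 1)" if z: "z > 0" for n z
  proof -
    have "N n * I n z \<le> N n * ((C1 + C2) * (z powr (- 1 / 2) + 1))"
      using Ib[OF z] N0 by (intro mult_left_mono) auto
    also have "\<dots> \<le> B * ((C1 + C2) * (z powr (- 1 / 2) + 1))"
      using B C by (intro mult_right_mono) auto
    finally show ?thesis using S[OF z] by (simp add: mult_ac)
  qed
  then show "\<exists>C. \<forall>n. \<forall>z>0. surv \<beta> (d n) z / d n \<le> C * (z powr (- 1 / 2) + 1)" by blast
  assume z: "z > 0"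
  have "(\<lambda>n. I n z) \<longlonglongrightarrow> (\<integral>y. (if z < y then exp (- \<beta> * y) / y else 0) \<partial>lborel)"
    unfolding I_def
  proof (rule integral_dominated_convergence[where w = "\<lambda>y. (1 / z + 1) * (indicator {0<..} y * exp (- \<beta> * y))"])
    show "AE y in lborel. (\<lambda>n. if z < y then y powr (d n - 1) * exp (- \<beta> * y) else 0)
        \<longlonglongrightarrow> (if z < y then exp (- \<beta> * y) / y else 0)"
    proof (rule AE_I2)
      fix y
      have "(\<lambda>n. y powr (d n - 1) * exp (- \<beta> * y)) \<longlonglongrightarrow> y powr (0 - 1) * exp (- \<beta> * y)" if "z < y"
        using that z by (intro tendsto_intros d0) auto
      then show "(\<lambda>n. if z < y then y powr (d n - 1) * exp (- \<beta> * y) else 0) \<longlonglongrightarrow> (if z < y then exp (- \<beta> * y) / y else 0)"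
        using z by (cases "z < y") (auto simp: powr_minus_divide)
    qed
    show "AE y in lborel. norm (if z < y then y powr (d n - 1) * exp (- \<beta> * y) else 0)
        \<le> (1 / z + 1) * (indicator {0<..} y * exp (- \<beta> * y))" for n
    proof (rule AE_I2)
      fix y
      show "norm (if z < y then y powr (d n - 1) * exp (- \<beta> * y) else 0)
          \<le> (1 / z + 1) * (indicator {0<..} y * exp (- \<beta> * y))"
      proof (cases "z < y")
        case True
        then have "1 / y \<le> 1 / z" using z by (simp add: frac_le)
        then have "y powr (d n - 1) \<le> 1 / z + 1" using pw[of y n] True z by linarith
        then show ?thesis using True z by simp
      next
        case False
        then show ?thesis using z by auto
      qed
    qed
  qed (use E in auto)
  from tendsto_mult[OF N this] show "(\<lambda>n. surv \<beta> (d n) z / d n) \<longlonglongrightarrow> levy_tail 1 \<beta> z"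
    by (simp add: S[OF z] levy_tail_altdef)
qed

text \<open>Divided by \<open>d\<close>, \<open>surv_add\<close> equates a convolution with
  \<open>surv \<beta> d / d\<close> and a difference quotient in the shape. Along
  \<open>d = 1 / (n + 1)\<close> the former converges by domination, the latter by
  differentiability.\<close>

lemma gam_levy_tail_convolution:
  fixes \<beta> c x :: real
  assumes \<beta>: "\<beta> > 0" and c: "c > 0"
  shows "integrable lborel (\<lambda>s. indicator {..<x} s * (gam \<beta> c s * levy_tail 1 \<beta> (x - s)))"
    and "(\<integral>s. indicator {..<x} s * (gam \<beta> c s * levy_tail 1 \<beta> (x - s)) \<partial>lborel)
        = (\<integral>y. indicator {x<..} y * dgam \<beta> c y \<partial>lborel)"
proof -
  define d where "d = (\<lambda>n. inverse (real (Suc n)))"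
  have d0: "d \<longlonglongrightarrow> 0" unfolding d_def by (rule LIMSEQ_inverse_real_of_nat)
  have d: "d n > 0" for n by (auto simp: d_def)
  obtain C where C: "\<And>n z. z > 0 \<Longrightarrow> surv \<beta> (d n) z / d n \<le> C * (z powr (- 1 / 2) + 1)"
    using surv_tendsto_levy_tail(2)[OF \<beta>] unfolding d_def by blast
  have C0: "C \<ge> 0"
  proof -
    have "0 \<le> C * (1 powr (- 1 / 2) + 1)"
      using C[of 1 0] surv_nonneg[OF d[of 0], of \<beta> 1] d[of 0] by (smt (verit) divide_nonneg_pos zero_less_one)
    then show ?thesis by simp
  qed
  \<comment> \<open>On \<open>0 < s < x\<close> the factor \<open>exp (\<beta> * x)\<close>
    outweighs \<open>exp (- \<beta> * (x - s))\<close>, so the first term dominates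
    \<open>(x - s) powr (- 1 / 2)\<close>; its integral is a multiple of
    \<open>gam \<beta> (c + 1 / 2) x\<close>.\<close>
  define w where "w s = C * (exp (\<beta> * x) * (Gamma (1 / 2) / \<beta> powr (1 / 2)) * (gam \<beta> c s * gam \<beta> (1 / 2) (x - s))
      + gam \<beta> c s)" for s
  have "(\<integral>\<^sup>+s. ennreal (gam \<beta> c s * gam \<beta> (1 / 2) (x - s)) \<partial>lborel) = ennreal (gam \<beta> (c + 1 / 2) x)"
    using gam_convolution[OF \<beta> c, of "1 / 2" x] c by (simp add: ennreal_mult')
  then have "integrable lborel (\<lambda>s. gam \<beta> c s * gam \<beta> (1 / 2) (x - s))"
    using c by (intro integrableI_nonneg) auto
  then have w: "integrable lborel w"
    unfolding w_def by (intro integrable_mult_right Bochner_Integration.integrable_add integrable_gam \<beta> c)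
  have bound: "norm (indicator {..<x} s * (gam \<beta> c s * (surv \<beta> (d n) (x - s) / d n))) \<le> w s" for n s
  proof (cases "0 < s \<and> s < x")
    case True
    have "(x - s) powr (- 1 / 2) \<le> exp (\<beta> * x) * (Gamma (1 / 2) / \<beta> powr (1 / 2)) * gam \<beta> (1 / 2) (x - s)"
    proof -
      have "exp (\<beta> * x) * (Gamma (1 / 2) / \<beta> powr (1 / 2)) * gam \<beta> (1 / 2) (x - s) = (x - s) powr (- 1 / 2) * exp (\<beta> * s)"
        using True \<beta> Gamma_real_pos[of "1 / 2", THEN less_imp_neq]
            by (simp add: gam_def exp_add[symmetric] algebra_simps exp_diff exp_minus divide_simps)
      moreover have "1 \<le> exp (\<beta> * s)" using True \<beta> by simp
      ultimately show ?thesis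
        using mult_left_mono[of 1 "exp (\<beta> * s)" "(x - s) powr (- 1 / 2)"] by simp
    qed
    then have "C * ((x - s) powr (- 1 / 2) + 1)
        \<le> C * (exp (\<beta> * x) * (Gamma (1 / 2) / \<beta> powr (1 / 2)) * gam \<beta> (1 / 2) (x - s) + 1)"
      using C0 by (intro mult_left_mono) auto
    then have "surv \<beta> (d n) (x - s) / d n \<le> C * (exp (\<beta> * x) * (Gamma (1 / 2) / \<beta> powr (1 / 2)) * gam \<beta> (1 / 2) (x - s) + 1)"
      using C[of "x - s" n] True by simp
    then have "gam \<beta> c s * (surv \<beta> (d n) (x - s) / d n)
        \<le> gam \<beta> c s * (C * (exp (\<beta> * x) * (Gamma (1 / 2) / \<beta> powr (1 / 2)) * gam \<beta> (1 / 2) (x - s) + 1))"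
      using c by (intro mult_left_mono) auto
    also have "\<dots> = w s" by (simp add: w_def algebra_simps)
    finally show ?thesis
      using True c surv_nonneg[OF d[of n], of \<beta> "x - s"] d[of n] by (simp add: abs_mult)
  next
    case False
    then have "indicator {..<x} s * gam \<beta> c s = 0" by (auto simp: gam_def)
    moreover have "w s \<ge> 0" using C0 c by (simp add: w_def)
    ultimately show ?thesis by auto
  qed
  have lim: "(\<lambda>n. indicator {..<x} s * (gam \<beta> c s * (surv \<beta> (d n) (x - s) / d n)))
      \<longlonglongrightarrow> indicator {..<x} s * (gam \<beta> c s * levy_tail 1 \<beta> (x - s))" for s
  proof (cases "s < x")
    case True
    then have "(\<lambda>n. surv \<beta> (d n) (x - s) / d n) \<longlonglongrightarrow> levy_tail 1 \<beta> (x - s)"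
      using surv_tendsto_levy_tail(1)[OF \<beta>, of "x - s"] by (simp only: d_def diff_gt_0_iff_gt)
    then show ?thesis by (intro tendsto_mult tendsto_const)
  qed simp
  have dct: "integrable lborel (\<lambda>s. indicator {..<x} s * (gam \<beta> c s * levy_tail 1 \<beta> (x - s)))"
    "(\<lambda>n. \<integral>s. indicator {..<x} s * (gam \<beta> c s * (surv \<beta> (d n) (x - s) / d n)) \<partial>lborel)
        \<longlonglongrightarrow> (\<integral>s. indicator {..<x} s * (gam \<beta> c s * levy_tail 1 \<beta> (x - s)) \<partial>lborel)"
    by (rule integrable_dominated_convergence[where w = w, OF _ _ w AE_I2[OF lim] AE_I2[OF bound]]
             integral_dominated_convergence[where w = w, OF _ _ w AE_I2[OF lim] AE_I2[OF bound]], measurable)+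
  show "integrable lborel (\<lambda>s. indicator {..<x} s * (gam \<beta> c s * levy_tail 1 \<beta> (x - s)))" by (rule dct)
  have "(\<integral>s. indicator {..<x} s * (gam \<beta> c s * (surv \<beta> (d n) (x - s) / d n)) \<partial>lborel)
      = (surv \<beta> (c + d n) x - surv \<beta> c x) / d n" for n
  proof -
    have "(\<integral>s. indicator {..<x} s * (gam \<beta> c s * (surv \<beta> (d n) (x - s) / d n)) \<partial>lborel)
        = (\<integral>s. indicator {..<x} s * (gam \<beta> c s * surv \<beta> (d n) (x - s)) \<partial>lborel) / d n"
      by (subst integral_divide_zero[symmetric]) (simp add: mult.assoc)
    then show ?thesis using surv_add[OF \<beta> c d[of n], of x] by simp
  qed
  moreover have "(\<lambda>n. (surv \<beta> (c + d n) x - surv \<beta> c x) / d n) \<longlonglongrightarrow> (\<integral>y. indicator {x<..} y * dgam \<beta> c y \<partial>lborel)"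
  proof -
    have "(\<lambda>h. (surv \<beta> (c + h) x - surv \<beta> c x) / h) \<midarrow>0\<rightarrow> (\<integral>y. indicator {x<..} y * dgam \<beta> c y \<partial>lborel)"
      using has_real_derivative_gam_integral(2)[OF \<beta> c, of "{x<..}"] by (simp add: DERIV_def surv_def)
    moreover have "\<forall>i. d i \<in> UNIV - {0}" using d by (auto simp: less_imp_neq[symmetric])
    ultimately show ?thesis using d0 unfolding tendsto_at_iff_sequentially o_def by blast
  qed
  ultimately show "(\<integral>s. indicator {..<x} s * (gam \<beta> c s * levy_tail 1 \<beta> (x - s)) \<partial>lborel)
      = (\<integral>y. indicator {x<..} y * dgam \<beta> c y \<partial>lborel)"
    using dct(2) by (simp only: LIMSEQ_unique)
qed

section \<open>The variance gamma density as a correlation of gamma densities\<close>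

text \<open>Nonnegativity and \<open>fin\<close> give the absolute integrability on which the
  substitution theorem rests; hence each use must know beforehand that the integral over
  \<open>T\<close> is finite.\<close>

lemma nn_integral_change_of_variables_real:
  fixes f g g' :: "real \<Rightarrow> real"
  assumes [measurable]: "S \<in> sets borel" "T \<in> sets borel" "f \<in> borel_measurable borel"
    and g: "\<And>x. x \<in> S \<Longrightarrow> (g has_real_derivative g' x) (at x)" and inj: "inj_on g S" and T: "g ` S = T"
    and nonneg: "\<And>y. y \<in> T \<Longrightarrow> f y \<ge> 0"
    and fin: "(\<integral>\<^sup>+y. ennreal (f y) * indicator T y \<partial>lborel) < \<infinity>"
  shows "(\<integral>\<^sup>+x. ennreal (\<bar>g' x\<bar> * f (g x)) * indicator S x \<partial>lborel) = (\<integral>\<^sup>+y. ennreal (f y) * indicator T y \<partial>lborel)"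
proof -
  have eq: "(\<integral>\<^sup>+y. ennreal (f y) * indicator T y \<partial>lborel) = (\<integral>\<^sup>+y. ennreal (indicator T y *\<^sub>R f y) \<partial>lborel)"
    by (intro nn_integral_cong) (auto simp: indicator_def)
  have int: "set_integrable lborel T f"
    unfolding set_integrable_def
  proof (rule integrableI_nonneg)
    show "AE y in lborel. 0 \<le> indicator T y *\<^sub>R f y" using nonneg by (auto simp: indicator_def)
    show "(\<integral>\<^sup>+y. ennreal (indicator T y *\<^sub>R f y) \<partial>lborel) < \<infinity>" using fin eq by simp
  qed measurable
  define I where "I = (LINT y:T|lborel. f y)"
  have I: "f absolutely_integrable_on T" "integral T f = I"
    using int set_borel_integral_eq_integral(2)[OF int]
    by (auto simp: I_def nonneg intro!: nonnegative_absolutely_integrable_1 set_borel_integral_eq_integral(1))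
  have "(\<lambda>x. \<bar>g' x\<bar> * f (g x)) absolutely_integrable_on S \<and> integral S (\<lambda>x. \<bar>g' x\<bar> * f (g x)) = I"
    using I T g inj
    by (subst has_absolute_integral_change_of_variables_1') (auto intro: has_field_derivative_at_within)
  then have "((\<lambda>x. \<bar>g' x\<bar> * f (g x)) has_integral I) S"
    by (auto simp: has_integral_iff absolutely_integrable_on_def)
  then have "(\<integral>\<^sup>+x. ennreal (\<bar>g' x\<bar> * f (g x)) * indicator S x \<partial>lborel) = ennreal I"
    using nonneg T by (intro nn_integral_has_integral_lebesgue') (auto intro!: mult_nonneg_nonneg)
  also have "ennreal I = (\<integral>\<^sup>+y. ennreal (indicator T y *\<^sub>R f y) \<partial>lborel)"
    unfolding I_def set_lebesgue_integral_def using int nonneg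
    by (intro nn_integral_eq_integral[symmetric]) (auto simp: set_integrable_def indicator_def)
  finally show ?thesis using eq by simp
qed

lemma nn_integral_gaussian: "(\<integral>\<^sup>+v. ennreal (exp (- v\<^sup>2)) \<partial>lborel) = ennreal (sqrt pi)"
proof -
  have "(\<integral>\<^sup>+v. ennreal (exp (- v\<^sup>2)) \<partial>lborel)
      = (\<integral>\<^sup>+v. ennreal (sqrt pi) * ennreal (normal_density 0 (sqrt (1 / 2)) v) \<partial>lborel)"
    by (intro nn_integral_cong) (simp add: normal_density_def ennreal_mult'[symmetric])
  also have "\<dots> = ennreal (sqrt pi) * (\<integral>\<^sup>+v. ennreal (normal_density 0 (sqrt (1 / 2)) v) \<partial>lborel)"
    by (rule nn_integral_cmult) simp
  also have "(\<integral>\<^sup>+v. ennreal (normal_density 0 (sqrt (1 / 2)) v) \<partial>lborel) = 1"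
    using prob_space.emeasure_space_1[OF prob_space_normal_density[of "sqrt (1 / 2)" 0]]
    by (simp add: emeasure_density)
  finally show ?thesis by simp
qed

text \<open>By the substitution \<open>v = w / sqrt s - \<kappa> * sqrt s\<close>
  the Gaussian integral is the sum of two integrals, which the substitution \<open>s = w\<^sup>2 / (\<kappa>\<^sup>2 * u)\<close>
  exchanges.\<close>

lemma nn_integral_half_stable:
  fixes w \<kappa> :: real
  assumes w: "w > 0" and \<kappa>: "\<kappa> > 0"
  shows "(\<integral>\<^sup>+s. ennreal (w / sqrt pi * s powr (- 3 / 2) * exp (- w\<^sup>2 / s - \<kappa>\<^sup>2 * s)) * indicator {0<..} s \<partial>lborel)
           = ennreal (exp (- 2 * \<kappa> * w))"
proof -
  define E where "E s = exp (- w\<^sup>2 / s - \<kappa>\<^sup>2 * s)" for s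
  define A where "A = (\<integral>\<^sup>+s. ennreal (w * s powr (- 3 / 2) * E s) * indicator {0<..} s \<partial>lborel)"
  define B where "B = (\<integral>\<^sup>+s. ennreal (\<kappa> * s powr (- 1 / 2) * E s) * indicator {0<..} s \<partial>lborel)"
  have [measurable]: "E \<in> borel_measurable borel" unfolding E_def by measurable
  have E0: "E s \<ge> 0" for s by (simp add: E_def)
  have AB: "A + B = ennreal (2 * sqrt pi * exp (- 2 * \<kappa> * w))"
  proof -
    define g where "g s = w / sqrt s - \<kappa> * sqrt s" for s
    define g' where "g' s = - (w * s powr (- 3 / 2) + \<kappa> * s powr (- 1 / 2)) / 2" for s
    have [measurable]: "g' \<in> borel_measurable borel" "g \<in> borel_measurable borel" unfolding g_def g'_def by measurable
    have "(\<integral>\<^sup>+s. ennreal (\<bar>g' s\<bar> * exp (- (g s)\<^sup>2)) * indicator {0<..} s \<partial>lborel)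
        = (\<integral>\<^sup>+v. ennreal (exp (- v\<^sup>2)) * indicator UNIV v \<partial>lborel)"
    proof (rule nn_integral_change_of_variables_real)
      fix s :: real assume s: "s \<in> {0<..}"
      have p: "s powr (- 3 / 2) = 1 / (s * sqrt s)" "s powr (- 1 / 2) = 1 / sqrt s"
        using s powr_minus_divide[of s "1 / 2"] powr_minus_divide[of s "3 / 2"] powr_add[of s 1 "1 / 2"]
        by (simp_all add: powr_half_sqrt)
      show "(g has_real_derivative g' s) (at s)"
        unfolding g_def g'_def p using s
        by (auto intro!: derivative_eq_intros simp: field_simps real_sqrt_mult_self)
    next
      show "inj_on g {0<..}"
      proof (rule linorder_inj_onI)
        fix s u :: real assume su: "s < u" "s \<in> {0<..}" "u \<in> {0<..}"
        then have "w / sqrt u < w / sqrt s" "\<kappa> * sqrt s < \<kappa> * sqrt u"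
          using w \<kappa> by (auto intro!: divide_strict_left_mono)
        then show "g s \<noteq> g u" by (simp add: g_def)
      qed auto
    next
      show "g ` {0<..} = UNIV"
      proof (intro equalityI subset_UNIV subsetI)
        fix v :: real
        \<comment> \<open>The value of \<open>sqrt s\<close> with \<open>g s = v\<close>: the
          positive root of \<open>\<kappa> * r\<^sup>2 + v * r = w\<close>.\<close>
        define r where "r = (sqrt (v\<^sup>2 + 4 * \<kappa> * w) - v) / (2 * \<kappa>)"
        have "\<bar>v\<bar> < sqrt (v\<^sup>2 + 4 * \<kappa> * w)"
          using w \<kappa> by (intro real_less_rsqrt) auto
        then have r: "r > 0" using \<kappa> by (simp add: r_def)
        have q: "sqrt (v\<^sup>2 + 4 * \<kappa> * w) = 2 * \<kappa> * r + v" using \<kappa> by (simp add: r_def)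
        have "(2 * \<kappa> * r + v)\<^sup>2 = v\<^sup>2 + 4 * \<kappa> * w"
          using w \<kappa> unfolding q[symmetric] by (intro real_sqrt_pow2) auto
        then have "4 * \<kappa> * (\<kappa> * r * r + v * r - w) = 0" by (simp add: power2_eq_square algebra_simps)
        then have "\<kappa> * r * r + v * r - w = 0" using \<kappa> by simp
        then have "g (r\<^sup>2) = v" using r by (simp add: g_def field_simps)
        then show "v \<in> g ` {0<..}" using r by (intro image_eqI[of _ _ "r\<^sup>2"]) auto
      qed
    qed (auto simp: nn_integral_gaussian)
    also have "\<dots> = ennreal (sqrt pi)" by (simp add: nn_integral_gaussian)
    also have "(\<integral>\<^sup>+s. ennreal (\<bar>g' s\<bar> * exp (- (g s)\<^sup>2)) * indicator {0<..} s \<partial>lborel)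
      = (\<integral>\<^sup>+s. ennreal (exp (2 * \<kappa> * w) / 2) * (ennreal (w * s powr (- 3 / 2) * E s) * indicator {0<..} s
          + ennreal (\<kappa> * s powr (- 1 / 2) * E s) * indicator {0<..} s) \<partial>lborel)"
    proof (intro nn_integral_cong)
      fix s :: real
      show "ennreal (\<bar>g' s\<bar> * exp (- (g s)\<^sup>2)) * indicator {0<..} s =
        ennreal (exp (2 * \<kappa> * w) / 2) * (ennreal (w * s powr (- 3 / 2) * E s) * indicator {0<..} s
            + ennreal (\<kappa> * s powr (- 1 / 2) * E s) * indicator {0<..} s)"
      proof (cases "s > 0")
        case True
        have "(g s)\<^sup>2 = w\<^sup>2 / s + \<kappa>\<^sup>2 * s - 2 * \<kappa> * w"
          using True by (simp add: g_def power2_diff power_divide power_mult_distrib)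
        then have e1: "exp (- (g s)\<^sup>2) = exp (2 * \<kappa> * w) * E s"
          by (simp add: E_def exp_add[symmetric] algebra_simps)
        have e2: "\<bar>g' s\<bar> = (w * s powr (- 3 / 2) + \<kappa> * s powr (- 1 / 2)) / 2"
        proof -
          have "0 \<le> (w * s powr (- 3 / 2) + \<kappa> * s powr (- 1 / 2)) / 2"
            using w \<kappa> by (intro divide_nonneg_pos add_nonneg_nonneg mult_nonneg_nonneg) auto
          moreover have "g' s = - ((w * s powr (- 3 / 2) + \<kappa> * s powr (- 1 / 2)) / 2)"
              by (simp only: g'_def minus_divide_left)
          ultimately show ?thesis by (simp only: abs_minus_cancel abs_of_nonneg)
        qed
        have "\<bar>g' s\<bar> * exp (- (g s)\<^sup>2) = exp (2 * \<kappa> * w) / 2 * (w * s powr (- 3 / 2) * E s + \<kappa> * s powr (- 1 / 2) * E s)"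
        proof -
          have "(p + q) / 2 * (e * r) = e / 2 * (p * r + q * r)" for p q e r :: real
            by (simp add: field_simps)
          then show ?thesis unfolding e1 e2 .
        qed
        then show ?thesis using True w \<kappa> E0[of s]
            by (simp add: ennreal_mult'[symmetric] ennreal_plus[symmetric] del: ennreal_plus)
      qed auto
    qed
    also have "\<dots> = ennreal (exp (2 * \<kappa> * w) / 2) * (A + B)"
      by (simp add: nn_integral_cmult nn_integral_add A_def B_def)
    finally have "ennreal (2 * exp (- 2 * \<kappa> * w)) * (ennreal (exp (2 * \<kappa> * w) / 2) * (A + B))
        = ennreal (2 * exp (- 2 * \<kappa> * w)) * ennreal (sqrt pi)"
      by simp
    moreover have "ennreal (2 * exp (- 2 * \<kappa> * w)) * ennreal (exp (2 * \<kappa> * w) / 2) = 1"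
      by (simp add: ennreal_mult'[symmetric] exp_add[symmetric])
    moreover have "ennreal (2 * exp (- 2 * \<kappa> * w)) * ennreal (sqrt pi) = ennreal (2 * sqrt pi * exp (- 2 * \<kappa> * w))"
      by (simp add: ennreal_mult'[symmetric] mult_ac)
    ultimately show ?thesis by (simp only: mult.assoc[symmetric] mult_1_left)
  qed
  have "A = B"
  proof -
    define g where "g s = w\<^sup>2 / (\<kappa>\<^sup>2 * s)" for s
    have "(\<integral>\<^sup>+s. ennreal (\<bar>- w\<^sup>2 / (\<kappa>\<^sup>2 * s\<^sup>2)\<bar> * (\<kappa> * g s powr (- 1 / 2) * E (g s))) * indicator {0<..} s \<partial>lborel)
       = (\<integral>\<^sup>+s. ennreal (\<kappa> * s powr (- 1 / 2) * E s) * indicator {0<..} s \<partial>lborel)"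
    proof (rule nn_integral_change_of_variables_real)
      fix s :: real assume s: "s \<in> {0<..}"
      then show "(g has_real_derivative - w\<^sup>2 / (\<kappa>\<^sup>2 * s\<^sup>2)) (at s)"
        unfolding g_def using \<kappa> by (auto intro!: derivative_eq_intros simp: field_simps power2_eq_square)
    next
      show "inj_on g {0<..}" using w \<kappa> by (auto simp: inj_on_def g_def)
      show "g ` {0<..} = {0<..}"
      proof (intro equalityI subsetI)
        fix v :: real assume "v \<in> {0<..}"
        then show "v \<in> g ` {0<..}" using w \<kappa>
          by (intro image_eqI[of _ _ "w\<^sup>2 / (\<kappa>\<^sup>2 * v)"]) (auto simp: g_def)
      qed (use w \<kappa> in \<open>auto simp: g_def\<close>)
      \<comment> \<open>The finiteness demanded by this substitution comes from the value of the
        sum, which is why \<open>AB\<close> precedes \<open>A = B\<close>.\<close>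
      have "B \<le> A + B" by simp
      also have "A + B < \<infinity>" using AB by simp
      finally show "(\<integral>\<^sup>+s. ennreal (\<kappa> * s powr (- 1 / 2) * E s) * indicator {0<..} s \<partial>lborel) < \<infinity>"
        by (simp add: B_def)
    qed (use \<kappa> E0 in auto)
    also have "(\<integral>\<^sup>+s. ennreal (\<bar>- w\<^sup>2 / (\<kappa>\<^sup>2 * s\<^sup>2)\<bar> * (\<kappa> * g s powr (- 1 / 2) * E (g s))) * indicator {0<..} s \<partial>lborel) = A"
      unfolding A_def
    proof (intro nn_integral_cong)
      fix s :: real
      show "ennreal (\<bar>- w\<^sup>2 / (\<kappa>\<^sup>2 * s\<^sup>2)\<bar> * (\<kappa> * g s powr (- 1 / 2) * E (g s))) * indicator {0<..} s
         = ennreal (w * s powr (- 3 / 2) * E s) * indicator {0<..} s"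
      proof (cases "s > 0")
        case True
        have "E (g s) = E s"
          using True w \<kappa> by (simp add: E_def g_def field_simps)
        moreover have "g s powr (- 1 / 2) = \<kappa> / w * s powr (1 / 2)"
        proof -
          have "g s powr (- 1 / 2) = 1 / sqrt (g s)"
            using True w \<kappa> powr_minus_divide[of "g s" "1 / 2"] by (simp add: powr_half_sqrt g_def)
          also have "sqrt (g s) = w / (\<kappa> * sqrt s)"
            using True w \<kappa> by (simp add: g_def real_sqrt_divide real_sqrt_mult)
          finally show ?thesis using True w \<kappa> by (simp add: powr_half_sqrt)
        qed
        moreover have "s powr (- 3 / 2) = s powr (1 / 2) / s\<^sup>2"
          using True powr_diff[of s "1 / 2" 2] by simp
        moreover have "\<bar>- w\<^sup>2 / (\<kappa>\<^sup>2 * s\<^sup>2)\<bar> * (\<kappa> * (\<kappa> / w * s powr (1 / 2)) * E s) = w * (s powr (1 / 2) / s\<^sup>2) * E s"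
          using True w \<kappa> by (simp add: field_simps power2_eq_square)
        ultimately show ?thesis by metis
      qed auto
    qed
    finally show "A = B" by (simp add: B_def)
  qed
  have "ennreal 2 * A = A + B" using \<open>A = B\<close> by (simp add: mult_2)
  also have "\<dots> = ennreal 2 * ennreal (sqrt pi * exp (- 2 * \<kappa> * w))"
    unfolding AB by (subst ennreal_mult'[symmetric]) (simp_all add: mult.assoc)
  finally have "ennreal 2 * A = ennreal 2 * ennreal (sqrt pi * exp (- 2 * \<kappa> * w))" .
  then have "ennreal (1 / 2) * (ennreal 2 * A) = ennreal (1 / 2) * (ennreal 2 * ennreal (sqrt pi * exp (- 2 * \<kappa> * w)))"
    by simp
  then have A: "A = ennreal (sqrt pi * exp (- 2 * \<kappa> * w))"
    by (simp only: mult.assoc[symmetric] ennreal_mult'[symmetric]) simp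
  have "(\<integral>\<^sup>+s. ennreal (w / sqrt pi * s powr (- 3 / 2) * exp (- w\<^sup>2 / s - \<kappa>\<^sup>2 * s)) * indicator {0<..} s \<partial>lborel)
     = (\<integral>\<^sup>+s. ennreal (1 / sqrt pi) * (ennreal (w * s powr (- 3 / 2) * E s) * indicator {0<..} s) \<partial>lborel)"
    by (intro nn_integral_cong) (simp add: E_def ennreal_mult'[symmetric] mult.assoc[symmetric])
  also have "\<dots> = ennreal (1 / sqrt pi) * A"
    unfolding A_def by (rule nn_integral_cmult) measurable
  also have "\<dots> = ennreal (exp (- 2 * \<kappa> * w))"
    unfolding A by (simp add: ennreal_mult'[symmetric])
  finally show ?thesis .
qed

text \<open>Two integral representations of the Macdonald function, matched by inserting
  \<open>exp (- 2 * \<kappa> * w)\<close>, \<open>w = y + x / 2\<close>, as a half-stable Laplace transform: then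
  \<open>w\<^sup>2 = x\<^sup>2 / 4 + y * (x + y)\<close>.\<close>

lemma nn_integral_macdonald:
  fixes c \<kappa> x :: real
  assumes c: "c > 0" and \<kappa>: "\<kappa> > 0" and x: "x \<ge> 0"
  shows "(\<integral>\<^sup>+y. ennreal (((x + y) * y) powr (c - 1) * exp (- \<kappa> * (x + 2 * y))) * indicator {0<..} y \<partial>lborel)
    = ennreal (Gamma c / (2 * sqrt pi)) *
      (\<integral>\<^sup>+s. ennreal (s powr (c - 3 / 2) * exp (- x\<^sup>2 / (4 * s) - \<kappa>\<^sup>2 * s)) * indicator {0<..} s \<partial>lborel)"
proof -
  \<comment> \<open>The prefactor is \<open>w / sqrt pi\<close> with
    \<open>w = (x + 2 * y) / 2\<close>. Its factor \<open>x + 2 * y\<close> is the derivative of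
    \<open>(x + y) * y\<close> in \<open>y\<close>, so after exchanging the integrals the inner one
    is a gamma integral in \<open>v = (x + y) * y\<close>.\<close>
  define h where "h s y = 1 / (2 * sqrt pi) * (s powr (- 3 / 2) * exp (- x\<^sup>2 / (4 * s) - \<kappa>\<^sup>2 * s)) *
     ((x + 2 * y) * (((x + y) * y) powr (c - 1) * exp (- ((x + y) * y) / s)))" for s y
  have hm[measurable]: "(\<lambda>(s, y). ennreal (h s y)) \<in> borel_measurable (borel \<Otimes>\<^sub>M borel)"
    unfolding h_def by measurable
  have "(\<integral>\<^sup>+y. ennreal (((x + y) * y) powr (c - 1) * exp (- \<kappa> * (x + 2 * y))) * indicator {0<..} y \<partial>lborel)
     = (\<integral>\<^sup>+y. (\<integral>\<^sup>+s. ennreal (h s y) * indicator {0<..} s * indicator {0<..} y \<partial>lborel) \<partial>lborel)"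
  proof (intro nn_integral_cong)
    fix y :: real
    show "ennreal (((x + y) * y) powr (c - 1) * exp (- \<kappa> * (x + 2 * y))) * indicator {0<..} y
       = (\<integral>\<^sup>+s. ennreal (h s y) * indicator {0<..} s * indicator {0<..} y \<partial>lborel)"
    proof (cases "y > 0")
      case y: True
      define w where "w = y + x / 2"
      have w: "w > 0" using y x by (simp add: w_def)
      have w2: "w\<^sup>2 = x\<^sup>2 / 4 + (x + y) * y" by (simp add: w_def power2_eq_square field_simps)
      have "(\<integral>\<^sup>+s. ennreal (h s y) * indicator {0<..} s * indicator {0<..} y \<partial>lborel)
         = (\<integral>\<^sup>+s. ennreal (((x + y) * y) powr (c - 1)) * (ennreal (w / sqrt pi * s powr (- 3 / 2)
             * exp (- w\<^sup>2 / s - \<kappa>\<^sup>2 * s)) * indicator {0<..} s) \<partial>lborel)"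
      proof (intro nn_integral_cong)
        fix s :: real
        show "ennreal (h s y) * indicator {0<..} s * indicator {0<..} y
            = ennreal (((x + y) * y) powr (c - 1)) * (ennreal (w / sqrt pi * s powr (- 3 / 2) * exp (- w\<^sup>2 / s - \<kappa>\<^sup>2
            * s)) * indicator {0<..} s)"
        proof (cases "s > 0")
          case s: True
          have e: "exp (- w\<^sup>2 / s - \<kappa>\<^sup>2 * s) = exp (- x\<^sup>2 / (4 * s) - \<kappa>\<^sup>2 * s) * exp (- ((x + y) * y) / s)"
            unfolding w2 exp_add[symmetric] using s by (intro arg_cong[where f = exp]) (simp add: field_simps)
          have "h s y = ((x + y) * y) powr (c - 1) * (w / sqrt pi * s powr (- 3 / 2) * exp (- w\<^sup>2 / s - \<kappa>\<^sup>2 * s))"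
            unfolding e h_def by (simp add: w_def field_simps)
          then show ?thesis using s y by (simp add: ennreal_mult'[symmetric])
        qed auto
      qed
      also have "\<dots> = ennreal (((x + y) * y) powr (c - 1)) * ennreal (exp (- 2 * \<kappa> * w))"
        using w \<kappa> by (subst nn_integral_cmult) (simp_all only: nn_integral_half_stable, measurable)
      also have "\<dots> = ennreal (((x + y) * y) powr (c - 1) * exp (- \<kappa> * (x + 2 * y)))"
        by (simp add: ennreal_mult'[symmetric] w_def algebra_simps)
      finally show ?thesis using y by simp
    qed auto
  qed
  also have "\<dots> = (\<integral>\<^sup>+s. (\<integral>\<^sup>+y. ennreal (h s y) * indicator {0<..} s * indicator {0<..} y \<partial>lborel) \<partial>lborel)"
    by (rule lborel_pair.Fubini') measurable
  also have "\<dots> = (\<integral>\<^sup>+s. ennreal (Gamma c / (2 * sqrt pi)) * (ennreal (s powr (c - 3 / 2) * exp (- x\<^sup>2 / (4 * s) - \<kappa>\<^sup>2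
      * s)) * indicator {0<..} s) \<partial>lborel)"
  proof (intro nn_integral_cong)
    fix s :: real
    show "(\<integral>\<^sup>+y. ennreal (h s y) * indicator {0<..} s * indicator {0<..} y \<partial>lborel)
      = ennreal (Gamma c / (2 * sqrt pi)) * (ennreal (s powr (c - 3 / 2) * exp (- x\<^sup>2 / (4 * s) - \<kappa>\<^sup>2 * s))
          * indicator {0<..} s)"
    proof (cases "s > 0")
      case s: True
      define G where "G v = v powr (c - 1) * exp (- v / s)" for v
      define K where "K = 1 / (2 * sqrt pi) * (s powr (- 3 / 2) * exp (- x\<^sup>2 / (4 * s) - \<kappa>\<^sup>2 * s))"
      have [measurable]: "G \<in> borel_measurable borel" unfolding G_def by measurable
      have G: "(\<integral>\<^sup>+v. ennreal (G v) * indicator {0<..} v \<partial>lborel) = ennreal (Gamma c * s powr c)"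
        using nn_integral_powr_exp[of "1 / s" c] s c by (simp add: G_def powr_divide)
      have "(\<integral>\<^sup>+y. ennreal (\<bar>x + 2 * y\<bar> * G ((x + y) * y)) * indicator {0<..} y \<partial>lborel)
         = (\<integral>\<^sup>+v. ennreal (G v) * indicator {0<..} v \<partial>lborel)"
      proof (rule nn_integral_change_of_variables_real)
        fix y :: real
        show "((\<lambda>y. (x + y) * y) has_real_derivative x + 2 * y) (at y)"
          by (auto intro!: derivative_eq_intros simp: algebra_simps)
      next
        show "inj_on (\<lambda>y. (x + y) * y) {0<..}"
        proof (rule linorder_inj_onI)
          fix y z :: real assume "y < z" "y \<in> {0<..}" "z \<in> {0<..}"
          then have "(x + y) * y < (x + z) * z" using x by (intro mult_strict_mono) auto
          then show "(x + y) * y \<noteq> (x + z) * z" by simp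
        qed auto
        show "(\<lambda>y. (x + y) * y) ` {0<..} = {0<..}"
        proof (intro equalityI subsetI)
          fix v :: real assume v: "v \<in> {0<..}"
          \<comment> \<open>The positive root of \<open>y\<^sup>2 + x * y = v\<close>.\<close>
          define y where "y = (sqrt (x\<^sup>2 + 4 * v) - x) / 2"
          have "x < sqrt (x\<^sup>2 + 4 * v)" using v by (intro real_less_rsqrt) auto
          then have "y > 0" by (simp add: y_def)
          moreover have q: "2 * y + x = sqrt (x\<^sup>2 + 4 * v)" by (simp add: y_def field_simps)
          have "(2 * y + x)\<^sup>2 = x\<^sup>2 + 4 * v" unfolding q using v by (intro real_sqrt_pow2) auto
          then have "v = (x + y) * y" by (simp add: power2_eq_square algebra_simps)
          ultimately show "v \<in> (\<lambda>y. (x + y) * y) ` {0<..}" by auto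
        qed (use x in auto)
      qed (auto simp: G, auto simp: G_def)
      then have g: "(\<integral>\<^sup>+y. ennreal (\<bar>x + 2 * y\<bar> * G ((x + y) * y)) * indicator {0<..} y \<partial>lborel)
          = ennreal (Gamma c * s powr c)"
        by (simp add: G)
      have "(\<integral>\<^sup>+y. ennreal (h s y) * indicator {0<..} s * indicator {0<..} y \<partial>lborel)
         = (\<integral>\<^sup>+y. ennreal K * (ennreal (\<bar>x + 2 * y\<bar> * G ((x + y) * y)) * indicator {0<..} y) \<partial>lborel)"
        using s x by (intro nn_integral_cong) (auto simp: h_def K_def G_def indicator_def ennreal_mult'[symmetric])
      also have "\<dots> = ennreal K * ennreal (Gamma c * s powr c)"
        by (subst nn_integral_cmult) (auto simp: g)
      also have "K * (Gamma c * s powr c) = Gamma c / (2 * sqrt pi) * (s powr (c - 3 / 2) * exp (- x\<^sup>2 / (4 * s) - \<kappa>\<^sup>2 * s))"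
      proof -
        have "s powr (c - 3 / 2) = s powr c * s powr (- 3 / 2)"
          by (simp add: powr_add[symmetric])
        then show ?thesis by (simp add: K_def)
      qed
      then have "ennreal K * ennreal (Gamma c * s powr c)
          = ennreal (Gamma c / (2 * sqrt pi)) * ennreal (s powr (c - 3 / 2) * exp (- x\<^sup>2 / (4 * s) - \<kappa>\<^sup>2 * s))"
        using c by (simp add: ennreal_mult''[symmetric] )
      finally show ?thesis using s by simp
    qed auto
  qed
  also have "\<dots> = ennreal (Gamma c / (2 * sqrt pi)) *
      (\<integral>\<^sup>+s. ennreal (s powr (c - 3 / 2) * exp (- x\<^sup>2 / (4 * s) - \<kappa>\<^sup>2 * s)) * indicator {0<..} s \<partial>lborel)"
    by (rule nn_integral_cmult) measurable
  finally show ?thesis .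
qed

text \<open>The rate \<open>\<beta>m\<close> is this function at \<open>- \<theta>\<close>, so
  reflecting the line amounts to changing the sign of \<open>\<theta>\<close> and exchanging the
  rates.\<close>

definition vg_plus_rate :: "real \<Rightarrow> real \<Rightarrow> real" where
  "vg_plus_rate b \<theta> = sqrt (\<theta>\<^sup>2 / 4 + b) - \<theta> / 2"

lemma vg_plus_rate_pos: "b > 0 \<Longrightarrow> vg_plus_rate b \<theta> > 0"
proof -
  assume "b > 0"
  then have "\<theta> / 2 < sqrt (\<theta>\<^sup>2 / 4 + b)" by (intro real_less_rsqrt) (simp add: power_divide)
  then show ?thesis by (simp add: vg_plus_rate_def)
qed

lemma vg_plus_rate_mult: "b > 0 \<Longrightarrow> vg_plus_rate b \<theta> * vg_plus_rate b (- \<theta>) = b"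
proof -
  assume "b > 0"
  then have "(sqrt (\<theta>\<^sup>2 / 4 + b))\<^sup>2 = \<theta>\<^sup>2 / 4 + b" by (intro real_sqrt_pow2) auto
  then show ?thesis by (simp add: vg_plus_rate_def algebra_simps power2_eq_square)
qed

lemma vg_integrand_minus: "vg_integrand a b (- \<theta>) t (- x) s = vg_integrand a b \<theta> t x s"
  by (simp add: vg_integrand_def drifted_bm_density_def power2_commute[of "\<theta> * s"])

text \<open>With \<open>\<kappa>\<^sup>2 = \<theta>\<^sup>2 / 4 + b\<close> the negated exponents
  are \<open>x\<^sup>2 / (4 * s) + \<kappa>\<^sup>2 * s - \<theta> * x / 2\<close> on the left, by
  completing the square, and \<open>\<kappa> * (x + 2 * y) - \<theta> * x / 2\<close> on the right.
  Apart from \<open>exp (\<theta> * x / 2)\<close> and constants these are the two sides of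
  \<open>nn_integral_macdonald\<close>.\<close>

lemma nn_integral_vg_integrand_aux:
  fixes a b \<theta> t x :: real
  assumes a: "a > 0" and b: "b > 0" and t: "t > 0" and x: "x \<ge> 0"
  shows "(\<integral>\<^sup>+s. ennreal (vg_integrand a b \<theta> t x s) \<partial>lborel) =
     (\<integral>\<^sup>+y. ennreal (gam (vg_plus_rate b \<theta>) (a * t) (x + y) * gam (vg_plus_rate b (- \<theta>)) (a * t) y) \<partial>lborel)"
proof -
  define c where "c = a * t"
  have c: "c > 0" using a t by (simp add: c_def)
  define \<kappa> where "\<kappa> = sqrt (\<theta>\<^sup>2 / 4 + b)"
  have \<kappa>: "\<kappa> > 0" using b by (simp add: \<kappa>_def add_nonneg_pos)
  have \<kappa>2: "\<kappa>\<^sup>2 = \<theta>\<^sup>2 / 4 + b" using b by (simp add: \<kappa>_def)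
  define I where "I = (\<integral>\<^sup>+s. ennreal (s powr (c - 3 / 2) * exp (- x\<^sup>2 / (4 * s) - \<kappa>\<^sup>2 * s)) * indicator {0<..} s \<partial>lborel)"
  define K1 where "K1 = b powr c / Gamma c * exp (\<theta> * x / 2) / (2 * sqrt pi)"
  define K2 where "K2 = b powr c / (Gamma c)\<^sup>2 * exp (\<theta> * x / 2)"
  have "(\<integral>\<^sup>+s. ennreal (vg_integrand a b \<theta> t x s) \<partial>lborel)
     = (\<integral>\<^sup>+s. ennreal K1 * (ennreal (s powr (c - 3 / 2) * exp (- x\<^sup>2 / (4 * s) - \<kappa>\<^sup>2 * s)) * indicator {0<..} s) \<partial>lborel)"
  proof (intro nn_integral_cong)
    fix s :: real
    show "ennreal (vg_integrand a b \<theta> t x s) = ennreal K1 * (ennreal (s powr (c - 3 / 2) * exp (- x\<^sup>2 / (4 * s) - \<kappa>\<^sup>2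
        * s)) * indicator {0<..} s)"
    proof (cases "s > 0")
      case s: True
      have e: "exp (- (x - \<theta> * s)\<^sup>2 / (4 * s)) * exp (- b * s) = exp (\<theta> * x / 2) * exp (- x\<^sup>2 / (4 * s) - \<kappa>\<^sup>2 * s)"
        unfolding exp_add[symmetric] \<kappa>2 using s
        by (intro arg_cong[where f = exp]) (simp add: field_simps power2_eq_square)
      have p: "s powr (c - 1) / sqrt s = s powr (c - 3 / 2)"
      proof -
        have "s powr (c - 3 / 2) = s powr (c - 1) / s powr (1 / 2)"
          by (simp add: powr_diff[symmetric])
        then show ?thesis using s by (simp add: powr_half_sqrt)
      qed
      have "vg_integrand a b \<theta> t x s = b powr c / Gamma c / (2 * sqrt pi) * (s powr (c - 1) / sqrt s) * (exp (- (x - \<theta>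
          * s)\<^sup>2 / (4 * s)) * exp (- b * s))"
        using s by (simp add: vg_integrand_def drifted_bm_density_def gamma_density_def c_def real_sqrt_mult mult_ac)
      also have "\<dots> = K1 * (s powr (c - 3 / 2) * exp (- x\<^sup>2 / (4 * s) - \<kappa>\<^sup>2 * s))"
        unfolding e p by (simp add: K1_def)
      finally show ?thesis using s c by (simp add: ennreal_mult''[symmetric])
    qed (simp add: vg_integrand_def gamma_density_def)
  qed
  also have "\<dots> = ennreal K1 * I"
    unfolding I_def by (rule nn_integral_cmult) measurable
  also have "\<dots> = ennreal K2 * (ennreal (Gamma c / (2 * sqrt pi)) * I)"
  proof -
    have "Gamma c > 0" using c by simp
    then have "K1 = K2 * (Gamma c / (2 * sqrt pi))" by (simp add: K1_def K2_def power2_eq_square)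
    moreover have "K2 \<ge> 0" by (simp add: K2_def)
    ultimately have "ennreal K1 = ennreal K2 * ennreal (Gamma c / (2 * sqrt pi))"
      by (simp only: ennreal_mult')
    then show ?thesis by (simp only: mult.assoc)
  qed
  also have "\<dots> = ennreal K2 * (\<integral>\<^sup>+y. ennreal (((x + y) * y) powr (c - 1) * exp (- \<kappa> * (x
      + 2 * y))) * indicator {0<..} y \<partial>lborel)"
    unfolding I_def nn_integral_macdonald[OF c \<kappa> x] ..
  also have "\<dots> = (\<integral>\<^sup>+y. ennreal K2 * (ennreal (((x + y) * y) powr (c - 1) * exp (- \<kappa> * (x
      + 2 * y))) * indicator {0<..} y) \<partial>lborel)"
    by (rule nn_integral_cmult[symmetric]) measurable
  also have "\<dots> = (\<integral>\<^sup>+y. ennreal (gam (vg_plus_rate b \<theta>) c (x + y) * gam (vg_plus_rate b (- \<theta>)) c y) \<partial>lborel)"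
  proof (intro nn_integral_cong)
    fix y :: real
    show "ennreal K2 * (ennreal (((x + y) * y) powr (c - 1) * exp (- \<kappa> * (x + 2 * y))) * indicator {0<..} y)
       = ennreal (gam (vg_plus_rate b \<theta>) c (x + y) * gam (vg_plus_rate b (- \<theta>)) c y)"
    proof (cases "y > 0")
      case y: True
      have e: "exp (- vg_plus_rate b \<theta> * (x + y)) * exp (- vg_plus_rate b (- \<theta>) * y)
          = exp (\<theta> * x / 2) * exp (- \<kappa> * (x + 2 * y))"
        unfolding exp_add[symmetric] by (intro arg_cong[where f = exp]) (simp add: vg_plus_rate_def \<kappa>_def algebra_simps)
      have bb: "vg_plus_rate b \<theta> powr c * vg_plus_rate b (- \<theta>) powr c = b powr c"
        using b vg_plus_rate_pos[OF b] by (simp add: powr_mult[symmetric] vg_plus_rate_mult less_imp_le)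
      have "gam (vg_plus_rate b \<theta>) c (x + y) * gam (vg_plus_rate b (- \<theta>)) c y =
        (vg_plus_rate b \<theta> powr c * vg_plus_rate b (- \<theta>) powr c) / (Gamma c)\<^sup>2 * ((x + y) powr (c - 1) * y powr (c - 1)) *
        (exp (- vg_plus_rate b \<theta> * (x + y)) * exp (- vg_plus_rate b (- \<theta>) * y))"
        using y x by (simp add: gam_def power2_eq_square)
      also have "\<dots> = K2 * (((x + y) * y) powr (c - 1) * exp (- \<kappa> * (x + 2 * y)))"
        unfolding e bb using x y by (simp add: K2_def powr_mult)
      finally show ?thesis using y by (simp add: ennreal_mult''[symmetric])
    qed (simp add: gam_def)
  qed
  finally show ?thesis by (simp add: c_def)
qed

text \<open>A negative \<open>x\<close> is reflected together with \<open>\<theta>\<close>, which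
  exchanges the rates; shifting \<open>y\<close> by \<open>x\<close> restores the order of the
  factors.\<close>

lemma nn_integral_vg_integrand:
  fixes a b \<theta> t x :: real
  assumes a: "a > 0" and b: "b > 0" and t: "t > 0"
  shows "(\<integral>\<^sup>+s. ennreal (vg_integrand a b \<theta> t x s) \<partial>lborel) =
     (\<integral>\<^sup>+y. ennreal (gam (vg_plus_rate b \<theta>) (a * t) (x + y) * gam (vg_plus_rate b (- \<theta>)) (a * t) y) \<partial>lborel)"
proof (cases "x \<ge> 0")
  case True
  then show ?thesis using nn_integral_vg_integrand_aux[OF a b t] by blast
next
  case False
  then have "(\<integral>\<^sup>+s. ennreal (vg_integrand a b \<theta> t x s) \<partial>lborel) =
     (\<integral>\<^sup>+y. ennreal (gam (vg_plus_rate b (- \<theta>)) (a * t) (- x + y) * gam (vg_plus_rate b \<theta>) (a * t) y) \<partial>lborel)"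
    using nn_integral_vg_integrand_aux[OF a b t, of "- x" "- \<theta>"] by (simp add: vg_integrand_minus)
  also have "\<dots> = (\<integral>\<^sup>+y. ennreal (gam (vg_plus_rate b \<theta>) (a * t) (x + y) * gam (vg_plus_rate b (- \<theta>)) (a * t) y) \<partial>lborel)"
    by (subst nn_integral_real_affine[where t = x and c = 1]) (auto simp: mult.commute)
  finally show ?thesis .
qed

lemma measurable_vg_integrand [measurable]:
  "(\<lambda>(x, s). vg_integrand a b \<theta> t x s) \<in> borel_measurable (borel \<Otimes>\<^sub>M borel)"
  unfolding vg_integrand_def drifted_bm_density_def gamma_density_eq by measurable

lemma vg_integrand_nonneg: "a > 0 \<Longrightarrow> t > 0 \<Longrightarrow> vg_integrand a b \<theta> t x s \<ge> 0"
  by (auto simp: vg_integrand_def drifted_bm_density_def gamma_density_def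
       intro!: mult_nonneg_nonneg divide_nonneg_nonneg)

lemma vg_density_altdef: "vg_density a b \<theta> t x = (\<integral>s. vg_integrand a b \<theta> t x s \<partial>lborel)"
  unfolding vg_density_def set_lebesgue_integral_def
  by (intro Bochner_Integration.integral_cong) (auto simp: indicator_def vg_integrand_def gamma_density_def)

lemma vg_density_finite_altdef:
  "vg_density_finite a b \<theta> t x \<longleftrightarrow> integrable lborel (vg_integrand a b \<theta> t x)"
  unfolding vg_density_finite_def set_integrable_def
  by (intro Bochner_Integration.integrable_cong) (auto simp: indicator_def vg_integrand_def gamma_density_def)

text \<open>Equality of nonnegative integrals transfers integrability in both directions, and where
  both are infinite the two Bochner integrals share the default value 0; no point \<open>x\<close>
  has to be excluded.\<close>

lemma vg_density_eq_gam:
  fixes a b \<theta> t x :: real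
  assumes a: "a > 0" and b: "b > 0" and t: "t > 0"
  shows "vg_density a b \<theta> t x =
     (\<integral>y. gam (vg_plus_rate b \<theta>) (a * t) (x + y) * gam (vg_plus_rate b (- \<theta>)) (a * t) y \<partial>lborel)"
    and "vg_density_finite a b \<theta> t x \<longleftrightarrow>
     integrable lborel (\<lambda>y. gam (vg_plus_rate b \<theta>) (a * t) (x + y) * gam (vg_plus_rate b (- \<theta>)) (a * t) y)"
proof -
  have [simp]: "a * t > 0" using a t by simp
  show "vg_density a b \<theta> t x =
     (\<integral>y. gam (vg_plus_rate b \<theta>) (a * t) (x + y) * gam (vg_plus_rate b (- \<theta>)) (a * t) y \<partial>lborel)"
    unfolding vg_density_altdef
    using nn_integral_vg_integrand[OF a b t] vg_integrand_nonneg[OF a t]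
    by (simp add: integral_eq_nn_integral)
  show "vg_density_finite a b \<theta> t x \<longleftrightarrow>
     integrable lborel (\<lambda>y. gam (vg_plus_rate b \<theta>) (a * t) (x + y) * gam (vg_plus_rate b (- \<theta>)) (a * t) y)"
    unfolding vg_density_finite_altdef integrable_iff_bounded
    using nn_integral_vg_integrand[OF a b t] vg_integrand_nonneg[OF a t]
    by (simp add: abs_mult)
qed

section \<open>Correlations of gamma densities\<close>

text \<open>If \<open>f\<close> and \<open>g\<close> are the densities of independent
  \<open>Y\<close> and \<open>Z\<close>, this is the density of \<open>Z - Y\<close>. For the
  process the first argument belongs to \<open>\<beta>m\<close>, the second to
  \<open>\<beta>p\<close>.\<close>

definition xcorr :: "(real \<Rightarrow> real) \<Rightarrow> (real \<Rightarrow> real) \<Rightarrow> real \<Rightarrow> real" where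
  "xcorr f g x = (\<integral>y. f y * g (x + y) \<partial>lborel)"

lemma measurable_xcorr [measurable]:
  assumes [measurable]: "f \<in> borel_measurable borel" "g \<in> borel_measurable borel"
  shows "xcorr f g \<in> borel_measurable borel"
  unfolding xcorr_def[abs_def] by measurable

lemma xcorr_uminus: "xcorr f g (- x) = xcorr g f x"
  unfolding xcorr_def
  by (subst lborel_integral_real_affine[where t = x and c = 1]) (auto simp: mult.commute)

lemma integrable_xcorr_uminus:
  fixes f g :: "real \<Rightarrow> real"
  shows "integrable lborel (\<lambda>y. f y * g (- x + y)) \<longleftrightarrow> integrable lborel (\<lambda>y. g y * f (x + y))"
  by (subst lborel_integrable_real_affine_iff[where t = x and c = 1, symmetric]) (auto simp: mult.commute)

text \<open>One class for \<open>gam\<close> and \<open>dgam\<close>: a power singularity of order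
  \<open>\<eta>\<close> at 0, exponential decay, and continuity on the open half-line only, since at
  0 the functions may jump or blow up.\<close>

definition gam_dominated :: "real \<Rightarrow> real \<Rightarrow> (real \<Rightarrow> real) \<Rightarrow> bool" where
  "gam_dominated \<eta> \<kappa> f \<longleftrightarrow> f \<in> borel_measurable borel \<and> (\<forall>z\<le>0. f z = 0) \<and> continuous_on {0<..} f \<and>
     (\<exists>C\<ge>0. \<forall>z>0. \<bar>f z\<bar> \<le> C * (z powr (- \<eta>) * exp (- \<kappa> * z)))"

text \<open>\<open>f\<close> is singular at \<open>y = 0\<close>, \<open>g (x + y)\<close> at
  \<open>y = - x\<close>. While \<open>x\<close> stays above a positive \<open>x1\<close>, the
  second singularity is out of reach; for \<open>x1 = 0\<close> the two can merge into
  \<open>y powr (- 2 * \<eta>)\<close>, integrable when \<open>2 * \<eta> < 1\<close>. As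
  \<open>\<eta>\<close> will have to exceed \<open>1 - c\<close>, shape \<open>1 / 2\<close> becomes
  critical here.\<close>

lemma gam_dominated_bound:
  fixes f g :: "real \<Rightarrow> real"
  assumes f: "gam_dominated \<eta> \<kappa> f" and g: "gam_dominated \<eta> \<kappa> g" and \<kappa>: "\<kappa> > 0" and \<eta>: "\<eta> \<ge> 0" "\<eta> < 1"
    and x1: "x1 > 0 \<or> x1 = 0 \<and> 2 * \<eta> < 1"
  obtains w where "integrable lborel w" "\<And>x y. x \<ge> x1 \<Longrightarrow> \<bar>f y * g (x + y)\<bar> \<le> w y"
proof -
  obtain C D where C: "C \<ge> 0" "\<And>z. z > 0 \<Longrightarrow> \<bar>f z\<bar> \<le> C * (z powr (- \<eta>) * exp (- \<kappa> * z))"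
    and D: "D \<ge> 0" "\<And>z. z > 0 \<Longrightarrow> \<bar>g z\<bar> \<le> D * (z powr (- \<eta>) * exp (- \<kappa> * z))"
    using f g unfolding gam_dominated_def by blast
  have f0: "f y = 0" if "y \<le> 0" for y using f that by (simp add: gam_dominated_def)
  obtain M \<eta>' where M: "M \<ge> 0" "\<eta>' < 1" and le: "\<And>y. y > 0 \<Longrightarrow> y powr (- \<eta>) * (x1 + y) powr (- \<eta>) \<le> M * y powr (- \<eta>')"
  proof (cases "x1 > 0")
    case True
    then have "y powr (- \<eta>) * (x1 + y) powr (- \<eta>) \<le> x1 powr (- \<eta>) * y powr (- \<eta>)" if "y > 0" for y
      using that \<eta> by (subst mult.commute) (intro mult_right_mono powr_mono2', auto)
    then show ?thesis using that[of "x1 powr (- \<eta>)" \<eta>] \<eta> by simp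
  next
    case False
    then have x10: "x1 = 0" "2 * \<eta> < 1" using x1 by auto
    have "y powr (- \<eta>) * (x1 + y) powr (- \<eta>) \<le> 1 * y powr (- (2 * \<eta>))" if "y > 0" for y
      using that x10 by (simp add: powr_add[symmetric])
    then show ?thesis using that[of 1 "2 * \<eta>"] x10 by simp
  qed
  define w where "w y = C * D * M * (indicator {0<..} y *\<^sub>R (y powr (- \<eta>') * exp (- \<kappa> * y)))" for y
  have "integrable lborel (\<lambda>y. indicator {0<..} y *\<^sub>R (y powr (- \<eta>') * exp (- \<kappa> * y)))"
    using set_integrable_powr_exp[of \<kappa> "1 - \<eta>'"] \<kappa> M by (simp add: set_integrable_def)
  then have "integrable lborel w"
    unfolding w_def by (rule integrable_mult_right)
  moreover have "\<bar>f y * g (x + y)\<bar> \<le> w y" if x: "x \<ge> x1" for x y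
  proof (cases "y > 0")
    case y: True
    have x0: "x \<ge> 0" using x x1 by auto
    have "\<bar>g (x + y)\<bar> \<le> D * ((x + y) powr (- \<eta>) * exp (- \<kappa> * (x + y)))"
      using D(2)[of "x + y"] x0 y by simp
    also have "\<dots> \<le> D * ((x1 + y) powr (- \<eta>) * 1)"
      using x x0 y x1 \<kappa> \<eta> D by (intro mult_left_mono mult_mono powr_mono2') auto
    finally have "\<bar>f y\<bar> * \<bar>g (x + y)\<bar> \<le> (C * (y powr (- \<eta>) * exp (- \<kappa> * y))) * (D * ((x1 + y) powr (- \<eta>) * 1))"
      using C y by (intro mult_mono) auto
    also have "\<dots> = C * D * exp (- \<kappa> * y) * (y powr (- \<eta>) * (x1 + y) powr (- \<eta>))" by simp
    also have "\<dots> \<le> C * D * exp (- \<kappa> * y) * (M * y powr (- \<eta>'))"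
      using le[OF y] C D by (intro mult_left_mono) auto
    finally show ?thesis using y by (simp add: w_def abs_mult mult_ac)
  qed (simp add: f0 w_def)
  ultimately show thesis by (rule that)
qed

text \<open>Dominated convergence along sequences. The half-line is closed so that for
  \<open>x1 = 0\<close> two one-sided statements can be glued at the origin.\<close>

lemma gam_dominated_right:
  fixes f g :: "real \<Rightarrow> real"
  assumes f: "gam_dominated \<eta> \<kappa> f" and g: "gam_dominated \<eta> \<kappa> g" and \<kappa>: "\<kappa> > 0" and \<eta>: "\<eta> \<ge> 0" "\<eta> < 1"
    and x1: "x1 > 0 \<or> x1 = 0 \<and> 2 * \<eta> < 1"
  shows "continuous_on {x1..} (xcorr f g)"
    and "integrable lborel (\<lambda>y. f y * g (x1 + y))"
proof -
  obtain w where w: "integrable lborel w" "\<And>x y. x \<ge> x1 \<Longrightarrow> \<bar>f y * g (x + y)\<bar> \<le> w y"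
    using gam_dominated_bound[OF assms] by metis
  have [measurable]: "f \<in> borel_measurable borel" "g \<in> borel_measurable borel"
    using f g by (auto simp: gam_dominated_def)
  have f0: "f y = 0" if "y \<le> 0" for y using f that by (simp add: gam_dominated_def)
  show "integrable lborel (\<lambda>y. f y * g (x1 + y))"
  proof (rule Bochner_Integration.integrable_bound[OF w(1)])
    show "AE y in lborel. norm (f y * g (x1 + y)) \<le> norm (w y)"
      using w(2)[of x1] by (intro AE_I2) (smt (verit) real_norm_def order_refl)
  qed measurable
  show "continuous_on {x1..} (xcorr f g)"
  proof (rule continuous_on_sequentiallyI)
    fix u and a :: real
    assume u: "\<forall>n. u n \<in> {x1..}" "a \<in> {x1..}" "u \<longlonglongrightarrow> a"
    show "(\<lambda>n. xcorr f g (u n)) \<longlonglongrightarrow> xcorr f g a"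
      unfolding xcorr_def
    proof (rule integral_dominated_convergence[where w = w])
      show "AE y in lborel. norm (f y * g (u n + y)) \<le> w y" for n
        using w(2) u(1) by simp
      show "AE y in lborel. (\<lambda>n. f y * g (u n + y)) \<longlonglongrightarrow> f y * g (a + y)"
      proof (rule AE_I2)
        fix y
        show "(\<lambda>n. f y * g (u n + y)) \<longlonglongrightarrow> f y * g (a + y)"
        proof (cases "y > 0")
          case True
          then have "a + y > 0" using u(2) x1 by auto
          then have "isCont g (a + y)"
            using g by (auto simp: gam_dominated_def continuous_on_eq_continuous_at)
          moreover have "(\<lambda>n. u n + y) \<longlonglongrightarrow> a + y" by (intro tendsto_intros u)
          ultimately have "(\<lambda>n. g (u n + y)) \<longlonglongrightarrow> g (a + y)" by (rule isCont_tendsto_compose)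
          then show ?thesis by (intro tendsto_mult tendsto_const)
        qed (simp add: f0)
      qed
    qed (use w in measurable)
  qed
qed

text \<open>Negative \<open>x\<close> reduces to positive \<open>x\<close> by reflection, which
  exchanges \<open>f\<close> and \<open>g\<close>; at 0 continuity is assembled from the two closed
  half-lines.\<close>

lemma
  fixes f g :: "real \<Rightarrow> real"
  assumes f: "gam_dominated \<eta> \<kappa> f" and g: "gam_dominated \<eta> \<kappa> g" and \<kappa>: "\<kappa> > 0" and \<eta>: "\<eta> \<ge> 0" "\<eta> < 1"
    and x: "x \<noteq> 0 \<or> 2 * \<eta> < 1"
  shows isCont_xcorr: "isCont (xcorr f g) x"
    and integrable_xcorr: "integrable lborel (\<lambda>y. f y * g (x + y))"
proof -
  note fg = gam_dominated_right[OF f g \<kappa> \<eta>] and gf = gam_dominated_right[OF g f \<kappa> \<eta>]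
  have refl: "continuous_on {..- x1} (xcorr f g)" if "continuous_on {x1..} (xcorr g f)" for x1
  proof -
    have "continuous_on {..- x1} (\<lambda>x. xcorr g f (- x))"
      by (rule continuous_on_compose2[OF that]) (auto intro!: continuous_intros)
    then show ?thesis by (simp add: xcorr_uminus)
  qed
  consider "x > 0" | "x < 0" | "x = 0" "2 * \<eta> < 1" using x by linarith
  then have "isCont (xcorr f g) x \<and> integrable lborel (\<lambda>y. f y * g (x + y))"
  proof cases
    case 1
    then have "continuous_on {x / 2<..} (xcorr f g)"
      using fg(1)[of "x / 2"] by (rule_tac continuous_on_subset) auto
    then show ?thesis using 1 fg(2)[of x] by (auto simp: continuous_on_eq_continuous_at)
  next
    case 2
    then have "continuous_on {..<x / 2} (xcorr f g)"
      using refl[OF gf(1)[of "- x / 2"]] by (rule_tac continuous_on_subset) auto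
    then show ?thesis using 2 gf(2)[of "- x"] integrable_xcorr_uminus[of f g "- x"]
      by (auto simp: continuous_on_eq_continuous_at)
  next
    case 3
    have "continuous_on ({0..} \<union> {..0}) (xcorr f g)"
      using fg(1)[of 0] refl[OF gf(1)[of 0]] 3 by (intro continuous_on_closed_Un) auto
    moreover have "{0..} \<union> {..0} = (UNIV :: real set)" by auto
    ultimately show ?thesis using fg(2)[of 0] 3 by (auto simp: continuous_on_eq_continuous_at)
  qed
  then show "isCont (xcorr f g) x" "integrable lborel (\<lambda>y. f y * g (x + y))" by auto
qed

lemma continuous_on_gam: "continuous_on {0<..} (gam \<beta> c)"
proof -
  have "continuous_on {0<..} (\<lambda>z. \<beta> powr c / Gamma c * z powr (c - 1) * exp (- \<beta> * z))"
    by (intro continuous_intros) auto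
  then show ?thesis by (rule continuous_on_eq) (auto simp: gam_def)
qed

lemma
  assumes \<beta>: "\<beta> > 0" and c: "c > 0" and \<eta>: "1 - c < \<eta>" and \<kappa>: "2 * \<kappa> \<le> \<beta>"
  shows gam_dominated_gam: "gam_dominated \<eta> \<kappa> (gam \<beta> c)"
    and gam_dominated_dgam: "gam_dominated \<eta> \<kappa> (dgam \<beta> c)"
proof -
  obtain C where C: "C > 0" "\<And>z. z > 0 \<Longrightarrow> gam \<beta> c z * (1 + \<bar>ln z\<bar>) \<le> C * (z powr (- \<eta>) * exp (- (\<beta> / 2) * z))"
    using gam_log_bound[OF \<beta> c \<eta>] by metis
  define K where "K = \<bar>ln \<beta> - Digamma c\<bar> + 1"
  have le: "gam \<beta> c z * (1 + \<bar>ln z\<bar>) \<le> C * (z powr (- \<eta>) * exp (- \<kappa> * z))" if z: "z > 0" for z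
  proof -
    have "exp (- (\<beta> / 2) * z) \<le> exp (- \<kappa> * z)" using z \<kappa> by simp
    then show ?thesis
      using C(2)[OF z] C(1) by (smt (verit) mult_left_mono powr_ge_zero)
  qed
  have "\<bar>gam \<beta> c z\<bar> \<le> C * (z powr (- \<eta>) * exp (- \<kappa> * z))" if z: "z > 0" for z
  proof -
    have "gam \<beta> c z * 1 \<le> gam \<beta> c z * (1 + \<bar>ln z\<bar>)" using c by (intro mult_left_mono) auto
    then show ?thesis using le[OF z] c by simp
  qed
  then show "gam_dominated \<eta> \<kappa> (gam \<beta> c)"
    using C(1) continuous_on_gam unfolding gam_dominated_def by (auto simp: gam_def intro!: exI[of _ C])
  have "\<bar>dgam \<beta> c z\<bar> \<le> (C * K) * (z powr (- \<eta>) * exp (- \<kappa> * z))" if z: "z > 0" for z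
  proof -
    have "\<bar>ln \<beta> - Digamma c + ln z\<bar> \<le> K * (1 + \<bar>ln z\<bar>)"
      by (simp add: K_def algebra_simps) (smt (verit) mult_nonneg_nonneg abs_ge_zero)
    then have "gam \<beta> c z * \<bar>ln \<beta> - Digamma c + ln z\<bar> \<le> gam \<beta> c z * (K * (1 + \<bar>ln z\<bar>))"
      using c by (intro mult_left_mono) auto
    also have "\<dots> = K * (gam \<beta> c z * (1 + \<bar>ln z\<bar>))" by simp
    also have "\<dots> \<le> K * (C * (z powr (- \<eta>) * exp (- \<kappa> * z)))"
      using le[OF z] by (intro mult_left_mono) (auto simp: K_def)
    finally show ?thesis using c by (simp add: dgam_def abs_mult mult_ac)
  qed
  moreover have "continuous_on {0<..} (dgam \<beta> c)"
    unfolding dgam_def by (intro continuous_intros continuous_on_gam) auto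
  moreover have "C * K \<ge> 0" using C(1) by (simp add: K_def)
  ultimately show "gam_dominated \<eta> \<kappa> (dgam \<beta> c)"
    unfolding gam_dominated_def by (auto simp: dgam_def gam_def[of _ _ "_ :: real"] intro!: exI[of _ "C * K"])
qed

text \<open>The exponent \<open>\<eta>\<close> must exceed \<open>1 - c\<close> and stay below 1, at
  the origin below \<open>1 / 2\<close>; \<open>c > 1 / 2\<close> makes room for the latter. The
  sets for \<open>f\<close> and \<open>g\<close> cover all products of densities and shape
  derivatives at once.\<close>

lemma
  fixes f g :: "real \<Rightarrow> real"
  assumes f: "f \<in> {gam \<beta> c, dgam \<beta> c}" and g: "g \<in> {gam \<beta>' c, dgam \<beta>' c}"
    and \<beta>: "\<beta> > 0" "\<beta>' > 0" and c: "c > 0" and x: "x \<noteq> 0 \<or> c > 1 / 2"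
  shows isCont_xcorr_gam: "isCont (xcorr f g) x"
    and integrable_xcorr_gam: "integrable lborel (\<lambda>y. f y * g (x + y))"
proof -
  obtain \<eta> where \<eta>: "\<eta> \<ge> 0" "\<eta> < 1" "1 - c < \<eta>" "x \<noteq> 0 \<or> 2 * \<eta> < 1"
  proof (cases "c > 1 / 2")
    case True
    have "max 0 (1 - c) < 1 / 2" using True by (simp add: max_def)
    then obtain \<eta> where "max 0 (1 - c) < \<eta>" "\<eta> < 1 / 2" using dense by blast
    then show ?thesis using that[of \<eta>] by auto
  next
    case False
    have "max 0 (1 - c) < 1" using c by auto
    then obtain \<eta> where "max 0 (1 - c) < \<eta>" "\<eta> < 1" using dense by blast
    then show ?thesis using that[of \<eta>] x False by auto
  qed
  define \<kappa> where "\<kappa> = min \<beta> \<beta>' / 2"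
  have \<kappa>: "\<kappa> > 0" "2 * \<kappa> \<le> \<beta>" "2 * \<kappa> \<le> \<beta>'" using \<beta> by (auto simp: \<kappa>_def)
  have "gam_dominated \<eta> \<kappa> f" "gam_dominated \<eta> \<kappa> g"
    using f g gam_dominated_gam[OF \<beta>(1) c \<eta>(3) \<kappa>(2)] gam_dominated_dgam[OF \<beta>(1) c \<eta>(3) \<kappa>(2)]
      gam_dominated_gam[OF \<beta>(2) c \<eta>(3) \<kappa>(3)] gam_dominated_dgam[OF \<beta>(2) c \<eta>(3) \<kappa>(3)] by auto
  then show "isCont (xcorr f g) x" "integrable lborel (\<lambda>y. f y * g (x + y))"
    using isCont_xcorr integrable_xcorr \<kappa>(1) \<eta> by metis+
qed

text \<open>By translation invariance the integral of \<open>\<bar>g (w + y)\<bar>\<close> over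
  \<open>w\<close> does not depend on \<open>y\<close>. The price for assuming mere integrability is
  that the integral defining \<open>xcorr\<close> need exist only at almost every point.\<close>

lemma integrable_xcorr_lborel:
  fixes f g :: "real \<Rightarrow> real"
  assumes f: "integrable lborel f" and g: "integrable lborel g"
  shows "integrable (lborel \<Otimes>\<^sub>M lborel) (\<lambda>(y, w). f y * g (w + y))"
    and "integrable lborel (xcorr f g)"
proof -
  have [measurable]: "f \<in> borel_measurable borel" "g \<in> borel_measurable borel" using f g by auto
  have gy: "integrable lborel (\<lambda>w. g (w + y))" for y
    using lborel_integrable_real_affine[OF g, of 1 y] by (simp add: add.commute)
  show I: "integrable (lborel \<Otimes>\<^sub>M lborel) (\<lambda>(y, w). f y * g (w + y))"
  proof (rule lborel_pair.Fubini_integrable)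
    have "(\<integral>w. norm (f y * g (w + y)) \<partial>lborel) = \<bar>f y\<bar> * (\<integral>w. \<bar>g w\<bar> \<partial>lborel)" for y
      using lborel_integral_real_affine[of 1 "\<lambda>w. \<bar>g w\<bar>" y] by (simp add: abs_mult add.commute)
    then show "integrable lborel (\<lambda>y. \<integral>w. norm (case (y, w) of (y, w) \<Rightarrow> f y * g (w + y)) \<partial>lborel)"
      using f by simp
    show "AE y in lborel. integrable lborel (\<lambda>w. case (y, w) of (y, w) \<Rightarrow> f y * g (w + y))"
      using gy by simp
  qed measurable
  have "integrable lborel (\<lambda>w. \<integral>y. f y * g (w + y) \<partial>lborel)"
    using lborel_pair.integrable_snd[OF I] by simp
  then show "integrable lborel (xcorr f g)" by (simp add: xcorr_def[abs_def])
qed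

text \<open>Continuity is asked at \<open>x\<close> alone, since a correlation may be discontinuous
  at the origin. Near \<open>x\<close> the tail is a constant minus an integral from
  \<open>x - 1\<close>, to which the fundamental theorem at a point of continuity applies.\<close>

lemma has_real_derivative_tail_integral:
  fixes \<Phi> :: "real \<Rightarrow> real"
  assumes \<Phi>: "integrable lborel \<Phi>" and cont: "isCont \<Phi> x"
  shows "((\<lambda>x. \<integral>w. indicator {x<..} w * \<Phi> w \<partial>lborel) has_real_derivative - \<Phi> x) (at x)"
proof -
  have ind: "integrable lborel (\<lambda>w. indicator A w * \<Phi> w)" if [measurable]: "A \<in> sets borel" for A
    using \<Phi> by (rule Bochner_Integration.integrable_bound) (use \<Phi> in \<open>auto simp: indicator_def\<close>)
  define a b where "a = x - 1" and "b = x + 1"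
  have set_int: "set_integrable lborel {a..u} \<Phi>" for u
    using ind[of "{a..u}"] by (simp add: set_integrable_def)
  have hk: "(\<integral>w. indicator {u<..} w * \<Phi> w \<partial>lborel) = (\<integral>w. indicator {a..} w * \<Phi> w \<partial>lborel) - integral {a..u} \<Phi>"
    if "u > a" for u
  proof -
    have "(\<integral>w. indicator {a..} w * \<Phi> w \<partial>lborel) = (\<integral>w. indicator {a..u} w * \<Phi> w + indicator {u<..} w * \<Phi> w \<partial>lborel)"
      using that by (intro Bochner_Integration.integral_cong) (auto simp: indicator_def)
    also have "\<dots> = (\<integral>w. indicator {a..u} w * \<Phi> w \<partial>lborel) + (\<integral>w. indicator {u<..} w * \<Phi> w \<partial>lborel)"
      by (intro Bochner_Integration.integral_add ind) auto
    also have "(\<integral>w. indicator {a..u} w * \<Phi> w \<partial>lborel) = integral {a..u} \<Phi>"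
      using set_borel_integral_eq_integral(2)[OF set_int[of u]] by (simp add: set_lebesgue_integral_def)
    finally show ?thesis by simp
  qed
  have "((\<lambda>u. integral {a..u} \<Phi>) has_vector_derivative \<Phi> x) (at x within ({a..b} - {}))"
  proof (rule integral_has_vector_derivative_continuous_at)
    show "\<Phi> integrable_on {a..b}" using set_borel_integral_eq_integral(1)[OF set_int] .
  qed (use cont in \<open>auto simp: a_def b_def intro: continuous_at_imp_continuous_at_within\<close>)
  then have "((\<lambda>u. integral {a..u} \<Phi>) has_real_derivative \<Phi> x) (at x)"
    using at_within_Icc_at[of a x b] by (simp add: has_real_derivative_iff_has_vector_derivative a_def b_def)
  then have "((\<lambda>u. (\<integral>w. indicator {a..} w * \<Phi> w \<partial>lborel) - integral {a..u} \<Phi>) has_real_derivative - \<Phi> x) (at x)"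
    by (auto intro!: derivative_eq_intros)
  moreover have "eventually (\<lambda>u. u > a) (nhds x)"
    by (rule eventually_nhds_in_open[of "{a<..}", simplified]) (auto simp: a_def)
  then have "eventually (\<lambda>u. (\<integral>w. indicator {a..} w * \<Phi> w \<partial>lborel) - integral {a..u} \<Phi>
      = (\<integral>w. indicator {u<..} w * \<Phi> w \<partial>lborel)) (nhds x)"
    by eventually_elim (simp add: hk)
  ultimately show ?thesis
    by (subst (asm) DERIV_cong_ev[OF refl _ refl]) auto
qed

section \<open>Weyl integrals and the shape derivative\<close>

text \<open>Scaling by 2 turns the integral over \<open>{0<..<2}\<close> into that over
  \<open>{0<..<1}\<close>, although \<open>{1..<2}\<close> adds at least \<open>1 / 2\<close>; so
  the value cannot be finite.\<close>

lemma nn_integral_inverse_Ioo: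
  "(\<integral>\<^sup>+y. ennreal (1 / y) * indicator {0<..<1} y \<partial>lborel) = (\<infinity> :: ennreal)"
proof (rule ccontr)
  define I where "I = (\<integral>\<^sup>+y. ennreal (1 / y) * indicator {0<..<1} y \<partial>lborel)"
  assume "(\<integral>\<^sup>+y. ennreal (1 / y) * indicator {0<..<1} y \<partial>lborel) \<noteq> \<infinity>"
  then have fin: "I \<noteq> \<infinity>" by (simp add: I_def)
  have "I + ennreal (1 / 2) = (\<integral>\<^sup>+y. ennreal (1 / y) * indicator {0<..<1} y \<partial>lborel) +
      (\<integral>\<^sup>+y. ennreal (1 / 2) * indicator {1..<2} (y :: real) \<partial>lborel)"
    by (simp add: I_def nn_integral_cmult_indicator)
  also have "\<dots> = (\<integral>\<^sup>+y. ennreal (1 / y) * indicator {0<..<1} y + ennreal (1 / 2) * indicator {1..<2} y \<partial>lborel)"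
    by (rule nn_integral_add[symmetric]) auto
  also have "\<dots> \<le> (\<integral>\<^sup>+y. ennreal (1 / y) * indicator {0<..<2} y \<partial>lborel)"
  proof (rule nn_integral_mono)
    fix y :: real
    have "ennreal (1 / 2) \<le> ennreal (1 / y)" if "1 \<le> y" "y < 2"
      using that by (intro ennreal_leI) (auto simp: field_simps)
    then show "ennreal (1 / y) * indicator {0<..<1} y + ennreal (1 / 2) * indicator {1..<2} y
        \<le> ennreal (1 / y) * indicator {0<..<2} y"
      by (auto simp: indicator_def)
  qed
  also have "\<dots> = ennreal 2 * (\<integral>\<^sup>+y. ennreal (1 / (2 * y)) * indicator {0<..<2} (2 * y) \<partial>lborel)"
    using nn_integral_real_affine[of "\<lambda>y. ennreal (1 / y) * indicator {0<..<2} y" 2 0] by simp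
  also have "\<dots> = (\<integral>\<^sup>+y. ennreal 2 * (ennreal (1 / (2 * y)) * indicator {0<..<2} (2 * y)) \<partial>lborel)"
    by (rule nn_integral_cmult[symmetric]) measurable
  also have "\<dots> = I"
    unfolding I_def
  proof (rule nn_integral_cong)
    fix y :: real
    have "ennreal 2 * ennreal (1 / (2 * y)) = ennreal (1 / y)" if "y > 0"
      using that by (subst ennreal_mult'[symmetric]) auto
    moreover have "indicator {0<..<2} (2 * y) = (indicator {0<..<1} y :: ennreal)" by (auto simp: indicator_def)
    ultimately show "ennreal 2 * (ennreal (1 / (2 * y)) * indicator {0<..<2} (2 * y))
        = ennreal (1 / y) * indicator {0<..<1} y"
      by (cases "y > 0") (simp_all only: mult.assoc[symmetric], auto)
  qed
  finally have "I + ennreal (1 / 2) \<le> I + 0" by simp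
  then have "ennreal (1 / 2) \<le> 0"
    using fin by (simp only: ennreal_add_left_cancel_le) auto
  then show False by simp
qed

text \<open>Near 0 the product behaves like \<open>y powr (2 * c - 2)\<close>, which for
  \<open>c \<le> 1 / 2\<close> is at least \<open>1 / y\<close> on the unit interval. This turns
  finiteness of the density at the origin into a condition on the shape.\<close>

lemma gam_product_integrable_imp:
  assumes \<beta>: "\<beta> > 0" "\<beta>' > 0" and c: "c > 0"
    and int: "integrable lborel (\<lambda>y. gam \<beta> c y * gam \<beta>' c y)"
  shows "c > 1 / 2"
proof (rule ccontr)
  assume "\<not> c > 1 / 2"
  then have c2: "c \<le> 1 / 2" by simp
  define K where "K = \<beta> powr c / Gamma c * (\<beta>' powr c / Gamma c) * exp (- (\<beta> + \<beta>'))"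
  have K: "K > 0" using \<beta> c by (simp add: K_def)
  have le: "K * (1 / y) \<le> gam \<beta> c y * gam \<beta>' c y" if y: "0 < y" "y < 1" for y
  proof -
    have "1 / y \<le> y powr (c - 1) * y powr (c - 1)"
      using powr_mono'[of "c - 1 + (c - 1)" "- 1" y] y c2 by (simp add: powr_add[symmetric] powr_minus_divide)
    moreover have "exp (- (\<beta> + \<beta>')) \<le> exp (- \<beta> * y) * exp (- \<beta>' * y)"
    proof -
      have "(\<beta> + \<beta>') * y \<le> (\<beta> + \<beta>') * 1" using y \<beta> by (intro mult_left_mono) auto
      then show ?thesis by (simp add: exp_add[symmetric] algebra_simps)
    qed
    ultimately have "exp (- (\<beta> + \<beta>')) * (1 / y) \<le> (exp (- \<beta> * y) * exp (- \<beta>' * y)) * (y powr (c - 1) * y powr (c - 1))"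
      using y by (intro mult_mono) auto
    then have "\<beta> powr c / Gamma c * (\<beta>' powr c / Gamma c) * (exp (- (\<beta> + \<beta>')) * (1 / y))
       \<le> \<beta> powr c / Gamma c * (\<beta>' powr c / Gamma c) * ((exp (- \<beta> * y) * exp (- \<beta>' * y)) * (y powr (c - 1) * y powr (c - 1)))"
      using c by (intro mult_left_mono) auto
    also have "\<dots> = gam \<beta> c y * gam \<beta>' c y" using y by (simp add: gam_def mult_ac)
    finally show ?thesis by (simp add: K_def mult_ac)
  qed
  have "ennreal K * (\<integral>\<^sup>+y. ennreal (1 / y) * indicator {0<..<1} y \<partial>lborel)
      = (\<integral>\<^sup>+y. ennreal K * (ennreal (1 / y) * indicator {0<..<1} y) \<partial>lborel)"
    by (rule nn_integral_cmult[symmetric]) measurable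
  also have "\<dots> \<le> (\<integral>\<^sup>+y. ennreal (norm (gam \<beta> c y * gam \<beta>' c y)) \<partial>lborel)"
  proof (rule nn_integral_mono)
    fix y :: real
    show "ennreal K * (ennreal (1 / y) * indicator {0<..<1} y) \<le> ennreal (norm (gam \<beta> c y * gam \<beta>' c y))"
    proof (cases "0 < y \<and> y < 1")
      case True
      then show ?thesis using le[of y] K by (simp add: ennreal_mult'[symmetric] abs_mult c ennreal_leI)
    qed (auto simp: indicator_def)
  qed
  also have "\<dots> < \<infinity>" using int by (simp add: integrable_iff_bounded)
  finally show False using K nn_integral_inverse_Ioo by (simp add: ennreal_mult_top)
qed

text \<open>The tail is moved inside the correlation and convolved with \<open>gam \<beta> c\<close>
  alone, giving the tail integral \<open>K\<close> of \<open>dgam\<close>; a second exchange pulls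
  the tail out again. The first exchange concerns nonnegative functions and also yields
  integrability; the second involves the sign-changing \<open>dgam\<close> and needs absolute
  integrability.\<close>

lemma weyl_plus_xcorr_gam_unit:
  assumes \<beta>: "\<beta> > 0" "\<beta>' > 0" and c: "c > 0"
  shows "integrable lborel (\<lambda>s. indicator {..<x} s * (xcorr (gam \<beta>' c) (gam \<beta> c) s * levy_tail 1 \<beta> (x - s)))"
    and "(\<integral>s. indicator {..<x} s * (xcorr (gam \<beta>' c) (gam \<beta> c) s * levy_tail 1 \<beta> (x - s)) \<partial>lborel)
        = (\<integral>w. indicator {x<..} w * xcorr (gam \<beta>' c) (dgam \<beta> c) w \<partial>lborel)"
proof -
  define f g d where "f = gam \<beta>' c" and "g = gam \<beta> c" and "d = dgam \<beta> c"
  have [measurable]: "f \<in> borel_measurable borel" "g \<in> borel_measurable borel" "d \<in> borel_measurable borel"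
    by (simp_all add: f_def g_def d_def)
  have f0: "f y \<ge> 0" and g0: "g y \<ge> 0" for y using c by (simp_all add: f_def g_def)
  have fi: "integrable lborel f" and gi: "integrable lborel g" and di: "integrable lborel d"
    using \<beta> c has_real_derivative_gam_integral(1)[of \<beta> c UNIV] by (auto simp: f_def g_def d_def integrable_gam)
  \<comment> \<open>Cutting the tail off at 0 replaces the half-line depending on \<open>x\<close>
    by a convolution over the whole line, which can be shifted by \<open>y\<close>.\<close>
  define T where "T z = (if z > 0 then levy_tail 1 \<beta> z else 0)" for z
  have [measurable]: "T \<in> borel_measurable borel" unfolding T_def by measurable
  have T0: "T z \<ge> 0" for z by (simp add: T_def levy_tail_nonneg)
  have indT: "indicator {..<u} s * (r * levy_tail 1 \<beta> (u - s)) = r * T (u - s)" for u s r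
    by (auto simp: T_def indicator_def)
  define K where "K u = (\<integral>v. indicator {u<..} v * d v \<partial>lborel)" for u
  have K: "integrable lborel (\<lambda>s. g s * T (u - s))" "(\<integral>s. g s * T (u - s) \<partial>lborel) = K u" for u
    using gam_levy_tail_convolution[OF \<beta>(1) c, of u] unfolding indT g_def d_def K_def by auto
  \<comment> \<open>Not visible from the definition, since \<open>d\<close> changes sign; it follows
    from the convolution form of \<open>K\<close>.\<close>
  have K0: "K u \<ge> 0" for u
    unfolding K(2)[symmetric] using g0 T0 by (intro integral_nonneg_AE) auto
  have Km[measurable]: "K \<in> borel_measurable borel"
    unfolding K(2)[symmetric, abs_def] by measurable
  have Kb: "K u \<le> (\<integral>v. \<bar>d v\<bar> \<partial>lborel)" for u
    unfolding K_def using di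
    by (intro integral_mono Bochner_Integration.integrable_bound[OF di] integrable_abs) (auto simp: indicator_def)
  have Knn: "(\<integral>\<^sup>+s. ennreal (g s * T (u - s)) \<partial>lborel) = ennreal (K u)" for u
    using K[of u] g0 T0 by (subst nn_integral_eq_integral) auto
  \<comment> \<open>At \<open>s = 0\<close> the correlation may diverge, and then
    \<open>xcorr\<close> has the default value 0 instead of the nonnegative integral; under the
    outer integral almost every \<open>s\<close> suffices.\<close>
  have fin: "AE s in lborel. integrable lborel (\<lambda>y. f y * g (s + y))"
    using lborel_pair.AE_integrable_snd[OF integrable_xcorr_lborel(1)[OF fi gi]] by simp
  have fK: "integrable lborel (\<lambda>y. f y * K (x + y))"
  proof (rule Bochner_Integration.integrable_bound)
    show "integrable lborel (\<lambda>y. f y * (\<integral>v. \<bar>d v\<bar> \<partial>lborel))" using fi by simp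
    show "AE y in lborel. norm (f y * K (x + y)) \<le> norm (f y * (\<integral>v. \<bar>d v\<bar> \<partial>lborel))"
    proof (rule AE_I2)
      fix y
      have "f y * K (x + y) \<le> f y * (\<integral>v. \<bar>d v\<bar> \<partial>lborel)" using Kb f0 by (intro mult_left_mono) auto
      then show "norm (f y * K (x + y)) \<le> norm (f y * (\<integral>v. \<bar>d v\<bar> \<partial>lborel))"
        using f0[of y] K0[of "x + y"] by simp
    qed
  qed measurable
  have x0: "xcorr f g s \<ge> 0" for s
    unfolding xcorr_def using f0 g0 by (intro integral_nonneg_AE) auto
  have "(\<integral>\<^sup>+s. ennreal (xcorr f g s * T (x - s)) \<partial>lborel)
      = (\<integral>\<^sup>+s. (\<integral>\<^sup>+y. ennreal (f y * g (s + y)) * ennreal (T (x - s)) \<partial>lborel) \<partial>lborel)"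
  proof (rule nn_integral_cong_AE)
    show "AE s in lborel. ennreal (xcorr f g s * T (x - s))
        = (\<integral>\<^sup>+y. ennreal (f y * g (s + y)) * ennreal (T (x - s)) \<partial>lborel)"
      using fin
    proof eventually_elim
      case (elim s)
      have "ennreal (xcorr f g s) = (\<integral>\<^sup>+y. ennreal (f y * g (s + y)) \<partial>lborel)"
        unfolding xcorr_def using f0 g0 by (intro nn_integral_eq_integral[symmetric] elim) auto
      then show ?case using T0[of "x - s"] x0[of s]
        by (subst nn_integral_multc) (auto simp: ennreal_mult)
    qed
  qed
  also have "\<dots> = (\<integral>\<^sup>+y. (\<integral>\<^sup>+s. ennreal (f y * g (s + y)) * ennreal (T (x - s)) \<partial>lborel) \<partial>lborel)"
    by (rule lborel_pair.Fubini') measurable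
  also have "\<dots> = (\<integral>\<^sup>+y. ennreal (f y * K (x + y)) \<partial>lborel)"
  proof (rule nn_integral_cong)
    fix y
    have "(\<integral>\<^sup>+s. ennreal (f y * g (s + y)) * ennreal (T (x - s)) \<partial>lborel)
       = (\<integral>\<^sup>+s. ennreal (f y * g s) * ennreal (T (x + y - s)) \<partial>lborel)"
      by (subst nn_integral_real_affine[where t = "- y" and c = 1]) (auto simp: algebra_simps)
    also have "\<dots> = (\<integral>\<^sup>+s. ennreal (f y) * ennreal (g s * T (x + y - s)) \<partial>lborel)"
      using f0 g0 T0 by (intro nn_integral_cong) (simp add: ennreal_mult mult.assoc)
    also have "\<dots> = ennreal (f y) * ennreal (K (x + y))"
      by (subst nn_integral_cmult) (auto simp: Knn)
    finally show "(\<integral>\<^sup>+s. ennreal (f y * g (s + y)) * ennreal (T (x - s)) \<partial>lborel) = ennreal (f y * K (x + y))"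
      using f0 K0 by (simp add: ennreal_mult)
  qed
  also have "\<dots> = ennreal (\<integral>y. f y * K (x + y) \<partial>lborel)"
    using fK f0 K0 by (intro nn_integral_eq_integral) auto
  finally have nn: "(\<integral>\<^sup>+s. ennreal (xcorr f g s * T (x - s)) \<partial>lborel) = ennreal (\<integral>y. f y * K (x + y) \<partial>lborel)" .
  have I: "integrable lborel (\<lambda>s. xcorr f g s * T (x - s))"
    using nn x0 T0 by (intro integrableI_nonneg) auto
  then show "integrable lborel (\<lambda>s. indicator {..<x} s * (xcorr (gam \<beta>' c) (gam \<beta> c) s * levy_tail 1 \<beta> (x - s)))"
    unfolding indT f_def g_def .
  have "(\<integral>s. xcorr f g s * T (x - s) \<partial>lborel) = (\<integral>y. f y * K (x + y) \<partial>lborel)"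
    using nn x0 T0 f0 K0 by (simp add: integral_eq_nn_integral integral_nonneg_AE)
  also have "\<dots> = (\<integral>y. (\<integral>w. f y * (indicator {x<..} w * d (w + y)) \<partial>lborel) \<partial>lborel)"
  proof (rule Bochner_Integration.integral_cong[OF refl])
    fix y
    have "K (x + y) = (\<integral>w. indicator {x<..} w * d (w + y) \<partial>lborel)"
      unfolding K_def
      by (subst lborel_integral_real_affine[where t = y and c = 1])
         (auto intro!: Bochner_Integration.integral_cong simp: indicator_def add.commute)
    then show "f y * K (x + y) = (\<integral>w. f y * (indicator {x<..} w * d (w + y)) \<partial>lborel)" by simp
  qed
  also have "\<dots> = (\<integral>w. (\<integral>y. f y * (indicator {x<..} w * d (w + y)) \<partial>lborel) \<partial>lborel)"
  proof (rule lborel_pair.Fubini_integral[symmetric])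
    show "integrable (lborel \<Otimes>\<^sub>M lborel) (\<lambda>(y, w). f y * (indicator {x<..} w * d (w + y)))"
      by (rule Bochner_Integration.integrable_bound[OF integrable_xcorr_lborel(1)[OF fi di]])
         (auto simp: indicator_def)
  qed
  also have "\<dots> = (\<integral>w. indicator {x<..} w * xcorr f d w \<partial>lborel)"
    unfolding xcorr_def
    by (intro Bochner_Integration.integral_cong refl)
       (simp only: mult.left_commute[of _ "indicator {x<..} _"] integral_mult_right_zero)
  finally show "(\<integral>s. indicator {..<x} s * (xcorr (gam \<beta>' c) (gam \<beta> c) s * levy_tail 1 \<beta> (x - s)) \<partial>lborel)
        = (\<integral>w. indicator {x<..} w * xcorr (gam \<beta>' c) (dgam \<beta> c) w \<partial>lborel)"
    unfolding indT f_def g_def d_def .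
qed

text \<open>The tail representation holds for every \<open>x\<close>, so the domain condition is
  unconditional; the condition on \<open>x\<close> provides continuity of the correlation with
  \<open>dgam\<close>.\<close>

lemma weyl_plus_xcorr_gam:
  assumes \<beta>: "\<beta> > 0" "\<beta>' > 0" and c: "c > 0"
  defines "u \<equiv> xcorr (gam \<beta>' c) (gam \<beta> c)"
  shows "weyl_plus_domain \<alpha> \<beta> u"
    and "x \<noteq> 0 \<or> c > 1 / 2 \<Longrightarrow>
      (weyl_plus_integral \<alpha> \<beta> u has_real_derivative - (\<alpha> * xcorr (gam \<beta>' c) (dgam \<beta> c) x)) (at x)"
proof -
  have scale: "indicator {..<x} s *\<^sub>R (u s * levy_tail \<alpha> \<beta> (x - s))
      = \<alpha> * (indicator {..<x} s * (u s * levy_tail 1 \<beta> (x - s)))" for x s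
    by (subst levy_tail_scale) simp
  show "weyl_plus_domain \<alpha> \<beta> u"
    unfolding weyl_plus_domain_def set_integrable_def scale unfolding u_def
    by (intro allI integrable_mult_right weyl_plus_xcorr_gam_unit assms)
  have "weyl_plus_integral \<alpha> \<beta> u = (\<lambda>x. \<alpha> * (\<integral>w. indicator {x<..} w * xcorr (gam \<beta>' c) (dgam \<beta> c) w \<partial>lborel))"
    unfolding weyl_plus_integral_def[abs_def] set_lebesgue_integral_def scale unfolding u_def
    using weyl_plus_xcorr_gam_unit(2)[OF \<beta> c] by simp
  moreover assume x: "x \<noteq> 0 \<or> c > 1 / 2"
  have "((\<lambda>x. \<integral>w. indicator {x<..} w * xcorr (gam \<beta>' c) (dgam \<beta> c) w \<partial>lborel) has_real_derivative
         - xcorr (gam \<beta>' c) (dgam \<beta> c) x) (at x)"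
  proof (rule has_real_derivative_tail_integral)
    show "integrable lborel (xcorr (gam \<beta>' c) (dgam \<beta> c))"
      using \<beta> c has_real_derivative_gam_integral(1)[of \<beta> c UNIV]
      by (intro integrable_xcorr_lborel integrable_gam) auto
    show "isCont (xcorr (gam \<beta>' c) (dgam \<beta> c)) x"
      by (rule isCont_xcorr_gam[OF _ _ \<beta>(2) \<beta>(1) c x]) auto
  qed
  ultimately show "(weyl_plus_integral \<alpha> \<beta> u has_real_derivative - (\<alpha> * xcorr (gam \<beta>' c) (dgam \<beta> c) x)) (at x)"
    by (auto intro!: derivative_eq_intros)
qed

text \<open>The substitution \<open>s \<mapsto> - s\<close> reduces every claim on the minus
  operator to one on the plus operator.\<close>

lemma
  fixes u :: "real \<Rightarrow> real"
  shows weyl_minus_domain_reflect: "weyl_minus_domain \<alpha> \<beta> u \<longleftrightarrow> weyl_plus_domain \<alpha> \<beta> (\<lambda>s. u (- s))"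
    and weyl_minus_integral_reflect: "weyl_minus_integral \<alpha> \<beta> u x = weyl_plus_integral \<alpha> \<beta> (\<lambda>s. u (- s)) (- x)"
proof -
  have *: "indicator {x<..} (0 + - 1 * s) *\<^sub>R (u (0 + - 1 * s) * levy_tail \<alpha> \<beta> (0 + - 1 * s - x))
      = indicator {..<- x} s *\<^sub>R (u (- s) * levy_tail \<alpha> \<beta> (- x - s))" for x s
  proof -
    have "0 + - 1 * s - x = - x - s" "0 + - 1 * s = - s" by simp_all
    moreover have "indicator {x<..} (- s) = (indicator {..<- x} s :: real)" by (auto simp: indicator_def)
    ultimately show ?thesis by (simp only:)
  qed
  have E: "set_integrable lborel {x<..} (\<lambda>s. u s * levy_tail \<alpha> \<beta> (s - x))
     \<longleftrightarrow> set_integrable lborel {..<- x} (\<lambda>s. u (- s) * levy_tail \<alpha> \<beta> (- x - s))" for x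
    unfolding set_integrable_def
    using lborel_integrable_real_affine_iff[of "- 1" "\<lambda>s. indicator {x<..} s *\<^sub>R (u s * levy_tail \<alpha> \<beta> (s - x))" 0]
    unfolding * by simp
  show "weyl_minus_domain \<alpha> \<beta> u \<longleftrightarrow> weyl_plus_domain \<alpha> \<beta> (\<lambda>s. u (- s))"
    unfolding weyl_minus_domain_def weyl_plus_domain_def E
  proof (intro iffI allI)
    fix x
    assume "\<forall>x. set_integrable lborel {..<- x} (\<lambda>s. u (- s) * levy_tail \<alpha> \<beta> (- x - s))"
    from this[rule_format, of "- x"] show "set_integrable lborel {..<x} (\<lambda>s. u (- s) * levy_tail \<alpha> \<beta> (x - s))" by simp
  qed blast
  show "weyl_minus_integral \<alpha> \<beta> u x = weyl_plus_integral \<alpha> \<beta> (\<lambda>s. u (- s)) (- x)"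
    unfolding weyl_minus_integral_def weyl_plus_integral_def set_lebesgue_integral_def
    using lborel_integral_real_affine[of "- 1" "\<lambda>s. indicator {x<..} s *\<^sub>R (u s * levy_tail \<alpha> \<beta> (s - x))" 0]
    unfolding * by simp
qed

text \<open>Reflection exchanges the factors, hence \<open>\<beta>\<close> and
  \<open>\<beta>'\<close>, and the inner derivative \<open>- 1\<close> makes the sign opposite to
  that in \<open>weyl_plus_xcorr_gam\<close>.\<close>

lemma weyl_minus_xcorr_gam:
  assumes \<beta>: "\<beta> > 0" "\<beta>' > 0" and c: "c > 0"
  defines "u \<equiv> xcorr (gam \<beta>' c) (gam \<beta> c)"
  shows "weyl_minus_domain \<alpha> \<beta>' u"
    and "x \<noteq> 0 \<or> c > 1 / 2 \<Longrightarrow>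
      (weyl_minus_integral \<alpha> \<beta>' u has_real_derivative \<alpha> * xcorr (dgam \<beta>' c) (gam \<beta> c) x) (at x)"
proof -
  have u: "(\<lambda>s. u (- s)) = xcorr (gam \<beta> c) (gam \<beta>' c)" by (simp add: u_def xcorr_uminus fun_eq_iff)
  show "weyl_minus_domain \<alpha> \<beta>' u"
    unfolding weyl_minus_domain_reflect u by (rule weyl_plus_xcorr_gam(1)[OF \<beta>(2) \<beta>(1) c])
  assume x: "x \<noteq> 0 \<or> c > 1 / 2"
  have "(weyl_plus_integral \<alpha> \<beta>' (xcorr (gam \<beta> c) (gam \<beta>' c))
      has_real_derivative - (\<alpha> * xcorr (gam \<beta> c) (dgam \<beta>' c) (- x))) (at (- x))"
    by (rule weyl_plus_xcorr_gam(2)[OF \<beta>(2) \<beta>(1) c]) (use x in auto)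
  moreover have "(uminus has_real_derivative - 1) (at x)" by (auto intro!: derivative_eq_intros)
  ultimately  have "((\<lambda>x. weyl_plus_integral \<alpha> \<beta>' (xcorr (gam \<beta> c) (gam \<beta>' c)) (- x))
      has_real_derivative \<alpha> * xcorr (dgam \<beta>' c) (gam \<beta> c) x) (at x)"
    using DERIV_chain2[where f = "weyl_plus_integral \<alpha> \<beta>' (xcorr (gam \<beta> c) (gam \<beta>' c))" and g = uminus and x = x and s
        = UNIV]
    by (fastforce simp: xcorr_uminus)
  then show "(weyl_minus_integral \<alpha> \<beta>' u has_real_derivative \<alpha> * xcorr (dgam \<beta>' c) (gam \<beta> c) x) (at x)"
    by (simp add: weyl_minus_integral_reflect[abs_def] u)
qed

text \<open>Both factors share the shape, so their product is again an exponential family in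
  \<open>c\<close>, with statistic \<open>ln y + ln (x + y)\<close>; its logarithmic derivative
  splits into the two \<open>dgam\<close> terms.\<close>

lemma has_real_derivative_xcorr_gam:
  assumes \<beta>: "\<beta> > 0" "\<beta>' > 0" and c: "c > 0" and x: "x \<noteq> 0 \<or> c > 1 / 2"
  shows "((\<lambda>c. xcorr (gam \<beta>' c) (gam \<beta> c) x) has_real_derivative
          xcorr (gam \<beta>' c) (dgam \<beta> c) x + xcorr (dgam \<beta>' c) (gam \<beta> c) x) (at c)"
proof -
  define w where "w y = indicator {0<..} y * indicator {0<..} (x + y) * (exp (- \<beta>' * y) * exp (- \<beta> * (x
      + y))) / (y * (x + y))" for y
  define L where "L y = ln y + ln (x + y)" for y
  define N where "N c = \<beta>' powr c / Gamma c * (\<beta> powr c / Gamma c)" for c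
  have [measurable]: "w \<in> borel_measurable borel" "L \<in> borel_measurable borel" unfolding w_def L_def by measurable
  have prod: "gam \<beta>' c y * gam \<beta> c (x + y) = N c * (w y * exp (c * L y))" for c y
  proof -
    have "exp (c * L y) = exp (c * ln y) * exp (c * ln (x + y))" by (simp add: L_def distrib_left exp_add)
    then show ?thesis by (simp add: gam_eq_exp N_def w_def mult_ac)
  qed
  \<comment> \<open>At the origin \<open>c - \<delta>\<close> must still exceed \<open>1 / 2\<close>
    for integrability, elsewhere it must be positive; half of the available distance is
    taken.\<close>
  define \<delta> where "\<delta> = (if x = 0 then (c - 1 / 2) / 2 else c / 2)"
  have \<delta>: "\<delta> > 0" "c - \<delta> > 0" "x \<noteq> 0 \<or> c - \<delta> > 1 / 2" using x c by (auto simp: \<delta>_def field_simps)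
  have int: "integrable lborel (\<lambda>y. w y * exp (c' * L y))" if c': "c' > 0" "x \<noteq> 0 \<or> c' > 1 / 2" for c'
  proof -
    have "N c' \<noteq> 0" using \<beta> c'(1) Gamma_real_pos[OF c'(1), THEN less_imp_neq] by (simp add: N_def)
    moreover have "integrable lborel (\<lambda>y. N c' * (w y * exp (c' * L y)))"
      unfolding prod[symmetric] by (rule integrable_xcorr_gam[OF _ _ \<beta>(2) \<beta>(1) c']) auto
    ultimately show ?thesis by simp
  qed
  have int': "integrable lborel (\<lambda>y. w y * exp ((c - \<delta>) * L y))" "integrable lborel (\<lambda>y. w y * exp ((c + \<delta>) * L y))"
    using c \<delta> x by (intro int; auto)+
  have i1: "integrable lborel (\<lambda>y. w y * L y * exp (c * L y))"
    by (rule integrable_exp_family_log[OF \<delta>(1) _ _ int']) simp_all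
  have d1: "((\<lambda>c. \<integral>y. w y * exp (c * L y) \<partial>lborel) has_real_derivative (\<integral>y. w y * L y * exp (c * L y) \<partial>lborel)) (at c)"
    by (rule has_real_derivative_exp_family[OF \<delta>(1) _ _ int']) simp_all
  have dN: "(N has_real_derivative N c * (ln \<beta>' - Digamma c + (ln \<beta> - Digamma c))) (at c)"
  proof -
    from DERIV_mult[OF has_real_derivative_gam_norming[OF \<beta>(2) c] has_real_derivative_gam_norming[OF \<beta>(1) c]]
    show ?thesis
      unfolding N_def by (simp only: distrib_left mult_ac)
  qed
  have i0: "integrable lborel (\<lambda>y. w y * exp (c * L y))" using int[of c] c x by auto
  have "xcorr (gam \<beta>' c) (dgam \<beta> c) x + xcorr (dgam \<beta>' c) (gam \<beta> c) x
     = (\<integral>y. gam \<beta>' c y * dgam \<beta> c (x + y) + dgam \<beta>' c y * gam \<beta> c (x + y) \<partial>lborel)"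
    unfolding xcorr_def
    by (rule Bochner_Integration.integral_add[symmetric]; rule integrable_xcorr_gam[OF _ _ \<beta>(2) \<beta>(1) c x]) auto
  also have "\<dots> = (\<integral>y. N c * (ln \<beta>' - Digamma c + (ln \<beta> - Digamma c)) * (w y * exp (c * L y))
      + N c * (w y * L y * exp (c * L y)) \<partial>lborel)"
  proof (rule Bochner_Integration.integral_cong[OF refl])
    fix y
    have "gam \<beta>' c y * dgam \<beta> c (x + y) + dgam \<beta>' c y * gam \<beta> c (x + y)
       = gam \<beta>' c y * gam \<beta> c (x + y) * (ln \<beta>' - Digamma c + (ln \<beta> - Digamma c) + L y)"
      by (simp add: dgam_def L_def algebra_simps)
    then show "gam \<beta>' c y * dgam \<beta> c (x + y) + dgam \<beta>' c y * gam \<beta> c (x + y) =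
      N c * (ln \<beta>' - Digamma c + (ln \<beta> - Digamma c)) * (w y * exp (c * L y)) + N c * (w y * L y * exp (c * L y))"
      unfolding prod by (simp add: algebra_simps)
  qed
  also have "\<dots> = N c * (ln \<beta>' - Digamma c + (ln \<beta> - Digamma c)) * (\<integral>y. w y * exp (c * L y) \<partial>lborel) + N c *
      (\<integral>y. w y * L y * exp (c * L y) \<partial>lborel)"
    by (simp only: Bochner_Integration.integral_add integrable_mult_right i0 i1 integral_mult_right_zero)
  finally have val: "xcorr (gam \<beta>' c) (dgam \<beta> c) x + xcorr (dgam \<beta>' c) (gam \<beta> c) x = \<dots>" .
  have "(\<lambda>c. xcorr (gam \<beta>' c) (gam \<beta> c) x) = (\<lambda>c. N c * (\<integral>y. w y * exp (c * L y) \<partial>lborel))"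
    unfolding xcorr_def prod by simp
  then show ?thesis
    unfolding val using DERIV_mult[OF dN d1] by (simp add: algebra_simps)
qed

section \<open>The law of the subordinated process\<close>

text \<open>On the unit interval the \<open>k\<close>-th term of the exponential series is bounded
  by \<open>\<bar>u\<bar> ^ k / fact k\<close>, so the characteristic function is a series in the
  moments, and it determines the law.\<close>

lemma real_distribution_eqI_moments:
  assumes M1: "real_distribution M1" and M2: "real_distribution M2"
    and b1: "AE x in M1. 0 \<le> x \<and> x \<le> (1::real)" and b2: "AE x in M2. 0 \<le> x \<and> x \<le> 1"
    and eq: "\<And>k. (\<integral>x. x ^ k \<partial>M1) = (\<integral>x. x ^ k \<partial>M2)"
  shows "M1 = M2"
proof (rule Levy_uniqueness[OF M1 M2], rule ext)
  fix u :: real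
  have expand: "char N u = (\<Sum>k. (\<i> * of_real u) ^ k / fact k * of_real (\<integral>x. x ^ k \<partial>N))"
    if N: "real_distribution N" and b: "AE x in N. 0 \<le> x \<and> x \<le> 1" for N
  proof -
    interpret real_distribution N by (rule N)
    define F :: "nat \<Rightarrow> real \<Rightarrow> complex" where "F k x = (\<i> * of_real u) ^ k / fact k * of_real (x ^ k)" for k x
    have [measurable]: "F k \<in> borel_measurable N" for k unfolding F_def by measurable
    have nF: "norm (F k x) = \<bar>u\<bar> ^ k / fact k * \<bar>x\<bar> ^ k" for k x
      by (simp add: F_def norm_mult norm_divide norm_power)
    have nFx: "norm (F k x) \<le> \<bar>u\<bar> ^ k / fact k" if "0 \<le> x" "x \<le> 1" for k x
      using mult_left_mono[OF power_le_one[OF that, of k], of "\<bar>u\<bar> ^ k / fact k"] that by (simp add: nF)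
    have nFb: "AE x in N. norm (F k x) \<le> \<bar>u\<bar> ^ k / fact k" for k
      using b by eventually_elim (simp add: nFx)
    have int: "integrable N (F k)" for k
      using nFb by (intro integrable_const_bound) auto
    have sm: "summable (\<lambda>k. \<bar>u\<bar> ^ k / fact k)"
      using summable_exp[of "\<bar>u\<bar>"] by (simp add: field_simps)
    have "char N u = (\<integral>x. (\<Sum>k. F k x) \<partial>N)"
      unfolding char_def
    proof (rule Bochner_Integration.integral_cong[OF refl])
      fix x
      have "F k x = (\<i> * of_real (u * x)) ^ k /\<^sub>R fact k" for k
        by (simp add: F_def power_mult_distrib scaleR_conv_of_real field_simps)
      then show "iexp (u * x) = (\<Sum>k. F k x)"
        by (simp add: exp_def)
    qed
    also have "\<dots> = (\<Sum>k. \<integral>x. F k x \<partial>N)"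
    proof (rule integral_suminf[OF int])
      show "AE x in N. summable (\<lambda>k. norm (F k x))"
        using b
      proof eventually_elim
        case (elim x)
        then show ?case by (intro summable_comparison_test'[OF sm, of 0]) (simp add: nFx)
      qed
      show "summable (\<lambda>k. \<integral>x. norm (F k x) \<partial>N)"
      proof (rule summable_comparison_test_ev[OF _ sm], rule always_eventually, rule allI)
        fix k
        have "(\<integral>x. norm (F k x) \<partial>N) \<le> (\<integral>x. \<bar>u\<bar> ^ k / fact k \<partial>N)"
          using nFb int by (intro integral_mono_AE) auto
        then show "norm (\<integral>x. norm (F k x) \<partial>N) \<le> \<bar>u\<bar> ^ k / fact k"
          using prob_space by simp
      qed
    qed
    also have "(\<lambda>k. \<integral>x. F k x \<partial>N) = (\<lambda>k. (\<i> * of_real u) ^ k / fact k * of_real (\<integral>x. x ^ k \<partial>N))"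
      unfolding F_def integral_mult_right_zero integral_complex_of_real ..
    finally show ?thesis .
  qed
  show "char M1 u = char M2 u"
    unfolding expand[OF M1 b1] expand[OF M2 b2] eq ..
qed

text \<open>For nonnegative \<open>X\<close> the variable \<open>exp (- X)\<close> lies in the unit
  interval, and its \<open>k\<close>-th moment is the Laplace transform at \<open>l = k\<close>;
  \<open>- ln\<close> recovers \<open>X\<close>.\<close>

lemma (in prob_space) distr_eq_gam:
  fixes X :: "'a \<Rightarrow> real" and \<beta> c :: real
  assumes \<beta>: "\<beta> > 0" and c: "c > 0"
    and [measurable]: "X \<in> borel_measurable M" and X0: "\<And>\<omega>. \<omega> \<in> space M \<Longrightarrow> X \<omega> \<ge> 0"
    and lap: "\<And>l. l > 0 \<Longrightarrow> (\<integral>\<omega>. exp (- l * X \<omega>) \<partial>M) = (\<beta> / (\<beta> + l)) powr c"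
  shows "distr M borel X = density lborel (\<lambda>s. ennreal (gam \<beta> c s))"
proof -
  define G where "G = density lborel (\<lambda>s. ennreal (gam \<beta> c s))"
  have sG[measurable_cong, simp]: "sets G = sets borel" "space G = UNIV" by (simp_all add: G_def)
  interpret G: prob_space G
    by (rule prob_spaceI) (simp add: G_def emeasure_density nn_integral_gam \<beta> c)
  define e :: "real \<Rightarrow> real" where "e x = exp (- x)" for x
  have [measurable]: "e \<in> borel_measurable borel" unfolding e_def by measurable
  interpret N1: real_distribution "distr M borel (\<lambda>\<omega>. e (X \<omega>))" by (rule real_distribution_distr) simp
  interpret N2: real_distribution "distr G borel e" by (rule G.real_distribution_distr) simp
  have "distr M borel (\<lambda>\<omega>. e (X \<omega>)) = distr G borel e"
  proof (rule real_distribution_eqI_moments[OF N1.real_distribution_axioms N2.real_distribution_axioms])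
    show "AE x in distr M borel (\<lambda>\<omega>. e (X \<omega>)). 0 \<le> x \<and> x \<le> 1"
      using X0 by (subst AE_distr_iff) (auto simp: e_def)
    have "AE s in G. s \<ge> 0"
      unfolding G_def by (subst AE_density) (auto simp: gam_def)
    then show "AE x in distr G borel e. 0 \<le> x \<and> x \<le> 1"
      by (subst AE_distr_iff) (auto simp: e_def elim!: eventually_mono)
    fix k :: nat
    show "(\<integral>x. x ^ k \<partial>distr M borel (\<lambda>\<omega>. e (X \<omega>))) = (\<integral>x. x ^ k \<partial>distr G borel e)"
    \<comment> \<open>Order 0 lies outside the range \<open>l > 0\<close> of the transform; there
      the moment is the total mass.\<close>
    proof (cases "k = 0")
      case True
      then show ?thesis using N1.prob_space N2.prob_space by simp
    next
      case False
      have ek: "e x ^ k = exp (- real k * x)" for x by (simp add: e_def exp_of_nat_mult[symmetric])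
      have "(\<integral>x. x ^ k \<partial>distr M borel (\<lambda>\<omega>. e (X \<omega>))) = (\<beta> / (\<beta> + real k)) powr c"
        using lap[of "real k"] False by (subst integral_distr) (auto simp: ek)
      moreover have "(\<integral>x. x ^ k \<partial>distr G borel e) = (\<integral>s. gam \<beta> c s * exp (- real k * s) \<partial>lborel)"
        using c unfolding G_def by (subst integral_distr) (auto simp: ek integral_real_density)
      moreover have "\<dots> = (\<beta> / (\<beta> + real k)) powr c"
        using nn_integral_gam_exp[OF \<beta> c, of "real k"] c by (subst integral_eq_nn_integral) auto
      ultimately show ?thesis by simp
    qed
  qed
  then have "distr (distr M borel (\<lambda>\<omega>. e (X \<omega>))) borel (\<lambda>y. - ln y) = distr (distr G borel e) borel (\<lambda>y. - ln y)"
    by simp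
  then have "distr M borel X = distr G borel (\<lambda>x. x)"
    by (simp add: distr_distr comp_def e_def)
  also have "\<dots> = G" by (rule distr_id2) simp
  finally show ?thesis by (simp add: G_def)
qed

text \<open>Evaluation of a path is not jointly measurable on the product \<open>\<sigma>\<close>-algebra, so independence
  is used at the times rounded up to \<open>(1 / Suc n) * \<nat>\<close>; path continuity gives the limit.\<close>

lemma (in prob_space)
  fixes B :: "real \<Rightarrow> 'a \<Rightarrow> real" and X :: "'a \<Rightarrow> real" and \<psi> :: "real \<Rightarrow> complex"
  assumes [measurable]: "\<And>s. s \<ge> 0 \<Longrightarrow> B s \<in> borel_measurable M"
    and cont: "\<And>\<omega>. \<omega> \<in> space M \<Longrightarrow> continuous_on {0..} (\<lambda>s. B s \<omega>)"
    and X[measurable]: "X \<in> borel_measurable M" and X0: "\<And>\<omega>. \<omega> \<in> space M \<Longrightarrow> X \<omega> \<ge> 0"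
    and indep: "indep_var (PiM {0..} (\<lambda>_. borel)) (\<lambda>\<omega>. \<lambda>s\<in>{0..}. B s \<omega>) N Y"
    and \<pi>[measurable]: "\<pi> \<in> borel_measurable N" and XY: "\<And>\<omega>. \<omega> \<in> space M \<Longrightarrow> X \<omega> = \<pi> (Y \<omega>)"
    and \<psi>: "continuous_on UNIV \<psi>" and b: "\<And>x. norm (\<psi> x) \<le> C"
  shows measurable_subordination: "(\<lambda>\<omega>. B (X \<omega>) \<omega>) \<in> borel_measurable M"
    and integral_subordination:
      "(\<integral>\<omega>. \<psi> (B (X \<omega>) \<omega>) \<partial>M) = (\<integral>\<omega>. (\<integral>\<omega>'. \<psi> (B (X \<omega>) \<omega>') \<partial>M) \<partial>M)"
proof -
  \<comment> \<open>For each \<open>n\<close> only countably many times occur, so evaluating the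
    path at \<open>h n (X \<omega>)\<close> is a countable case distinction and hence
    measurable.\<close>
  define h where "h n s = real (nat \<lceil>real (Suc n) * s\<rceil>) / real (Suc n)" for n s
  have h0: "h n s \<ge> 0" for n s by (simp add: h_def)
  have h: "(\<lambda>n. h n s) \<longlonglongrightarrow> s" if s: "s \<ge> 0" for s
  proof (rule tendsto_sandwich)
    have "s \<le> h n s \<and> h n s \<le> s + inverse (real (Suc n))" for n
    proof -
      have "0 \<le> real (Suc n) * s" using s by simp
      then have "0 \<le> \<lceil>real (Suc n) * s\<rceil>" by linarith
      then have r: "real (nat \<lceil>real (Suc n) * s\<rceil>) = of_int \<lceil>real (Suc n) * s\<rceil>" by simp
      have "real (Suc n) * s \<le> of_int \<lceil>real (Suc n) * s\<rceil>" "of_int \<lceil>real (Suc n) * s\<rceil> \<le> real (Suc n) * s + 1"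
        by linarith+
      moreover have "(s + inverse N) * N = N * s + 1" if "N > 0" for N
        using that by (simp add: field_simps)
      ultimately show ?thesis
        unfolding h_def r by (simp only: pos_le_divide_eq pos_divide_le_eq of_nat_0_less_iff zero_less_Suc
            mult.commute[of s])
    qed
    then show "eventually (\<lambda>n. s \<le> h n s) sequentially" "eventually (\<lambda>n. h n s \<le> s + inverse (real (Suc n))) sequentially"
      by auto
    show "(\<lambda>n. s + inverse (real (Suc n))) \<longlonglongrightarrow> s"
      using tendsto_add[OF tendsto_const LIMSEQ_inverse_real_of_nat, of s] by simp
  qed simp
  have [measurable]: "\<psi> \<in> borel_measurable borel" using \<psi> by (rule borel_measurable_continuous_onI)
  have path: "(\<lambda>n. B (h n s) \<omega>) \<longlonglongrightarrow> B s \<omega>" if "s \<ge> 0" "\<omega> \<in> space M" for s \<omega>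
    using that h0 by (intro continuous_on_tendsto_compose[OF cont[OF that(2)] h]) auto
  have lim: "(\<lambda>n. \<psi> (B (h n s) \<omega>)) \<longlonglongrightarrow> \<psi> (B s \<omega>)" if "s \<ge> 0" "\<omega> \<in> space M" for s \<omega>
    using \<psi> path[OF that] by (auto simp: continuous_on_eq_continuous_at intro: isCont_tendsto_compose)
  have idx: "(\<lambda>\<omega>. nat \<lceil>real (Suc n) * X \<omega>\<rceil>) \<in> measurable M (count_space UNIV)" for n
    by measurable
  have Bh[measurable]: "(\<lambda>\<omega>. B (h n (X \<omega>)) \<omega>) \<in> borel_measurable M" for n
    unfolding h_def by (rule measurable_compose_countable[OF _ idx]) simp
  show BX[measurable]: "(\<lambda>\<omega>. B (X \<omega>) \<omega>) \<in> borel_measurable M"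
    by (rule borel_measurable_LIMSEQ_metric[where f = "\<lambda>n \<omega>. B (h n (X \<omega>)) \<omega>"]) (use path X0 in auto)
  define g where "g s = (\<integral>\<omega>'. \<psi> (B s \<omega>') \<partial>M)" for s
  have gh[measurable]: "(\<lambda>\<omega>. g (h n (X \<omega>))) \<in> borel_measurable M" for n
    using measurable_compose[OF idx, of "\<lambda>i. g (real i / real (Suc n))" borel n] by (simp add: h_def)
  have glim: "(\<lambda>n. g (h n s)) \<longlonglongrightarrow> g s" if s: "s \<ge> 0" for s
    unfolding g_def
  proof (rule integral_dominated_convergence[where w = "\<lambda>_. C"])
    show "AE \<omega> in M. (\<lambda>n. \<psi> (B (h n s) \<omega>)) \<longlonglongrightarrow> \<psi> (B s \<omega>)" using lim[OF s] by auto
  qed (use b h0 s in auto)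
  have gb: "norm (g s) \<le> C" if "s \<ge> 0" for s
  proof -
    have int: "integrable M (\<lambda>\<omega>. \<psi> (B s \<omega>))" using b that by (intro integrable_const_bound[of _ C]) auto
    have "norm (g s) \<le> (\<integral>\<omega>. norm (\<psi> (B s \<omega>)) \<partial>M)" unfolding g_def by (rule integral_norm_bound)
    also have "\<dots> \<le> (\<integral>\<omega>. C \<partial>M)" using b int by (intro integral_mono) auto
    finally show ?thesis using prob_space by simp
  qed
  have step: "(\<integral>\<omega>. \<psi> (B (h n (X \<omega>)) \<omega>) \<partial>M) = (\<integral>\<omega>. g (h n (X \<omega>)) \<partial>M)" for n
  proof -
    define P where "P = PiM {0..} (\<lambda>_::real. borel :: real measure)"
    define W where "W \<omega> = (\<lambda>s\<in>{0..}. B s \<omega>)" for \<omega>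
    \<comment> \<open>The integrand as a function of the whole path and of \<open>Y\<close>; it
      reads the path at countably many coordinates only, which makes it measurable on the
      product.\<close>
    define F where "F = (\<lambda>(f, y). \<psi> (f (h n (\<pi> y))))"
    have idx2: "(\<lambda>z. nat \<lceil>real (Suc n) * \<pi> (snd z)\<rceil>) \<in> measurable (P \<Otimes>\<^sub>M N) (count_space UNIV)" by measurable
    have F[measurable]: "F \<in> borel_measurable (P \<Otimes>\<^sub>M N)"
    proof -
      have "(\<lambda>z. \<psi> (fst z (real (nat \<lceil>real (Suc n) * \<pi> (snd z)\<rceil>) / real (Suc n)))) \<in> borel_measurable (P \<Otimes>\<^sub>M N)"
      proof (rule measurable_compose_countable[OF _ idx2])
        fix i :: nat
        have [measurable]: "(\<lambda>f. f (real i / real (Suc n))) \<in> borel_measurable P"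
          unfolding P_def by (rule measurable_component_singleton) simp
        show "(\<lambda>z. \<psi> (fst z (real i / real (Suc n)))) \<in> borel_measurable (P \<Otimes>\<^sub>M N)"
          by measurable
      qed
      then show ?thesis by (simp add: F_def h_def case_prod_unfold)
    qed
    have W[measurable]: "W \<in> measurable M P" and Y[measurable]: "Y \<in> measurable M N"
      and joint: "distr M P W \<Otimes>\<^sub>M distr M N Y = distr M (P \<Otimes>\<^sub>M N) (\<lambda>\<omega>. (W \<omega>, Y \<omega>))"
      using indep unfolding indep_var_distribution_eq P_def W_def[abs_def] by auto
    interpret D1: prob_space "distr M P W" by (rule prob_space_distr) simp
    interpret D2: prob_space "distr M N Y" by (rule prob_space_distr) simp
    interpret pair_prob_space "distr M P W" "distr M N Y" ..
    have Fb: "norm (F z) \<le> C" for z using b by (simp add: F_def case_prod_unfold)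
    have "(\<integral>\<omega>. \<psi> (B (h n (X \<omega>)) \<omega>) \<partial>M) = (\<integral>\<omega>. F (W \<omega>, Y \<omega>) \<partial>M)"
      using h0 XY by (intro Bochner_Integration.integral_cong) (auto simp: F_def W_def)
    also have "\<dots> = (\<integral>z. F z \<partial>distr M (P \<Otimes>\<^sub>M N) (\<lambda>\<omega>. (W \<omega>, Y \<omega>)))"
      by (rule integral_distr[symmetric]) auto
    also have "\<dots> = (\<integral>z. F z \<partial>(distr M P W \<Otimes>\<^sub>M distr M N Y))" by (simp add: joint)
    also have "\<dots> = (\<integral>y. (\<integral>f. F (f, y) \<partial>distr M P W) \<partial>distr M N Y)"
    proof -
      have "F \<in> borel_measurable (distr M P W \<Otimes>\<^sub>M distr M N Y)" by simp
      then have "integrable (distr M P W \<Otimes>\<^sub>M distr M N Y) F"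
        using Fb by (intro P.integrable_const_bound[of _ C]) auto
      then show ?thesis using integral_snd[of "\<lambda>f y. F (f, y)"] by simp
    qed
    also have "\<dots> = (\<integral>y. g (h n (\<pi> y)) \<partial>distr M N Y)"
    proof (rule Bochner_Integration.integral_cong[OF refl])
      fix y assume "y \<in> space (distr M N Y)"
      then have "(\<lambda>f. F (f, y)) \<in> borel_measurable P" by simp
      then show "(\<integral>f. F (f, y) \<partial>distr M P W) = g (h n (\<pi> y))"
        using h0 by (subst integral_distr) (auto simp: F_def W_def g_def)
    qed
    also have "\<dots> = (\<integral>\<omega>. g (h n (\<pi> (Y \<omega>))) \<partial>M)"
    proof (rule integral_distr)
      have "(\<lambda>y. nat \<lceil>real (Suc n) * \<pi> y\<rceil>) \<in> measurable N (count_space UNIV)" by measurable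
      then show "(\<lambda>y. g (h n (\<pi> y))) \<in> borel_measurable N"
        using measurable_compose[of "\<lambda>y. nat \<lceil>real (Suc n)
            * \<pi> y\<rceil>" N "count_space UNIV" "\<lambda>i. g (real i / real (Suc n))" borel]
        by (simp add: h_def)
    qed simp
    also have "\<dots> = (\<integral>\<omega>. g (h n (X \<omega>)) \<partial>M)"
      using XY by (intro Bochner_Integration.integral_cong) auto
    finally show ?thesis .
  qed
  have "(\<lambda>n. \<integral>\<omega>. g (h n (X \<omega>)) \<partial>M) \<longlonglongrightarrow> (\<integral>\<omega>. \<psi> (B (X \<omega>) \<omega>) \<partial>M)"
    unfolding step[symmetric]
    by (rule integral_dominated_convergence[where w = "\<lambda>_. C"]) (use b lim X0 in auto)
  moreover have "(\<lambda>n. \<integral>\<omega>. g (h n (X \<omega>)) \<partial>M) \<longlonglongrightarrow> (\<integral>\<omega>. g (X \<omega>) \<partial>M)"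
  proof (rule integral_dominated_convergence[where w = "\<lambda>_. C"])
    show "(\<lambda>\<omega>. g (X \<omega>)) \<in> borel_measurable M"
      by (rule borel_measurable_LIMSEQ_metric[where f = "\<lambda>n \<omega>. g (h n (X \<omega>))"]) (use glim X0 in auto)
    show "AE \<omega> in M. (\<lambda>n. g (h n (X \<omega>))) \<longlonglongrightarrow> g (X \<omega>)" using glim X0 by auto
  qed (use gb h0 in auto)
  ultimately show "(\<integral>\<omega>. \<psi> (B (X \<omega>) \<omega>) \<partial>M) = (\<integral>\<omega>. (\<integral>\<omega>'. \<psi> (B (X \<omega>) \<omega>') \<partial>M) \<partial>M)"
    unfolding g_def by (rule LIMSEQ_unique)
qed

section \<open>The Gaussian density mixed over a gamma distributed time\<close>

lemma drifted_bm_density_eq_normal: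
  "s > 0 \<Longrightarrow> drifted_bm_density \<theta> s = normal_density (\<theta> * s) (sqrt (2 * s))"
  by (simp add: fun_eq_iff drifted_bm_density_def normal_density_def)

text \<open>Integrating over \<open>x\<close> first leaves the gamma density, as the Gaussian has
  mass 1 for \<open>s > 0\<close>. Joint integrability justifies Fubini below and makes the mixture
  finite at almost every \<open>x\<close>.\<close>

lemma integrable_vg_integrand_pair:
  fixes a b \<theta> t :: real
  assumes a: "a > 0" and b: "b > 0" and t: "t > 0"
  shows "integrable (lborel \<Otimes>\<^sub>M lborel) (\<lambda>(x, s). vg_integrand a b \<theta> t x s)"
    and "(\<integral>\<^sup>+y. ennreal (case y of (x, s) \<Rightarrow> vg_integrand a b \<theta> t x s) \<partial>(lborel \<Otimes>\<^sub>M lborel)) = 1"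
proof -
  have c: "a * t > 0" using a t by simp
  have "(\<integral>\<^sup>+y. ennreal (case y of (x, s) \<Rightarrow> vg_integrand a b \<theta> t x s) \<partial>(lborel \<Otimes>\<^sub>M lborel))
     = (\<integral>\<^sup>+s. (\<integral>\<^sup>+x. ennreal (vg_integrand a b \<theta> t x s) \<partial>lborel) \<partial>lborel)"
    by (subst lborel_pair.nn_integral_snd[symmetric]) auto
  also have "\<dots> = (\<integral>\<^sup>+s. ennreal (gam b (a * t) s) \<partial>lborel)"
  proof (rule nn_integral_cong)
    fix s
    show "(\<integral>\<^sup>+x. ennreal (vg_integrand a b \<theta> t x s) \<partial>lborel) = ennreal (gam b (a * t) s)"
    proof (cases "s > 0")
      case True
      interpret prob_space "density lborel (\<lambda>x. ennreal (normal_density (\<theta> * s) (sqrt (2 * s)) x))"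
        using True by (intro prob_space_normal_density) simp
      have "(\<integral>\<^sup>+x. ennreal (normal_density (\<theta> * s) (sqrt (2 * s)) x) \<partial>lborel) = 1"
        using emeasure_space_1 by (simp add: emeasure_density)
      moreover have "(\<integral>\<^sup>+x. ennreal (vg_integrand a b \<theta> t x s) \<partial>lborel)
         = (\<integral>\<^sup>+x. ennreal (gam b (a * t) s) * ennreal (normal_density (\<theta> * s) (sqrt (2 * s)) x) \<partial>lborel)"
        using True c by (intro nn_integral_cong)
          (simp add: vg_integrand_def gamma_density_eq drifted_bm_density_eq_normal ennreal_mult'[symmetric] mult.commute)
      ultimately show ?thesis by (simp add: nn_integral_cmult)
    qed (simp add: vg_integrand_def gamma_density_eq gam_def)
  qed
  finally show nn: "(\<integral>\<^sup>+y. ennreal (case y of (x, s) \<Rightarrow> vg_integrand a b \<theta> t x s) \<partial>(lborel \<Otimes>\<^sub>M lborel)) = 1"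
    using b c by (simp add: nn_integral_gam)
  show "integrable (lborel \<Otimes>\<^sub>M lborel) (\<lambda>(x, s). vg_integrand a b \<theta> t x s)"
    by (rule integrableI_nonneg) (use vg_integrand_nonneg[OF a t] nn in auto)
qed

lemma vg_density_nonneg: "a > 0 \<Longrightarrow> t > 0 \<Longrightarrow> vg_density a b \<theta> t x \<ge> 0"
  unfolding vg_density_altdef by (intro integral_nonneg_AE AE_I2 vg_integrand_nonneg)

lemma measurable_vg_density [measurable]: "vg_density a b \<theta> t \<in> borel_measurable borel"
  unfolding vg_density_altdef[abs_def] by measurable

lemma nn_integral_vg_density:
  fixes a b \<theta> t :: real
  assumes a: "a > 0" and b: "b > 0" and t: "t > 0"
  shows "(\<integral>\<^sup>+x. ennreal (vg_density a b \<theta> t x) \<partial>lborel) = 1"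
proof -
  note I = integrable_vg_integrand_pair[OF a b t, of \<theta>]
  have "AE x in lborel. integrable lborel (\<lambda>s. vg_integrand a b \<theta> t x s)"
    using lborel_pair.AE_integrable_fst[OF I(1)] by simp
  then have "AE x in lborel. ennreal (vg_density a b \<theta> t x) = (\<integral>\<^sup>+s. ennreal (vg_integrand a b \<theta> t x s) \<partial>lborel)"
    by eventually_elim
       (use vg_integrand_nonneg[OF a t] in \<open>auto simp: vg_density_altdef intro!: nn_integral_eq_integral[symmetric]\<close>)
  then have "(\<integral>\<^sup>+x. ennreal (vg_density a b \<theta> t x) \<partial>lborel)
      = (\<integral>\<^sup>+x. (\<integral>\<^sup>+s. ennreal (vg_integrand a b \<theta> t x s) \<partial>lborel) \<partial>lborel)"
    by (rule nn_integral_cong_AE)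
  also have "\<dots> = 1"
    using I(2) by (subst (asm) lborel.nn_integral_fst[symmetric]) auto
  finally show ?thesis .
qed

lemma gamma_subordinator_nonneg:
  assumes "gamma_subordinator M a b H" "t \<ge> 0" "\<omega> \<in> space M"
  shows "H t \<omega> \<ge> 0"
proof -
  have "mono_on {0..} (\<lambda>t. H t \<omega>)" "H 0 \<omega> = 0"
    using assms by (auto simp: gamma_subordinator_def starts_at_zero_def)
  then show ?thesis using mono_onD[of "{0..}" "\<lambda>t. H t \<omega>" 0 t] assms(2) by simp
qed

lemma (in prob_space) gamma_subordinator_distr:
  assumes a: "a > 0" and b: "b > 0" and t: "t > 0" and H: "gamma_subordinator M a b H"
  shows "distr M borel (H t) = density lborel (\<lambda>s. ennreal (gam b (a * t) s))"
proof (rule distr_eq_gam)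
  show "H t \<in> borel_measurable M" using H t by (simp add: gamma_subordinator_def)
  show "H t \<omega> \<ge> 0" if "\<omega> \<in> space M" for \<omega>
    using gamma_subordinator_nonneg[OF H _ that] t by simp
  fix l :: real assume l: "l > 0"
  have "(\<integral>\<omega>. exp (- l * H t \<omega>) \<partial>M) = exp (- t * (a * ln (1 + l / b)))"
    using H t l by (simp add: gamma_subordinator_def)
  also have "1 + l / b = (b + l) / b" using b by (simp add: field_simps)
  also have "ln ((b + l) / b) = - ln (b / (b + l))" using b l by (simp add: ln_div)
  also have "exp (- t * (a * - ln (b / (b + l)))) = (b / (b + l)) powr (a * t)"
    using b l by (simp add: powr_def mult_ac)
  finally show "(\<integral>\<omega>. exp (- l * H t \<omega>) \<partial>M) = (b / (b + l)) powr (a * t)" .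
qed (use a b t in auto)

text \<open>By characteristic functions: \<open>integral_subordination\<close> freezes the random
  time, the law of \<open>H t\<close> turns the outer expectation into an integral against the gamma
  density, and Fubini reassembles \<open>vg_density\<close>.\<close>

lemma (in prob_space) subordinated_distributed:
  assumes a: "a > 0" and b: "b > 0" and t: "t > 0"
    and H: "gamma_subordinator M a b H" and B: "drifted_brownian_motion M \<theta> B"
    and ind: "independent_processes M B H"
  shows "distributed M lborel (subordinated B H t) (\<lambda>x. ennreal (vg_density a b \<theta> t x))"
proof -
  have Bm: "B s \<in> borel_measurable M" if "s \<ge> 0" for s using B that by (simp add: drifted_brownian_motion_def)
  have cont: "continuous_on {0..} (\<lambda>s. B s \<omega>)" if "\<omega> \<in> space M" for \<omega>
    using B that by (simp add: drifted_brownian_motion_def)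
  have B0: "B 0 \<omega> = 0" if "\<omega> \<in> space M" for \<omega>
    using B that by (simp add: drifted_brownian_motion_def starts_at_zero_def)
  have Hm: "H t \<in> borel_measurable M" using H t by (simp add: gamma_subordinator_def)
  have H0: "H t \<omega> \<ge> 0" if "\<omega> \<in> space M" for \<omega>
    using gamma_subordinator_nonneg[OF H _ that] t by simp
  define \<Omega> where "\<Omega> = PiM {0..} (\<lambda>_::real. borel :: real measure)"
  have indep: "indep_var (PiM {0..} (\<lambda>_. borel)) (\<lambda>\<omega>. \<lambda>s\<in>{0..}. B s \<omega>) \<Omega> (\<lambda>\<omega>. \<lambda>s\<in>{0..}. H s \<omega>)"
    using ind by (simp add: independent_processes_def \<Omega>_def)
  have ev: "(\<lambda>f. f t) \<in> borel_measurable \<Omega>" "\<And>\<omega>. \<omega> \<in> space M \<Longrightarrow> H t \<omega> = (\<lambda>f. f t) (\<lambda>s\<in>{0..}. H s \<omega>)"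
    using t by (auto simp: \<Omega>_def)
  have Bdist: "(\<integral>\<omega>. \<psi> (B s \<omega>) \<partial>M) = (\<integral>x. drifted_bm_density \<theta> s x *\<^sub>R \<psi> x \<partial>lborel)"
    if s: "s > 0" and [measurable]: "\<psi> \<in> borel_measurable borel" for s and \<psi> :: "real \<Rightarrow> complex"
  proof -
    have "distributed M lborel (\<lambda>\<omega>. B s \<omega> - B 0 \<omega>) (\<lambda>x. ennreal (drifted_bm_density \<theta> s x))"
      using B s by (auto simp: drifted_brownian_motion_def)
    then have d: "distr M lborel (\<lambda>\<omega>. B s \<omega> - B 0 \<omega>) = density lborel (\<lambda>x. ennreal (drifted_bm_density \<theta> s x))"
      by (rule distributed_distr_eq_density)
    have [measurable]: "B s \<in> borel_measurable M" "B 0 \<in> borel_measurable M" using Bm s by auto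
    have [measurable]: "drifted_bm_density \<theta> s \<in> borel_measurable borel"
      using s by (simp add: drifted_bm_density_eq_normal)
    have "(\<integral>\<omega>. \<psi> (B s \<omega>) \<partial>M) = (\<integral>\<omega>. \<psi> (B s \<omega> - B 0 \<omega>) \<partial>M)"
      using B0 by (intro Bochner_Integration.integral_cong) auto
    also have "\<dots> = (\<integral>x. \<psi> x \<partial>distr M lborel (\<lambda>\<omega>. B s \<omega> - B 0 \<omega>))"
      by (rule integral_distr[symmetric]) auto
    also have "\<dots> = (\<integral>x. drifted_bm_density \<theta> s x *\<^sub>R \<psi> x \<partial>lborel)"
      unfolding d using s by (intro integral_density) (auto simp: drifted_bm_density_eq_normal)
    finally show ?thesis .
  qed
  \<comment> \<open>Measurability does not involve the test function, so the zero function stands in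
    for it.\<close>
  have meas: "subordinated B H t \<in> borel_measurable M"
    unfolding subordinated_def[abs_def]
    by (rule measurable_subordination[where B = B and X = "H t" and N = \<Omega> and Y = "\<lambda>\<omega>. \<lambda>s\<in>{0..}. H s \<omega>" and \<pi>
        = "\<lambda>f. f t" and \<psi> = "\<lambda>_. 0" and C = 0,
          OF Bm cont Hm H0 indep ev]) simp_all
  define D where "D = density lborel (\<lambda>x. ennreal (vg_density a b \<theta> t x))"
  have D: "real_distribution D"
  proof -
    have "prob_space D"
      by (rule prob_spaceI) (simp add: D_def emeasure_density nn_integral_vg_density a b t)
    then show ?thesis by (simp add: real_distribution_def real_distribution_axioms_def D_def)
  qed
  have "distr M borel (subordinated B H t) = D"
  proof (rule Levy_uniqueness[OF real_distribution_distr[OF meas] D], rule ext)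
    fix u :: real
    define \<psi> where "\<psi> x = iexp (u * x)" for x
    have \<psi>c: "continuous_on UNIV \<psi>" unfolding \<psi>_def by (intro continuous_intros)
    have [measurable]: "\<psi> \<in> borel_measurable borel" using \<psi>c by (rule borel_measurable_continuous_onI)
    have \<psi>b: "norm (\<psi> x) \<le> 1" for x by (simp add: \<psi>_def)
    have gm: "(\<lambda>s. \<integral>x. drifted_bm_density \<theta> s x *\<^sub>R \<psi> x \<partial>lborel) \<in> borel_measurable borel"
      unfolding drifted_bm_density_def by measurable
    have pm: "(\<lambda>(x, s). vg_integrand a b \<theta> t x s *\<^sub>R \<psi> x) \<in> borel_measurable (lborel \<Otimes>\<^sub>M lborel)"
      by measurable
    have pair: "integrable (lborel \<Otimes>\<^sub>M lborel) (\<lambda>(x, s). vg_integrand a b \<theta> t x s *\<^sub>R \<psi> x)"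
      by (rule Bochner_Integration.integrable_bound[OF integrable_vg_integrand_pair(1)[OF a b t, of \<theta>] pm])
         (simp add: \<psi>_def case_prod_unfold)
    have "char (distr M borel (subordinated B H t)) u = (\<integral>\<omega>. \<psi> (B (H t \<omega>) \<omega>) \<partial>M)"
      using meas unfolding char_def \<psi>_def by (subst integral_distr) (auto simp: subordinated_def)
    also have "\<dots> = (\<integral>\<omega>. (\<integral>\<omega>'. \<psi> (B (H t \<omega>) \<omega>') \<partial>M) \<partial>M)"
      by (rule integral_subordination[where B = B and X = "H t" and N = \<Omega> and Y = "\<lambda>\<omega>. \<lambda>s\<in>{0..}. H s \<omega>" and \<pi>
          = "\<lambda>f. f t" and \<psi> = \<psi> and C = 1,
          OF Bm cont Hm H0 indep ev \<psi>c \<psi>b])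
    also have "\<dots> = (\<integral>\<omega>. (\<integral>x. drifted_bm_density \<theta> (H t \<omega>) x *\<^sub>R \<psi> x \<partial>lborel) \<partial>M)"
    \<comment> \<open>At time 0 there is no Gaussian density, so the formula for \<open>B s\<close>
      needs \<open>H t > 0\<close>, which holds almost surely. For measurability the event
      \<open>H t = 0\<close> is kept, with the value \<open>\<psi> 0\<close>.\<close>
    proof (rule integral_cong_AE)
      have "AE s in distr M borel (H t). s > 0"
        unfolding gamma_subordinator_distr[OF a b t H] by (subst AE_density) (auto simp: gam_def)
      then have "AE \<omega> in M. H t \<omega> > 0" using Hm by (subst (asm) AE_distr_iff) auto
      then show eq: "AE \<omega> in M. (\<integral>\<omega>'. \<psi> (B (H t \<omega>) \<omega>') \<partial>M) = (\<integral>x. drifted_bm_density \<theta> (H t \<omega>) x *\<^sub>R \<psi> x \<partial>lborel)"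
        by eventually_elim (simp add: Bdist)
      show "(\<lambda>\<omega>. \<integral>x. drifted_bm_density \<theta> (H t \<omega>) x *\<^sub>R \<psi> x \<partial>lborel) \<in> borel_measurable M"
        by (rule measurable_compose[OF Hm gm])
      have "(\<lambda>\<omega>. if H t \<omega> > 0 then (\<integral>x. drifted_bm_density \<theta> (H t \<omega>) x *\<^sub>R \<psi> x \<partial>lborel) else \<psi> 0) \<in> borel_measurable M"
        using measurable_compose[OF Hm gm] Hm by measurable
      also have "?this \<longleftrightarrow> (\<lambda>\<omega>. \<integral>\<omega>'. \<psi> (B (H t \<omega>) \<omega>') \<partial>M) \<in> borel_measurable M"
      proof (rule measurable_cong)
        fix \<omega> assume \<omega>: "\<omega> \<in> space M"
        have "(\<integral>\<omega>'. \<psi> (B 0 \<omega>') \<partial>M) = (\<integral>\<omega>'. \<psi> 0 \<partial>M)"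
          using B0 by (intro Bochner_Integration.integral_cong) auto
        then have "(\<integral>\<omega>'. \<psi> (B 0 \<omega>') \<partial>M) = \<psi> 0" using prob_space by simp
        then show "(if H t \<omega> > 0 then (\<integral>x. drifted_bm_density \<theta> (H t \<omega>) x *\<^sub>R \<psi> x \<partial>lborel) else \<psi> 0)
            = (\<integral>\<omega>'. \<psi> (B (H t \<omega>) \<omega>') \<partial>M)"
          using H0[OF \<omega>] by (auto simp: Bdist)
      qed
      finally show "(\<lambda>\<omega>. \<integral>\<omega>'. \<psi> (B (H t \<omega>) \<omega>') \<partial>M) \<in> borel_measurable M" .
    qed
    also have "\<dots> = (\<integral>s. (\<integral>x. drifted_bm_density \<theta> s x *\<^sub>R \<psi> x \<partial>lborel) \<partial>distr M borel (H t))"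
      by (rule integral_distr[symmetric, OF Hm gm])
    also have "\<dots> = (\<integral>s. gam b (a * t) s *\<^sub>R (\<integral>x. drifted_bm_density \<theta> s x *\<^sub>R \<psi> x \<partial>lborel) \<partial>lborel)"
      unfolding gamma_subordinator_distr[OF a b t H] using gm a t by (intro integral_density) auto
    also have "\<dots> = (\<integral>s. (\<integral>x. vg_integrand a b \<theta> t x s *\<^sub>R \<psi> x \<partial>lborel) \<partial>lborel)"
      by (simp add: vg_integrand_def gamma_density_eq mult.commute flip: integral_scaleR_right)
    also have "\<dots> = (\<integral>x. (\<integral>s. vg_integrand a b \<theta> t x s *\<^sub>R \<psi> x \<partial>lborel) \<partial>lborel)"
      by (rule lborel_pair.Fubini_integral[OF pair])
    also have "\<dots> = (\<integral>x. vg_density a b \<theta> t x *\<^sub>R \<psi> x \<partial>lborel)"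
    proof (rule integral_cong_AE)
      have "AE x in lborel. integrable lborel (\<lambda>s. vg_integrand a b \<theta> t x s)"
        using lborel_pair.AE_integrable_fst[OF integrable_vg_integrand_pair(1)[OF a b t, of \<theta>]] by simp
      then show "AE x in lborel. (\<integral>s. vg_integrand a b \<theta> t x s *\<^sub>R \<psi> x \<partial>lborel) = vg_density a b \<theta> t x *\<^sub>R \<psi> x"
        by eventually_elim (simp add: vg_density_altdef)
    qed measurable
    also have "\<dots> = char D u"
      unfolding char_def D_def \<psi>_def using vg_density_nonneg[OF a t]
      by (subst integral_density) auto
    finally show "char (distr M borel (subordinated B H t)) u = char D u" .
  qed
  moreover have "distr M lborel (subordinated B H t) = distr M borel (subordinated B H t)"
    by (rule distr_cong) auto
  ultimately show ?thesis using meas by (simp add: distributed_def D_def)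
qed

section \<open>The evolution equation and the initial condition\<close>

lemma vg_density_eq_xcorr:
  assumes "a > 0" "b > 0" "t > 0"
  shows "vg_density a b \<theta> t = xcorr (gam (vg_plus_rate b (- \<theta>)) (a * t)) (gam (vg_plus_rate b \<theta>) (a * t))"
  by (simp add: fun_eq_iff xcorr_def vg_density_eq_gam(1)[OF assms] mult.commute)

lemma vg_density_finite_imp:
  assumes "a > 0" "b > 0" "t > 0" "vg_density_finite a b \<theta> t x"
  shows "x \<noteq> 0 \<or> a * t > 1 / 2"
proof (cases "x = 0")
  case True
  then have "integrable lborel (\<lambda>y. gam (vg_plus_rate b \<theta>) (a * t) y * gam (vg_plus_rate b (- \<theta>)) (a * t) y)"
    using assms(4) vg_density_eq_gam(2)[OF assms(1-3)] by simp
  then show ?thesis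
    using gam_product_integrable_imp[OF vg_plus_rate_pos vg_plus_rate_pos] assms by simp
qed simp

text \<open>The Levy tails carry the factor \<open>a\<close>, and the chain rule through
  \<open>c = a * t\<close> yields the same factor. The minus sign in \<open>weyl_minus\<close>
  offsets the opposite sign of the derivative of its integral.\<close>

lemma
  fixes a b \<theta> t x :: real
  assumes a: "a > 0" and b: "b > 0" and t: "t > 0" and fin: "vg_density_finite a b \<theta> t x"
  defines "\<beta>p \<equiv> vg_plus_rate b \<theta>" and "\<beta>m \<equiv> vg_plus_rate b (- \<theta>)"
  shows weyl_plus_integral_vg_density:
      "(weyl_plus_integral a \<beta>p (vg_density a b \<theta> t) has_real_derivative
         - (a * xcorr (gam \<beta>m (a * t)) (dgam \<beta>p (a * t)) x)) (at x)"
    and weyl_minus_integral_vg_density: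
      "(weyl_minus_integral a \<beta>m (vg_density a b \<theta> t) has_real_derivative
         a * xcorr (dgam \<beta>m (a * t)) (gam \<beta>p (a * t)) x) (at x)"
    and vg_density_has_time_derivative:
      "((\<lambda>t. vg_density a b \<theta> t x) has_real_derivative
         - (weyl_plus a \<beta>p (vg_density a b \<theta> t) x + weyl_minus a \<beta>m (vg_density a b \<theta> t) x)) (at t)"
proof -
  define c where "c = a * t"
  have c: "c > 0" using a t by (simp add: c_def)
  have x: "x \<noteq> 0 \<or> c > 1 / 2" using vg_density_finite_imp[OF a b t fin] by (simp add: c_def)
  have \<beta>: "\<beta>p > 0" "\<beta>m > 0" using b by (simp_all add: \<beta>p_def \<beta>m_def vg_plus_rate_pos)
  have eq: "vg_density a b \<theta> t = xcorr (gam \<beta>m (a * t)) (gam \<beta>p (a * t))" if "t > 0" for t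
    unfolding \<beta>p_def \<beta>m_def by (rule vg_density_eq_xcorr[OF a b that])
  show plus: "(weyl_plus_integral a \<beta>p (vg_density a b \<theta> t) has_real_derivative
      - (a * xcorr (gam \<beta>m (a * t)) (dgam \<beta>p (a * t)) x)) (at x)"
    unfolding eq[OF t] using weyl_plus_xcorr_gam(2)[OF \<beta> c x] by (simp add: c_def)
  show minus: "(weyl_minus_integral a \<beta>m (vg_density a b \<theta> t) has_real_derivative
      a * xcorr (dgam \<beta>m (a * t)) (gam \<beta>p (a * t)) x) (at x)"
    unfolding eq[OF t] using weyl_minus_xcorr_gam(2)[OF \<beta> c x] by (simp add: c_def)
  have "((\<lambda>c. xcorr (gam \<beta>m c) (gam \<beta>p c) x) has_real_derivative
      xcorr (gam \<beta>m c) (dgam \<beta>p c) x + xcorr (dgam \<beta>m c) (gam \<beta>p c) x) (at (a * t))"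
    using has_real_derivative_xcorr_gam[OF \<beta> c x] by (simp add: c_def)
  moreover have "((*) a has_real_derivative a) (at t)"
    by (auto intro!: derivative_eq_intros)
  ultimately have "((\<lambda>t. xcorr (gam \<beta>m (a * t)) (gam \<beta>p (a * t)) x) has_real_derivative
      (xcorr (gam \<beta>m c) (dgam \<beta>p c) x + xcorr (dgam \<beta>m c) (gam \<beta>p c) x) * a) (at t)"
    by (rule DERIV_chain2)
  moreover have "(xcorr (gam \<beta>m c) (dgam \<beta>p c) x + xcorr (dgam \<beta>m c) (gam \<beta>p c) x) * a
      = - (weyl_plus a \<beta>p (vg_density a b \<theta> t) x + weyl_minus a \<beta>m (vg_density a b \<theta> t) x)"
    unfolding weyl_plus_def weyl_minus_def DERIV_imp_deriv[OF plus] DERIV_imp_deriv[OF minus]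
    by (simp add: c_def algebra_simps)
  \<comment> \<open>The correlation formula is available for positive times, so the derivative is
    transferred by equality near \<open>t\<close>.\<close>
  moreover have "eventually (\<lambda>s. vg_density a b \<theta> s x = xcorr (gam \<beta>m (a * s)) (gam \<beta>p (a * s)) x) (nhds t)"
    using eventually_nhds_in_open[of "{0<..}" t] t by (auto elim!: eventually_mono simp: eq)
  ultimately show "((\<lambda>t. vg_density a b \<theta> t x) has_real_derivative
      - (weyl_plus a \<beta>p (vg_density a b \<theta> t) x + weyl_minus a \<beta>m (vg_density a b \<theta> t) x)) (at t)"
    by (subst DERIV_cong_ev[OF refl _ refl]) auto
qed

lemma vg_density_weyl_domain:
  assumes "a > 0" "b > 0" "t > 0"
  shows "weyl_plus_domain a (vg_plus_rate b \<theta>) (vg_density a b \<theta> t)"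
    and "weyl_minus_domain a (vg_plus_rate b (- \<theta>)) (vg_density a b \<theta> t)"
  unfolding vg_density_eq_xcorr[OF assms]
  using assms by (auto intro!: weyl_plus_xcorr_gam(1) weyl_minus_xcorr_gam(1) vg_plus_rate_pos)

text \<open>The integral is the expectation of \<open>\<phi>\<close> at the subordinated process.
  \<open>H\<close> is right continuous, \<open>B\<close> is continuous and both start at 0, so the
  process tends to 0 along every path and bounded convergence applies; no estimate of the density is
  involved.\<close>

lemma (in prob_space) vg_density_tendsto_dirac:
  fixes \<phi> :: "real \<Rightarrow> real"
  assumes a: "a > 0" and b: "b > 0"
    and H: "gamma_subordinator M a b H" and B: "drifted_brownian_motion M \<theta> B"
    and ind: "independent_processes M B H"
    and \<phi>: "continuous_on UNIV \<phi>" and bdd: "bounded (range \<phi>)"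
  shows "((\<lambda>t. LBINT x. vg_density a b \<theta> t x * \<phi> x) \<longlongrightarrow> \<phi> 0) (at_right 0)"
  unfolding tendsto_at_iff_sequentially comp_def
proof (intro allI impI)
  fix \<tau> :: "nat \<Rightarrow> real"
  assume \<tau>: "\<forall>i. \<tau> i \<in> {0<..} - {0}" "\<tau> \<longlonglongrightarrow> 0"
  have \<tau>0: "\<tau> i > 0" for i using \<tau>(1) by auto
  have [measurable]: "\<phi> \<in> borel_measurable borel" using \<phi> by (rule borel_measurable_continuous_onI)
  obtain C where C: "\<And>x. \<bar>\<phi> x\<bar> \<le> C" using bdd by (auto simp: bounded_iff)
  have dist: "distributed M lborel (subordinated B H (\<tau> i)) (\<lambda>x. ennreal (vg_density a b \<theta> (\<tau> i) x))" for i
    by (rule subordinated_distributed[OF a b \<tau>0 H B ind])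
  have [measurable]: "subordinated B H (\<tau> i) \<in> borel_measurable M" for i
    using distributed_measurable[OF dist[of i]] by simp
  have "(LBINT x. vg_density a b \<theta> (\<tau> i) x * \<phi> x) = (\<integral>\<omega>. \<phi> (subordinated B H (\<tau> i) \<omega>) \<partial>M)" for i
    using vg_density_nonneg[OF a \<tau>0] by (intro distributed_integral[OF dist]) auto
  moreover have "(\<lambda>i. \<integral>\<omega>. \<phi> (subordinated B H (\<tau> i) \<omega>) \<partial>M) \<longlonglongrightarrow> (\<integral>\<omega>. \<phi> 0 \<partial>M)"
  proof (rule integral_dominated_convergence[where w = "\<lambda>_. C"])
    show "AE \<omega> in M. (\<lambda>i. \<phi> (subordinated B H (\<tau> i) \<omega>)) \<longlonglongrightarrow> \<phi> 0"
    proof (rule AE_I2)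
      fix \<omega> assume \<omega>: "\<omega> \<in> space M"
      have z: "H 0 \<omega> = 0" "B 0 \<omega> = 0"
        using H B \<omega> by (auto simp: gamma_subordinator_def drifted_brownian_motion_def starts_at_zero_def)
      have "((\<lambda>t. H t \<omega>) \<longlongrightarrow> H 0 \<omega>) (at_right 0)"
        using H \<omega> by (auto simp: gamma_subordinator_def continuous_within)
      then have "(\<lambda>i. H (\<tau> i) \<omega>) \<longlonglongrightarrow> 0"
        using \<tau> z unfolding tendsto_at_iff_sequentially comp_def by metis
      moreover have "continuous_on {0..} (\<lambda>s. B s \<omega>)"
        using B \<omega> by (simp add: drifted_brownian_motion_def)
      moreover have "H (\<tau> i) \<omega> \<ge> 0" for i
        using gamma_subordinator_nonneg[OF H _ \<omega>] \<tau>0[of i] by simp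
      ultimately have "(\<lambda>i. B (H (\<tau> i) \<omega>) \<omega>) \<longlonglongrightarrow> B 0 \<omega>"
        by (intro continuous_on_tendsto_compose[where f = "\<lambda>s. B s \<omega>"]) auto
      then have "(\<lambda>i. \<phi> (B (H (\<tau> i) \<omega>) \<omega>)) \<longlonglongrightarrow> \<phi> 0"
        using \<phi> z by (auto simp: continuous_on_eq_continuous_at intro: isCont_tendsto_compose)
      then show "(\<lambda>i. \<phi> (subordinated B H (\<tau> i) \<omega>)) \<longlonglongrightarrow> \<phi> 0"
        by (simp add: subordinated_def)
    qed
  qed (use C in auto)
  ultimately show "(\<lambda>i. LBINT x. vg_density a b \<theta> (\<tau> i) x * \<phi> x) \<longlonglongrightarrow> \<phi> 0"
    using prob_space by simp
qed

text \<open>The Dirac mass has no density, so the initial condition appears as the law at time 0 and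
  as weak convergence tested on bounded continuous functions.\<close>

theorem corollary3p2:
  fixes a b \<theta> :: real
    and M :: "'w measure"
    and B H :: "real \<Rightarrow> 'w \<Rightarrow> real"
  assumes "a > 0" and "b > 0"
    and "prob_space M"
    and "gamma_subordinator M a b H"
    and "drifted_brownian_motion M \<theta> B"
    and "independent_processes M B H"
  defines "p \<equiv> vg_density a b \<theta>"
    and "\<beta>p \<equiv> sqrt (\<theta>\<^sup>2 / 4 + b) - \<theta> / 2"
    and "\<beta>m \<equiv> sqrt (\<theta>\<^sup>2 / 4 + b) + \<theta> / 2"
  shows
    "(\<forall>t>0. distributed M lborel (subordinated B H t) (\<lambda>x. ennreal (p t x))) \<and>
     (\<forall>t>0. weyl_plus_domain a \<beta>p (p t) \<and> weyl_minus_domain a \<beta>m (p t)) \<and>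
     (\<forall>t>0. \<forall>x. vg_density_finite a b \<theta> t x \<longrightarrow>
        weyl_plus_integral a \<beta>p (p t) field_differentiable (at x) \<and>
        weyl_minus_integral a \<beta>m (p t) field_differentiable (at x) \<and>
        ((\<lambda>t. p t x) has_real_derivative
           - (weyl_plus a \<beta>p (p t) x + weyl_minus a \<beta>m (p t) x)) (at t)) \<and>
     distr M borel (subordinated B H 0) = return borel 0 \<and>
     (\<forall>\<phi> :: real \<Rightarrow> real. continuous_on UNIV \<phi> \<longrightarrow> bounded (range \<phi>) \<longrightarrow>
        ((\<lambda>t. LBINT x. p t x * \<phi> x) \<longlongrightarrow> \<phi> 0) (at_right 0))"
proof -
  interpret prob_space M by (rule assms(3))
  have rates: "\<beta>p = vg_plus_rate b \<theta>" "\<beta>m = vg_plus_rate b (- \<theta>)"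
    by (simp_all add: \<beta>p_def \<beta>m_def vg_plus_rate_def)
  have "distr M borel (subordinated B H 0) = distr M borel (\<lambda>_. 0)"
    using assms(4,5)
    by (intro distr_cong)
       (auto simp: subordinated_def gamma_subordinator_def drifted_brownian_motion_def starts_at_zero_def)
  also have "\<dots> = return borel 0" by (rule distr_const) simp
  finally have start: "distr M borel (subordinated B H 0) = return borel 0" .
  show ?thesis
    unfolding p_def rates
  proof (intro conjI allI impI start)
    fix t x :: real
    assume "t > 0" and "vg_density_finite a b \<theta> t x"
    note diff = this
    show "weyl_plus_integral a (vg_plus_rate b \<theta>) (vg_density a b \<theta> t) field_differentiable (at x)"
      using weyl_plus_integral_vg_density[OF assms(1,2) diff] by (auto simp: field_differentiable_def)
    show "weyl_minus_integral a (vg_plus_rate b (- \<theta>)) (vg_density a b \<theta> t) field_differentiable (at x)"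
      using weyl_minus_integral_vg_density[OF assms(1,2) diff] by (auto simp: field_differentiable_def)
  qed (use assms(1-6) in \<open>auto intro!: subordinated_distributed vg_density_weyl_domain
      vg_density_tendsto_dirac vg_density_has_time_derivative simp del: minus_add_distrib\<close>)
qed

end
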